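(* For $0<|q|<1$, \begin{align*} \overline{r}_0(2)+\overline{r}_3(2)&=\tfrac{4}{9}\rho(q)-\tfrac{16}{9}\omega(q)+M(q),\\ \overline{r}_1(2)-\overline{r}_3(2)&=2\omega(q),\\ \overline{r}_2(2)+\overline{r}_3(2)&=-\tfrac{2}{9}\rho(q)-\tfrac{10}{9}\omega(q)+M(q), \end{align*} where $M(q)=\dfrac{4J_{6}^{12}}{3J_{1,6}^6J_{2}^4J_{3,6}^3}$.
   Context: An overpartition of a non-negative integer $n$ is a partition of $n$ in which the first occurrence of each distinct part may be overlined; the empty overpartition of $0$ is counted and has rank $0$. The rank of an overpartition is its largest part minus its number of parts. $\overline N(s,6,n)$ is the number of overpartitions of $n$ with rank congruent to $s$ modulo $6$, and $\overline r_s(d)=\sum_{n\ge0}\overline N(s,6,3n+d)q^n$. Notation: $(a;q)_n=\prod_{i=0}^{n-1}(1-aq^i)$, $(a;q)_\infty=\prod_{n\ge0}(1-aq^n)$, $j(z;q)=(z;q)_\infty(q/z;q)_\infty(q;q)_\infty$, $J_{a,m}=j(q^a;q^m)$, $J_m=(q^m;q^m)_\infty$. The third order mock theta functions are $\omega(q)=\sum_{n\ge0}\frac{q^{2n(n+1)}}{(q;q^2)_{n+1}^2}$ and $\rho(q)=\sum_{n\ge0}\frac{q^{2n(n+1)}(q;q^2)_{n+1}}{(q^3;q^6)_{n+1}}$. *)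

theory Defs
  imports "HOL-Analysis.Analysis" "HOL-Number_Theory.Cong" "HOL-Library.Multiset"
begin

(* An overpartition is encoded as a pair (A, S): A is the multiset of its parts and S is the
   set of those part sizes whose first occurrence is overlined. *)
definition overpartitions :: "nat \<Rightarrow> (nat multiset \<times> nat set) set" where
  "overpartitions n = {(A, S). 0 \<notin># A \<and> sum_mset A = n \<and> S \<subseteq> set_mset A}"

fun overpartition_rank :: "nat multiset \<times> nat set \<Rightarrow> int" where
  "overpartition_rank (A, S) =
     (if A = {#} then 0 else int (Max (set_mset A)) - int (size A))"

definition Nbar :: "int \<Rightarrow> nat \<Rightarrow> nat \<Rightarrow> nat" where
  "Nbar s m n = card {p \<in> overpartitions n. [overpartition_rank p = s] (mod int m)}"

definition rbar :: "int \<Rightarrow> nat \<Rightarrow> complex \<Rightarrow> complex" where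
  "rbar s d q = (\<Sum>n. of_nat (Nbar s 6 (3 * n + d)) * q ^ n)"

definition qpoch :: "complex \<Rightarrow> complex \<Rightarrow> nat \<Rightarrow> complex" where
  "qpoch a q n = (\<Prod>i<n. 1 - a * q ^ i)"

definition qpoch_inf :: "complex \<Rightarrow> complex \<Rightarrow> complex" where
  "qpoch_inf a q = (\<Prod>i. 1 - a * q ^ i)"

definition jtheta :: "complex \<Rightarrow> complex \<Rightarrow> complex" where
  "jtheta z q = qpoch_inf z q * qpoch_inf (q / z) q * qpoch_inf q q"

definition J2 :: "nat \<Rightarrow> nat \<Rightarrow> complex \<Rightarrow> complex" where
  "J2 a m q = jtheta (q ^ a) (q ^ m)"

definition J1 :: "nat \<Rightarrow> complex \<Rightarrow> complex" where
  "J1 m q = qpoch_inf (q ^ m) (q ^ m)"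

definition mock_omega :: "complex \<Rightarrow> complex" where
  "mock_omega q = (\<Sum>n. q ^ (2 * n * (n + 1)) / (qpoch q (q ^ 2) (n + 1)) ^ 2)"

definition mock_rho :: "complex \<Rightarrow> complex" where
  "mock_rho q =
     (\<Sum>n. q ^ (2 * n * (n + 1)) * qpoch q (q ^ 2) (n + 1) / qpoch (q ^ 3) (q ^ 6) (n + 1))"

definition M_quot :: "complex \<Rightarrow> complex" where
  "M_quot q = 4 * J1 6 q ^ 12 / (3 * J2 1 6 q ^ 6 * J1 2 q ^ 4 * J2 3 6 q ^ 3)"

end

theory Submission
  imports Defs
begin

text \<open>Summing over the largest part and expanding in partial fractions turns the rank generating
  function \<open>R(z; q)\<close> of overpartitions into a Lambert series. Let \<open>w\<close> be a primitive cube root of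
  unity, so that \<open>- w\<^sup>2\<close> is a primitive sixth root of unity. Then \<open>3 R(- w\<^sup>2) + R(w)\<close> is a theta
  quotient, \<open>R(1)\<close> is the reciprocal of a theta function, and \<open>3 R(- w\<^sup>2) - R(w)\<close> is a constant
  plus an Appell sum divided by \<open>J\<^sub>6\<close>. The exponents congruent to 2 modulo 3 are extracted by
  averaging over \<open>q, w q, w\<^sup>2 q\<close>. As \<open>J\<^sub>6\<close> is a function of \<open>q\<^sup>3\<close>, the averaging only concerns
  theta functions and the Appell sum, and turns the latter into Appell sums in \<open>q\<^sup>3\<close>. By Watson's
  identity, \<open>J\<^sub>2 \<omega> = U + 2 V\<close> and \<open>J\<^sub>2 \<rho> = U - V\<close> with Appell sums \<open>U\<close>, \<open>V\<close> of the same
  kind, and \<open>U\<close> is a theta quotient. A sixth root of unity filter concludes.\<close>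

section \<open>Theta functions and Appell sums\<close>

text \<open>The generating function at \<open>z = - 1\<close> is never evaluated: its contribution
  cancels in each of the three combinations of the theorem. The weights 3 and 1 in the sum and the
  difference balance the factor \<open>2 * (1 - z) * (1 - 1 / z)\<close>, which equals 2 at the
  primitive sixth roots of unity and 6 at the primitive cube roots. The obstacle is the prefactor of
  the Lambert series, the reciprocal of a theta function in q that does not survive the trisection.
  It is exchanged by means of a symmetric double series \<open>B\<close> that equals a theta
  function times an Appell sum in either of its two arguments; a three-term relation for
  \<open>B\<close> then brings the remaining Appell sum to \<open>U\<close> and \<open>V\<close>.
  Identities of theta functions and Appell sums are obtained by rearranging absolutely convergent
  series, not from elliptic function theory. The fractions 4/9, 16/9, 2/9 and 10/9 come from
  eliminating the theta quotient through
  \<open>U / J 2 = (2 * mock_rho q + mock_omega q) / 3\<close>.\<close>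

lemma summable_on_int:
  fixes f :: "int \<Rightarrow> 'a :: {uniform_topological_group_add, topological_comm_monoid_add, ab_group_add, complete_uniform_space}"
  assumes "(\<lambda>n::nat. f (int n)) summable_on UNIV" "(\<lambda>n::nat. f (- int n)) summable_on UNIV"
  shows "f summable_on UNIV"
proof -
  have "f summable_on range int"
    using assms(1) by (subst summable_on_reindex) (auto simp: o_def)
  moreover have "f summable_on range (\<lambda>n. - int n)"
    using assms(2) by (subst summable_on_reindex) (auto simp: o_def inj_on_def)
  moreover have "range int \<union> range (\<lambda>n. - int n) = UNIV"
  proof -
    have "x \<in> range int \<union> range (\<lambda>n. - int n)" for x
      by (cases x rule: int_cases2) auto
    thus ?thesis by auto
  qed
  ultimately show ?thesis using summable_on_union[of f "range int" "range (\<lambda>n. - int n)"] by simp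
qed

lemma infsum_int_shift: "(\<Sum>\<^sub>\<infinity>n. f (n + k)) = (\<Sum>\<^sub>\<infinity>n. f (n::int))"
  by (rule infsum_reindex_bij_witness[of _ "\<lambda>n. n - k" "\<lambda>n. n + k"]) auto

lemma summable_int_shift: "(\<lambda>n. f (n + k)) summable_on UNIV \<longleftrightarrow> f summable_on (UNIV :: int set)"
  by (rule summable_on_reindex_bij_witness[of _ "\<lambda>n. n - k" "\<lambda>n. n + k"]) auto

lemma infsum_int_reflect: "(\<Sum>\<^sub>\<infinity>n. f (k - n)) = (\<Sum>\<^sub>\<infinity>n. f (n::int))"
  by (rule infsum_reindex_bij_witness[of _ "\<lambda>n. k - n" "\<lambda>n. k - n"]) auto

lemma abs_summable_prod:
  fixes f :: "'a \<Rightarrow> complex" and g :: "'b \<Rightarrow> complex"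
  assumes "f summable_on A" "g summable_on B"
  shows "(\<lambda>p. norm (case p of (x, y) \<Rightarrow> f x * g y)) summable_on A \<times> B"
proof -
  have f: "(\<lambda>x. norm (f x)) summable_on A" and g: "(\<lambda>y. norm (g y)) summable_on B"
    using assms by (simp_all add: summable_on_iff_abs_summable_on_complex)
  have "(\<lambda>x. norm (\<Sum>\<^sub>\<infinity>y\<in>B. norm (f x * g y))) = (\<lambda>x. norm (f x) * norm (\<Sum>\<^sub>\<infinity>y\<in>B. norm (g y)))"
    by (simp add: norm_mult infsum_cmult_right' abs_mult)
  thus ?thesis using f g
    by (subst Infinite_Sum.abs_summable_on_Sigma_iff) (auto simp: norm_mult intro: summable_on_cmult_right summable_on_cmult_left)
qed

lemma summable_prod_bounded:
  fixes f :: "'a \<Rightarrow> complex" and g :: "'b \<Rightarrow> complex"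
  assumes "f summable_on UNIV" "g summable_on UNIV" "\<And>x y. norm (c x y) \<le> C"
  shows "(\<lambda>(x, y). f x * g y * c x y) summable_on UNIV"
proof -
  have "(\<lambda>p. norm (case p of (x, y) \<Rightarrow> f x * g y)) summable_on UNIV"
    using abs_summable_prod[OF assms(1,2)] by simp
  hence "(\<lambda>p. C * norm (f (fst p) * g (snd p))) summable_on UNIV"
    by (intro summable_on_cmult_right) (simp add: case_prod_unfold)
  moreover have "norm (f (fst p) * g (snd p) * c (fst p) (snd p)) \<le> C * norm (f (fst p) * g (snd p))" for p
    using mult_left_mono[OF assms(3)[of "fst p" "snd p"], of "norm (f (fst p) * g (snd p))"]
    by (simp add: norm_mult mult_ac)
  ultimately have "(\<lambda>p. norm (case p of (x, y) \<Rightarrow> f x * g y * c x y)) summable_on UNIV"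
    unfolding case_prod_unfold by (rule Infinite_Sum.abs_summable_on_comparison_test')
  thus ?thesis using abs_summable_summable by blast
qed

lemma infsum_prod:
  fixes f :: "'a \<Rightarrow> complex" and g :: "'b \<Rightarrow> complex"
  assumes "f summable_on UNIV" "g summable_on UNIV"
  shows "(\<Sum>\<^sub>\<infinity>(x, y). f x * g y) = (\<Sum>\<^sub>\<infinity>x. f x) * (\<Sum>\<^sub>\<infinity>y. g y)"
proof -
  have "(\<lambda>(x, y). f x * g y) summable_on Sigma UNIV (\<lambda>_. UNIV)"
    using summable_prod_bounded[OF assms, of "\<lambda>_ _. 1" 1] by simp
  from infsum_Sigma_banach[OF this] show ?thesis
    by (simp add: infsum_cmult_right' infsum_cmult_left')
qed

section \<open>Triangular exponents and bilateral theta series\<close>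

definition tri :: "int \<Rightarrow> int" where "tri n = n * (n - 1) div 2"

text \<open>Exponent identities for \<open>tri\<close> are proved after doubling, which removes the
  division.\<close>

lemma two_tri: "2 * tri n = n * (n - 1)"
  unfolding tri_def by (simp add: even_mult_iff)

lemma tri_add: "tri (m + n) = tri m + tri n + m * n"
proof -
  have "2 * tri (m + n) = 2 * (tri m + tri n + m * n)"
    unfolding distrib_left two_tri by (simp add: algebra_simps two_tri)
  thus ?thesis by simp
qed

lemma tri_simps [simp]: "tri 0 = 0" "tri 1 = 0" "tri (-1) = 1"
  by (auto simp: tri_def)

lemma tri_reflect: "tri (1 - n) = tri n"
proof -
  have "2 * tri (1 - n) = 2 * tri n" unfolding two_tri by (simp add: algebra_simps)
  thus ?thesis by simp
qed

lemma tri_nonneg: "tri n \<ge> 0"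
proof -
  have "n * (n - 1) \<ge> 0" by (cases "n \<ge> 1") (auto simp: mult_nonpos_nonpos)
  thus ?thesis using two_tri[of n] by linarith
qed

definition qt :: "complex \<Rightarrow> int \<Rightarrow> complex" where
  "qt Q n = (-1) powi n * Q powi tri n"

text \<open>The nome comes first here and second in \<open>jtheta\<close>: the triple product identity below
  reads \<open>theta Q z = jtheta z Q\<close>.\<close>

definition theta :: "complex \<Rightarrow> complex \<Rightarrow> complex" where
  "theta Q z = (\<Sum>\<^sub>\<infinity>n. qt Q n * z powi n)"

text \<open>The Appell-Lerch sum without its usual normalisation: in the common notation it is
  \<open>theta Q y\<close> times \<open>m(Q x / y, Q, y)\<close>.\<close>

definition appell :: "complex \<Rightarrow> complex \<Rightarrow> complex \<Rightarrow> complex" where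
  "appell Q x y = (\<Sum>\<^sub>\<infinity>n. qt Q n * y powi n / (1 - x * Q powi n))"

lemma qt_0 [simp]: "qt Q 0 = 1" by (simp add: qt_def)

lemma qt_reflect: "qt Q (1 - n) = - qt Q n"
proof -
  have "(-1 :: complex) powi (1 - n) = - ((-1) powi n)"
    by (cases "even n") (auto simp: power_int_minus_left)
  thus ?thesis by (simp add: qt_def tri_reflect)
qed

text \<open>The nome is a locale parameter because the results are also needed at powers of
  \<open>Q\<close>, at a cube root of \<open>Q\<close> and at its rotations by cube roots of
  unity.\<close>

locale nome =
  fixes Q :: complex
  assumes nz [simp]: "Q \<noteq> 0" and lt1: "norm Q < 1"
begin

lemma qt_add1: "qt Q (n + 1) = - (Q powi n * qt Q n)"
  by (simp add: qt_def tri_add power_int_add)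

lemma qt_minus1: "qt Q (n - 1) = - (Q powi (1 - n) * qt Q n)"
proof -
  have "qt Q n = - (Q powi (n - 1) * qt Q (n - 1))" using qt_add1[of "n - 1"] by simp
  hence "Q powi (1 - n) * qt Q n = - (Q powi (1 - n) * Q powi (n - 1) * qt Q (n - 1))" by simp
  thus ?thesis by (simp flip: power_int_add)
qed

lemma qt_nz [simp]: "qt Q n \<noteq> 0" by (simp add: qt_def)

lemma summable_ratio_zero:
  fixes f :: "nat \<Rightarrow> complex"
  assumes "\<And>n. norm (f (Suc n)) = norm Q ^ n * c * norm (f n)"
  shows "f summable_on UNIV"
proof -
  have "(\<lambda>n. norm Q ^ n * c) \<longlonglongrightarrow> 0 * c"
    using lt1 by (intro tendsto_mult LIMSEQ_power_zero tendsto_const) auto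
  hence "eventually (\<lambda>n. norm Q ^ n * c < 1/2) sequentially"
    by (intro order_tendstoD(2)) auto
  then obtain N where N: "\<And>n. n \<ge> N \<Longrightarrow> norm Q ^ n * c < 1/2"
    by (auto simp: eventually_at_top_linorder)
  have "summable (\<lambda>n. norm (f n))"
  proof (rule summable_ratio_test[of "1/2" N])
    fix n assume "n \<ge> N"
    hence "norm Q ^ n * c * norm (f n) \<le> 1/2 * norm (f n)"
      using N[of n] by (intro mult_right_mono) auto
    thus "norm (norm (f (Suc n))) \<le> 1/2 * norm (norm (f n))"
      unfolding assms[symmetric] by simp
  qed auto
  thus ?thesis by (rule norm_summable_imp_summable_on)
qed

lemma theta_summable:
  assumes "z \<noteq> 0"
  shows "(\<lambda>n. qt Q n * z powi n) summable_on UNIV"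
proof (rule summable_on_int)
  show "(\<lambda>n. qt Q (int n) * z powi int n) summable_on UNIV"
  proof (rule summable_ratio_zero[of _ "norm z"])
    fix n show "norm (qt Q (int (Suc n)) * z powi int (Suc n)) =
        norm Q ^ n * norm z * norm (qt Q (int n) * z powi int n)"
      using qt_add1[of "int n"] by (simp add: norm_mult norm_power norm_power_int power_int_add mult_ac add.commute)
  qed
  show "(\<lambda>n. qt Q (- int n) * z powi (- int n)) summable_on UNIV"
  proof (rule summable_ratio_zero[of _ "norm Q / norm z"])
    fix n show "norm (qt Q (- int (Suc n)) * z powi (- int (Suc n))) =
        norm Q ^ n * (norm Q / norm z) * norm (qt Q (- int n) * z powi (- int n))"
    proof -
      have "qt Q (- int (Suc n)) = - (Q ^ Suc n * qt Q (- int n))"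
      proof -
        have "- int (Suc n) = - int n - 1" by simp
        thus ?thesis using qt_minus1[of "- int n"] by (simp only:) (simp add: power_int_add)
      qed
      moreover have "z powi (- int (Suc n)) = z powi (- int n) / z"
        unfolding power_int_minus power_int_of_nat using assms by (simp add: divide_simps)
      ultimately show ?thesis by (simp add: norm_mult norm_power norm_divide mult_ac)
    qed
  qed
qed

lemma theta_bounded_summable:
  assumes "z \<noteq> 0" "\<And>n. norm (c n) \<le> C"
  shows "(\<lambda>n. qt Q n * z powi n * c n) summable_on UNIV"
proof -
  have "(\<lambda>n. norm (qt Q n * z powi n)) summable_on UNIV"
    using theta_summable[OF assms(1)] by (simp add: summable_on_iff_abs_summable_on_complex)
  hence "(\<lambda>n. C * norm (qt Q n * z powi n)) summable_on UNIV"
    by (intro summable_on_cmult_right)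
  moreover have "norm (qt Q n * z powi n * c n) \<le> C * norm (qt Q n * z powi n)" for n
    using mult_left_mono[OF assms(2)[of n], of "norm (qt Q n * z powi n)"]
    by (simp add: norm_mult mult_ac)
  ultimately have "(\<lambda>n. norm (qt Q n * z powi n * c n)) summable_on UNIV"
    by (rule Infinite_Sum.abs_summable_on_comparison_test')
  thus ?thesis by (rule abs_summable_summable)
qed

lemma theta_mult_Q:
  assumes "z \<noteq> 0" shows "theta Q (Q * z) = - theta Q z / z"
proof -
  have "theta Q (Q * z) = (\<Sum>\<^sub>\<infinity>n. (- 1 / z) * (qt Q (n + 1) * z powi (n + 1)))"
    unfolding theta_def using assms
    by (intro infsum_cong) (simp add: qt_add1 power_int_add power_int_mult_distrib)
  also have "\<dots> = (- 1 / z) * theta Q z"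
    unfolding theta_def infsum_cmult_right' by (subst infsum_int_shift) simp
  finally show ?thesis by simp
qed

lemma theta_inverse:
  assumes "z \<noteq> 0" shows "theta Q (1 / z) = - theta Q z / z"
proof -
  have "theta Q (1 / z) = (\<Sum>\<^sub>\<infinity>n. qt Q (1 - n) * (1 / z) powi (1 - n))"
    unfolding theta_def by (rule infsum_int_reflect[symmetric])
  also have "\<dots> = (\<Sum>\<^sub>\<infinity>n. (- 1 / z) * (qt Q n * z powi n))"
    using assms by (intro infsum_cong)
      (simp add: qt_reflect power_int_diff power_int_divide_distrib)
  also have "\<dots> = (- 1 / z) * theta Q z" unfolding theta_def by (rule infsum_cmult_right')
  finally show ?thesis by simp
qed

lemma theta_1 [simp]: "theta Q 1 = 0"
  using theta_inverse[of 1] by simp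

text \<open>The functional equations carry the zero at 1 to every integer power of
  \<open>Q\<close>.\<close>

lemma theta_Q_pow [simp]: "theta Q (Q powi s) = 0"
proof -
  have *: "theta Q (Q ^ n) = 0" for n :: nat
  proof (induction n)
    case (Suc n)
    then show ?case using theta_mult_Q[of "Q ^ n"] by simp
  qed auto
  show ?thesis
  proof (cases "s \<ge> 0")
    case True
    thus ?thesis using *[of "nat s"] by (simp add: power_int_def)
  next
    case False
    thus ?thesis using *[of "nat (-s)"] theta_inverse[of "Q ^ nat (-s)"]
      by (simp add: power_int_def field_simps)
  qed
qed

text \<open>The coefficients of \<open>theta Q z / (1 - Q powi m / z)\<close>. The bound on \<open>h s\<close> for negative \<open>s\<close>
  is due to the vanishing of \<open>theta Q (Q powi s)\<close>, the sum over all integers.\<close>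

definition h :: "int \<Rightarrow> complex" where
  "h s = (\<Sum>\<^sub>\<infinity>j\<in>{0..}. qt Q j * Q powi (j * s))"

lemma theta_summable':
  "(\<lambda>j. qt Q j * Q powi (j * s)) summable_on X"
proof -
  have "(\<lambda>j. qt Q j * Q powi (j * s)) summable_on UNIV"
    using theta_summable[of "Q powi s"] by (simp add: power_int_mult mult.commute[of _ s])
  thus ?thesis by (rule summable_on_subset_banach) auto
qed

lemma h_alt: "h s = - (\<Sum>\<^sub>\<infinity>j\<in>{..<0}. qt Q j * Q powi (j * s))"
proof -
  have "(\<Sum>\<^sub>\<infinity>j\<in>{0..} \<union> {..<0}. qt Q j * Q powi (j * s)) =
      h s + (\<Sum>\<^sub>\<infinity>j\<in>{..<0}. qt Q j * Q powi (j * s))"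
    unfolding h_def by (intro infsum_Un_disjoint theta_summable') auto
  moreover have "{0..} \<union> {..<0} = (UNIV :: int set)" by auto
  moreover have "(\<Sum>\<^sub>\<infinity>j. qt Q j * Q powi (j * s)) = theta Q (Q powi s)"
    unfolding theta_def by (simp add: power_int_mult mult.commute[of _ s])
  ultimately show ?thesis by (simp add: eq_neg_iff_add_eq_0)
qed

text \<open>Split off the term \<open>j = 0\<close> and shift the rest by one. The recurrence says
  that multiplying by \<open>1 - Q powi m / z\<close> undoes the weight \<open>h\<close> in
  \<open>theta_divide\<close>.\<close>

lemma h_rec: "h s + Q powi s * h (s + 1) = 1"
proof -
  have "h s = (\<Sum>\<^sub>\<infinity>j\<in>{0} \<union> {1..}. qt Q j * Q powi (j * s))"
    unfolding h_def by (rule arg_cong[of _ _ "infsum _"]) auto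
  also have "\<dots> = 1 + (\<Sum>\<^sub>\<infinity>j\<in>{1..}. qt Q j * Q powi (j * s))"
    by (subst infsum_Un_disjoint) (auto intro: theta_summable')
  also have "(\<Sum>\<^sub>\<infinity>j\<in>{1..}. qt Q j * Q powi (j * s)) =
      (\<Sum>\<^sub>\<infinity>j\<in>{0..}. qt Q (j + 1) * Q powi ((j + 1) * s))"
    by (rule infsum_reindex_bij_witness[of _ "\<lambda>j. j + 1" "\<lambda>j. j - 1"]) auto
  also have "\<dots> = (\<Sum>\<^sub>\<infinity>j\<in>{0..}. - (Q powi s) * (qt Q j * Q powi (j * (s + 1))))"
    by (intro infsum_cong) (simp add: qt_add1 ring_distribs power_int_add)
  also have "\<dots> = - (Q powi s) * h (s + 1)"
    unfolding h_def by (rule infsum_cmult_right')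
  finally show ?thesis by simp
qed

definition qt_mass :: real where "qt_mass = (\<Sum>\<^sub>\<infinity>j. norm (qt Q j))"

text \<open>Depending on the sign of \<open>s\<close>, the half-line of indices is chosen on which
  all exponents \<open>j * s\<close> are nonnegative. The bound is uniform in \<open>s\<close>,
  which makes every series weighted by \<open>h\<close> absolutely convergent.\<close>

lemma h_bound: "norm (h s) \<le> qt_mass"
proof -
  have abs: "(\<lambda>j. norm (qt Q j)) summable_on X" for X
    using theta_summable'[of 0 X] by (simp add: summable_on_iff_abs_summable_on_complex)
  have *: "norm (\<Sum>\<^sub>\<infinity>j\<in>X. qt Q j * Q powi (j * s)) \<le> qt_mass" if "\<And>j. j \<in> X \<Longrightarrow> j * s \<ge> 0" for X
  proof -
    have 1: "norm (qt Q j * Q powi (j * s)) \<le> norm (qt Q j)" if "j \<in> X" for j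
      using \<open>\<And>j. j \<in> X \<Longrightarrow> j * s \<ge> 0\<close>[OF that] lt1
      by (simp add: norm_mult norm_power_int mult_left_le power_int_le_one)
    have "norm (\<Sum>\<^sub>\<infinity>j\<in>X. qt Q j * Q powi (j * s)) \<le> (\<Sum>\<^sub>\<infinity>j\<in>X. norm (qt Q j * Q powi (j * s)))"
      using theta_summable'[of s X] by (intro norm_infsum_bound) (simp add: summable_on_iff_abs_summable_on_complex)
    also have "\<dots> \<le> (\<Sum>\<^sub>\<infinity>j\<in>X. norm (qt Q j))"
      using theta_summable'[of s X] 1 abs
      by (intro infsum_mono) (auto simp: summable_on_iff_abs_summable_on_complex)
    also have "\<dots> \<le> qt_mass"
      unfolding qt_mass_def using abs by (intro infsum_mono2) auto
    finally show ?thesis .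
  qed
  show ?thesis
  proof (cases "s \<ge> 0")
    case True
    thus ?thesis using *[of "{0..}"] by (simp add: h_def)
  next
    case False
    thus ?thesis using *[of "{..<0}"] by (simp add: h_alt mult_nonpos_nonpos)
  qed
qed

lemma h_summable: "z \<noteq> 0 \<Longrightarrow> (\<lambda>i. qt Q i * z powi i * h (i + m)) summable_on UNIV"
  by (rule theta_bounded_summable[OF _ h_bound])

text \<open>Multiply the series by \<open>1 - Q powi m / z\<close> and shift the index: the weight
  becomes \<open>h (i + m) + Q powi (i + m) * h (i + m + 1)\<close>, which is 1.\<close>

lemma theta_divide:
  assumes "z \<noteq> 0" "z \<noteq> Q powi m"
  shows "theta Q z / (1 - Q powi m / z) = (\<Sum>\<^sub>\<infinity>i. qt Q i * z powi i * h (i + m))" (is "_ = ?S")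
proof -
  have "(Q powi m / z) * ?S =
      (\<Sum>\<^sub>\<infinity>i. (Q powi m / z) * (qt Q (i + 1) * z powi (i + 1) * h (i + 1 + m)))"
    unfolding infsum_cmult_right' by (subst infsum_int_shift) simp
  also have "\<dots> = (\<Sum>\<^sub>\<infinity>i. - (qt Q i * z powi i * (Q powi (i + m) * h (i + m + 1))))"
    using assms by (intro infsum_cong) (simp add: qt_add1 power_int_add algebra_simps)
  finally have 1: "(Q powi m / z) * ?S = (\<Sum>\<^sub>\<infinity>i. - (qt Q i * z powi i * (Q powi (i + m) * h (i + m + 1))))" .
  have sm: "(\<lambda>i. - (qt Q i * z powi i * (Q powi (i + m) * h (i + m + 1)))) summable_on UNIV"
  proof -
    have "(\<lambda>i. (Q powi m / z) * (qt Q (i + 1) * z powi (i + 1) * h (i + 1 + m))) summable_on UNIV"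
      using h_summable[OF assms(1), of m]
      by (intro summable_on_cmult_right) (subst summable_int_shift)
    also have "(\<lambda>i. (Q powi m / z) * (qt Q (i + 1) * z powi (i + 1) * h (i + 1 + m))) =
        (\<lambda>i. - (qt Q i * z powi i * (Q powi (i + m) * h (i + m + 1))))"
      using assms by (intro ext) (simp add: qt_add1 power_int_add algebra_simps)
    finally show ?thesis .
  qed
  have "(1 - Q powi m / z) * ?S = ?S - (Q powi m / z) * ?S" by (simp add: algebra_simps)
  also have "\<dots> = (\<Sum>\<^sub>\<infinity>i. qt Q i * z powi i * h (i + m) + qt Q i * z powi i * (Q powi (i + m) * h (i + m + 1)))"
    unfolding 1 using infsum_add[OF h_summable[OF assms(1), of m] summable_on_uminus[THEN iffD2, OF sm]]
    by (simp add: infsum_uminus)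
  also have "\<dots> = (\<Sum>\<^sub>\<infinity>i. qt Q i * z powi i * (h (i + m) + Q powi (i + m) * h (i + m + 1)))"
    by (simp add: distrib_left)
  also have "\<dots> = theta Q z" by (simp add: h_rec theta_def)
  finally have "(1 - Q powi m / z) * ?S = theta Q z" .
  moreover have "1 - Q powi m / z \<noteq> 0" using assms by (simp add: field_simps)
  ultimately show ?thesis by (metis nonzero_mult_div_cancel_left)
qed

text \<open>A product of two theta series whose terms are weighted by a function of the sum of the
  indices. The weight 1 gives the product of theta functions, the weight \<open>h\<close> an Appell
  sum; the symmetry in \<open>u\<close> and \<open>v\<close> is built in.\<close>

definition bconv :: "(int \<Rightarrow> complex) \<Rightarrow> complex \<Rightarrow> complex \<Rightarrow> complex" where
  "bconv g u v = (\<Sum>\<^sub>\<infinity>(i, m). (qt Q i * u powi i) * (qt Q m * v powi m) * g (i + m))"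

lemma bconv_sym: "bconv g u v = bconv g v u"
  unfolding bconv_def
  by (rule infsum_reindex_bij_witness[of _ prod.swap prod.swap]) (auto simp: mult_ac add.commute)

lemma bconv_summable:
  assumes "u \<noteq> 0" "v \<noteq> 0" "\<And>s. norm (g s) \<le> C"
  shows "(\<lambda>(i, m). (qt Q i * u powi i) * (qt Q m * v powi m) * g (i + m)) summable_on UNIV"
  using summable_prod_bounded[OF theta_summable[OF assms(1)] theta_summable[OF assms(2)], of "\<lambda>i m. g (i + m)" C]
    assms(3) by simp

lemma bconv_iterated:
  assumes "u \<noteq> 0" "v \<noteq> 0" "\<And>s. norm (g s) \<le> C"
  shows "bconv g u v = (\<Sum>\<^sub>\<infinity>m. qt Q m * v powi m * (\<Sum>\<^sub>\<infinity>i. qt Q i * u powi i * g (i + m)))"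
proof -
  have "(\<lambda>(m, i). (qt Q m * v powi m) * (qt Q i * u powi i) * g (m + i)) summable_on Sigma UNIV (\<lambda>_. UNIV)"
    using bconv_summable[OF assms(2,1,3)] by simp
  from infsum_Sigma_banach[OF this] show ?thesis
    unfolding bconv_sym[of g u v] unfolding bconv_def
    by (simp add: mult.assoc infsum_cmult_right' add.commute)
qed

lemma bconv_one:
  assumes "u \<noteq> 0" "v \<noteq> 0"
  shows "bconv (\<lambda>_. 1) u v = theta Q u * theta Q v"
  unfolding bconv_def theta_def using infsum_prod[OF theta_summable[OF assms(1)] theta_summable[OF assms(2)]]
  by simp

abbreviation B :: "complex \<Rightarrow> complex \<Rightarrow> complex" where "B \<equiv> bconv h"

text \<open>Since \<open>B\<close> is symmetric, this relates the Appell sums with \<open>u\<close> and \<open>v\<close> exchanged.\<close>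

lemma B_theta_appell:
  assumes "u \<noteq> 0" "v \<noteq> 0" "\<And>m. u \<noteq> Q powi m"
  shows "theta Q u * appell Q (1 / u) v = B u v"
proof -
  have "B u v = (\<Sum>\<^sub>\<infinity>m. qt Q m * v powi m * (theta Q u / (1 - Q powi m / u)))"
    by (subst bconv_iterated[OF assms(1,2) h_bound], subst theta_divide)  (use assms in auto)
  also have "\<dots> = (\<Sum>\<^sub>\<infinity>m. theta Q u * (qt Q m * v powi m / (1 - 1 / u * Q powi m)))"
    by (simp add: mult_ac)
  also have "\<dots> = theta Q u * appell Q (1 / u) v"
    unfolding infsum_cmult_right' appell_def ..
  finally show ?thesis ..
qed

section \<open>Special values of the double series, and the reciprocal of a theta function\<close>

definition hsum :: "int \<Rightarrow> complex" where
  "hsum m = (\<Sum>\<^sub>\<infinity>i. qt Q i * h (i + m))"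

text \<open>Up to sign the limit of \<open>theta Q z / (1 - 1 / z)\<close> as \<open>z\<close> tends
  to 1, that is, the derivative of the theta function at its zero 1. Its product form is found in
  \<open>K_product\<close>.\<close>

definition K :: complex where "K = - hsum 0"

lemma Q_powi_eq_1: "Q powi m = 1 \<Longrightarrow> m = 0"
proof (rule ccontr)
  assume "Q powi m = 1" "m \<noteq> 0"
  hence "norm Q powi m = 1" by (metis norm_one norm_power_int)
  moreover have "norm Q powi m < 1" if "m > 0"
  proof -
    have "norm Q ^ nat m < 1" using lt1 that by (intro power_Suc_less_one power_strict_decreasing[of 0 "nat m" "norm Q", simplified]) auto
    thus ?thesis using that by (simp add: power_int_def)
  qed
  moreover have "norm Q powi m > 1" if "m < 0"
  proof -
    have "inverse (norm Q) ^ nat (-m) > 1" using lt1 that by (intro one_less_power) (auto simp: field_simps)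
    thus ?thesis using that by (simp add: power_int_def)
  qed
  ultimately show False using \<open>m \<noteq> 0\<close> by linarith
qed

text \<open>Insert \<open>h_rec\<close>: the constant part sums to \<open>theta Q 1 = 0\<close>, and
  the remainder is a shift of the series itself. So \<open>hsum m\<close> is fixed by multiplication
  with \<open>Q powi m\<close>, which differs from 1.\<close>

lemma hsum_eq_0:
  assumes "m \<noteq> 0" shows "hsum m = 0"
proof -
  have sm: "(\<lambda>i. qt Q i * h (i + m)) summable_on UNIV" for m
    using h_summable[of 1 m] by simp
  have sm0: "(\<lambda>i. qt Q i) summable_on UNIV" using theta_summable[of 1] by simp
  have "hsum m = (\<Sum>\<^sub>\<infinity>i. qt Q i - Q powi m * (- (qt Q (i + 1) * h (i + 1 + m))))"
    unfolding hsum_def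
  proof (intro infsum_cong)
    fix i
    have "h (i + m) = 1 - Q powi (i + m) * h (i + m + 1)" using h_rec[of "i + m"] by (simp add: algebra_simps)
    moreover have "i + 1 + m = i + m + 1" by simp
    ultimately show "qt Q i * h (i + m) = qt Q i - Q powi m * (- (qt Q (i + 1) * h (i + 1 + m)))"
      by (simp only: qt_add1) (simp add: power_int_add algebra_simps)
  qed
  also have "\<dots> = (\<Sum>\<^sub>\<infinity>i. qt Q i + Q powi m * (qt Q (i + 1) * h (i + 1 + m)))" by simp
  also have "\<dots> = (\<Sum>\<^sub>\<infinity>i. qt Q i) + (\<Sum>\<^sub>\<infinity>i. Q powi m * (qt Q (i + 1) * h (i + 1 + m)))"
    by (intro infsum_add sm0 summable_on_cmult_right) (subst summable_int_shift, rule sm)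
  also have "\<dots> = Q powi m * hsum m"
    using theta_1 unfolding infsum_cmult_right' hsum_def theta_def
    by (subst infsum_int_shift) simp
  finally have "hsum m * (1 - Q powi m) = 0" by (simp add: algebra_simps)
  thus ?thesis using Q_powi_eq_1 assms by auto
qed

text \<open>At \<open>u = 1\<close> the inner sums are the \<open>hsum m\<close>, of which only
  \<open>m = 0\<close> survives.\<close>

lemma B_1:
  assumes "v \<noteq> 0" shows "B 1 v = - K"
proof -
  have "B 1 v = (\<Sum>\<^sub>\<infinity>m. qt Q m * v powi m * hsum m)"
    using bconv_iterated[OF _ assms h_bound, of 1] by (simp add: hsum_def)
  also have "\<dots> = (\<Sum>\<^sub>\<infinity>m\<in>{0}. qt Q m * v powi m * hsum m)"
    by (intro infsum_cong_neutral) (auto simp: hsum_eq_0)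
  finally show ?thesis by (simp add: K_def)
qed

lemma B_Q:
  assumes "v \<noteq> 0" shows "B v Q = - v * K"
proof -
  \<comment> \<open>Since \<open>qt Q i * Q powi i\<close> is \<open>- qt Q (i + 1)\<close>, the
    argument \<open>Q\<close> only shifts the indices of the case of argument 1; the surviving term
    is now \<open>m = 1\<close>.\<close>
  have *: "(\<Sum>\<^sub>\<infinity>i. qt Q i * Q powi i * h (i + m)) = - hsum (m - 1)" for m
  proof -
    have "(\<Sum>\<^sub>\<infinity>i. qt Q i * Q powi i * h (i + m)) = (\<Sum>\<^sub>\<infinity>i. - (qt Q (i + 1) * h (i + 1 + (m - 1))))"
      by (simp add: qt_add1 mult_ac)
    also have "\<dots> = - hsum (m - 1)"
      unfolding infsum_uminus hsum_def by (subst infsum_int_shift) simp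
    finally show ?thesis .
  qed
  have "B v Q = (\<Sum>\<^sub>\<infinity>m. qt Q m * v powi m * - hsum (m - 1))"
    using bconv_iterated[OF _ assms h_bound, of Q] * by (simp add: bconv_sym[of _ v])
  also have "\<dots> = (\<Sum>\<^sub>\<infinity>m\<in>{1}. qt Q m * v powi m * - hsum (m - 1))"
    by (intro infsum_cong_neutral) (auto simp: hsum_eq_0)
  also have "\<dots> = - v * K" using qt_add1[of 0] by (simp add: K_def)
  finally show ?thesis .
qed

text \<open>The partial fraction expansion of the reciprocal of a theta function: when
  \<open>y\<close> is the nome itself, \<open>B\<close> collapses to one term. This is the source of
  every Appell sum below that is a theta quotient.\<close>

lemma theta_appell_Q:
  assumes "x \<noteq> 0" "\<And>m. x \<noteq> Q powi m"
  shows "theta Q x * appell Q x Q = K"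
proof -
  have *: "1 / x \<noteq> Q powi m" for m
    using assms(2)[of "-m"] assms(1) by (auto simp: power_int_minus field_simps)
  have "theta Q (1 / x) * appell Q (1 / (1 / x)) Q = B (1 / x) Q"
    using assms * by (intro B_theta_appell) auto
  thus ?thesis using assms by (simp add: theta_inverse B_Q field_simps)
qed

section \<open>Separation of variables and the three-term relation\<close>

definition s2 :: "(int \<Rightarrow> complex) \<Rightarrow> complex \<Rightarrow> complex" where
  "s2 g x = (\<Sum>\<^sub>\<infinity>r. Q powi (2 * tri r) * x powi r * g r)"

lemma s2_summable:
  assumes "x \<noteq> 0" "\<And>s. norm (g s) \<le> C"
  shows "(\<lambda>r. Q powi (2 * tri r) * x powi r * g r) summable_on UNIV"
proof -
  have "norm ((-1) powi r * Q powi tri r * g r) \<le> C" for r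
  proof -
    have "norm Q powi tri r * norm (g r) \<le> 1 * C"
      using lt1 tri_nonneg[of r] by (intro mult_mono assms power_int_le_one) auto
    thus ?thesis by (simp add: norm_mult norm_power_int)
  qed
  from theta_bounded_summable[OF assms(1), of "\<lambda>r. (-1) powi r * Q powi tri r * g r" C, OF this] show ?thesis
  proof (rule back_subst[of "\<lambda>f. f summable_on UNIV"], intro ext)
    fix r
    have "Q powi (2 * tri r) = Q powi tri r * Q powi tri r"
      unfolding mult_2 by (subst power_int_add) auto
    moreover have "(-1 :: complex) powi r * (-1) powi r = 1" by simp
    ultimately show "qt Q r * x powi r * ((-1) powi r * Q powi tri r * g r) = Q powi (2 * tri r) * x powi r * g r"
      unfolding qt_def by algebra
  qed
qed

text \<open>For the weight 1, \<open>s2\<close> at \<open>x\<close> is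
  \<open>theta (Q ^ 2) (- x)\<close>, and this is its functional equation.\<close>

lemma s2_shift:
  assumes "x \<noteq> 0" shows "s2 (\<lambda>_. 1) (Q ^ 2 * x) = s2 (\<lambda>_. 1) x / x"
proof -
  have "s2 (\<lambda>_. 1) (Q ^ 2 * x) = (\<Sum>\<^sub>\<infinity>r. (1 / x) * (Q powi (2 * tri (r + 1)) * x powi (r + 1) * 1))"
    unfolding s2_def
    by (intro infsum_cong)
       (use assms in \<open>simp add: tri_add power_int_mult_distrib power_int_add distrib_left power_int_power\<close>)
  also have "\<dots> = 1 / x * s2 (\<lambda>_. 1) x"
    unfolding infsum_cmult_right' s2_def by (subst infsum_int_shift) simp
  finally show ?thesis by simp
qed

text \<open>No mixed term in \<open>r\<close> and \<open>j\<close> remains, so the substitution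
  \<open>i = r + j\<close>, \<open>m = r - j\<close> separates the double series.\<close>

lemma tri_pm: "tri (r + j) + tri (r - j) = 2 * tri r + (2 * tri j + j)"
proof -
  have "2 * (tri (r + j) + tri (r - j)) = 2 * (2 * tri r + (2 * tri j + j))"
    unfolding distrib_left two_tri by (simp add: algebra_simps two_tri)
  thus ?thesis by simp
qed

lemma parity_even:
  fixes i m :: int
  assumes "even (i + m)"
  shows "(i + m) div 2 + (i - m) div 2 = i" "(i + m) div 2 - (i - m) div 2 = m"
  using assms by presburger+

lemma parity_odd:
  fixes i m :: int
  assumes "odd (i + m)"
  shows "(i + m) div 2 + (i - m) div 2 + 1 = i" "(i + m) div 2 - (i - m) div 2 = m"
  using assms by presburger+

text \<open>Splitting the double series by the parity of \<open>i + m\<close> separates the variables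
  \<open>u * v\<close> and \<open>u / v\<close>; hence for fixed \<open>u * v\<close> all these
  series lie in a two-dimensional space of functions of \<open>u / v\<close>.\<close>

lemma bconv_parity:
  assumes "u \<noteq> 0" "v \<noteq> 0" "\<And>s. norm (g s) \<le> C"
  shows "bconv g u v = s2 (\<lambda>r. g (2 * r)) (u * v) * s2 (\<lambda>_. 1) (Q * (u / v))
           - v * s2 (\<lambda>r. g (2 * r + 1)) (Q * (u * v)) * s2 (\<lambda>_. 1) (u / v)"
proof -
  let ?F = "\<lambda>(i, m). (qt Q i * u powi i) * (qt Q m * v powi m) * g (i + m)"
  let ?E = "{p :: int \<times> int. even (fst p + snd p)}" and ?O = "{p :: int \<times> int. odd (fst p + snd p)}"
  have sub: "?F summable_on X" for X
    by (rule summable_on_subset_banach[OF bconv_summable[OF assms]]) auto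
  have "bconv g u v = infsum ?F (?E \<union> ?O)"
    unfolding bconv_def by (rule arg_cong[of _ _ "infsum _"]) auto
  also have "\<dots> = infsum ?F ?E + infsum ?F ?O"
    by (intro infsum_Un_disjoint sub) auto
  also have "infsum ?F ?E = (\<Sum>\<^sub>\<infinity>(r, j). (Q powi (2 * tri r) * (u * v) powi r * g (2 * r)) *
      (Q powi (2 * tri j) * (Q * (u / v)) powi j * 1))"
  proof (rule infsum_reindex_bij_witness[of _ "\<lambda>(r, j). (r + j, r - j)" "\<lambda>(i, m). ((i + m) div 2, (i - m) div 2)"])
    fix p assume "p \<in> ?E"
    then obtain r j where p: "p = (r + j, r - j)"
    proof -
      obtain i m where im: "p = (i, m)" by (cases p)
      with \<open>p \<in> ?E\<close> have "even (i + m)" by (simp del: even_add)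
      then obtain r where r: "i + m = 2 * r" by (rule evenE)
      show ?thesis by (rule that[of r "i - r"]) (use im r in auto)
    qed
    have dv: "2 * r div 2 = r" "(r + j - (r - j)) div 2 = j" "r + j + (r - j) = 2 * r" by auto
    have "qt Q (r + j) * qt Q (r - j) = Q powi (2 * tri r) * (Q powi (2 * tri j) * Q powi j)"
    proof -
      have "qt Q (r + j) * qt Q (r - j) = ((-1) powi (r + j) * (-1) powi (r - j)) * (Q powi (tri (r + j) + tri (r - j)))"
        by (simp add: qt_def power_int_add)
      also have "(-1 :: complex) powi (r + j) * (-1) powi (r - j) = 1"
        by (simp add: power_int_minus_left flip: power_int_add)
      finally show ?thesis unfolding tri_pm by (simp add: power_int_add)
    qed
    moreover have "u powi (r + j) * v powi (r - j) = (u * v) powi r * (u / v) powi j"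
      using assms by (simp add: power_int_add power_int_diff power_int_mult_distrib power_int_divide_distrib)
    ultimately show "(case case p of (i, m) \<Rightarrow> ((i + m) div 2, (i - m) div 2) of (r, j) \<Rightarrow>
          (Q powi (2 * tri r) * (u * v) powi r * g (2 * r)) *
          (Q powi (2 * tri j) * (Q * (u / v)) powi j * 1)) = ?F p"
      unfolding p prod.case dv power_int_mult_distrib[of Q "u / v"] by algebra
  qed (auto simp del: even_add simp: parity_even)
  also have "\<dots> = s2 (\<lambda>r. g (2 * r)) (u * v) * s2 (\<lambda>_. 1) (Q * (u / v))"
    unfolding s2_def using assms by (intro infsum_prod s2_summable[of _ _ C] s2_summable[of _ _ 1]) auto
  also have "infsum ?F ?O = (\<Sum>\<^sub>\<infinity>(r, j). (Q powi (2 * tri r) * (Q * (u * v)) powi r * g (2 * r + 1)) *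
      (- u * (Q powi (2 * tri j) * (Q ^ 2 * (u / v)) powi j * 1)))"
  proof (rule infsum_reindex_bij_witness[of _ "\<lambda>(r, j). (r + j + 1, r - j)" "\<lambda>(i, m). ((i + m) div 2, (i - m) div 2)"])
    fix p assume "p \<in> ?O"
    then obtain r j where p: "p = (r + j + 1, r - j)"
    proof -
      obtain i m where im: "p = (i, m)" by (cases p)
      with \<open>p \<in> ?O\<close> have "odd (i + m)" by (simp del: even_add)
      then obtain r where r: "i + m = 2 * r + 1" by (rule oddE)
      show ?thesis by (rule that[of r "i - r - 1"]) (use im r in auto)
    qed
    have dv: "(2 * r + 1) div 2 = r" "(r + j + 1 - (r - j)) div 2 = j" "r + j + 1 + (r - j) = 2 * r + 1" by auto
    have "qt Q (r + j + 1) * qt Q (r - j) = - (Q powi (2 * tri r) * Q powi r * (Q powi (2 * tri j) * (Q powi j * Q powi j)))"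
    proof -
      have "qt Q (r + j + 1) * qt Q (r - j) = - (Q powi (r + j)) * (((-1) powi (r + j) * (-1) powi (r - j)) * (Q powi (tri (r + j) + tri (r - j))))"
        unfolding qt_add1 by (simp add: qt_def power_int_add)
      also have "(-1 :: complex) powi (r + j) * (-1) powi (r - j) = 1"
        by (simp add: power_int_minus_left flip: power_int_add)
      finally show ?thesis unfolding tri_pm by (simp add: power_int_add)
    qed
    moreover have "u powi (r + j + 1) * v powi (r - j) = u * ((u * v) powi r * (u / v) powi j)"
      using assms by (simp add: power_int_add power_int_diff power_int_mult_distrib power_int_divide_distrib)
    moreover have "(Q ^ 2 * (u / v)) powi j = Q powi j * Q powi j * (u / v) powi j"
      unfolding power_int_mult_distrib by (simp add: power2_eq_square power_int_mult_distrib)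
    ultimately show "(case case p of (i, m) \<Rightarrow> ((i + m) div 2, (i - m) div 2) of (r, j) \<Rightarrow>
          (Q powi (2 * tri r) * (Q * (u * v)) powi r * g (2 * r + 1)) *
          (- u * (Q powi (2 * tri j) * (Q ^ 2 * (u / v)) powi j * 1))) = ?F p"
      unfolding p prod.case dv power_int_mult_distrib[of Q "u * v"] by algebra
  qed (auto simp del: even_add simp: parity_odd, auto)
  also have "\<dots> = s2 (\<lambda>r. g (2 * r + 1)) (Q * (u * v)) * (- u * s2 (\<lambda>_. 1) (Q ^ 2 * (u / v)))"
  proof -
    have "(\<lambda>j. - u * (Q powi (2 * tri j) * (Q ^ 2 * (u / v)) powi j * 1)) summable_on UNIV"
      using assms by (intro summable_on_cmult_right s2_summable[of _ _ 1]) auto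
    moreover have "(\<lambda>r. Q powi (2 * tri r) * (Q * (u * v)) powi r * g (2 * r + 1)) summable_on UNIV"
      using assms by (intro s2_summable[of _ _ C]) auto
    ultimately show ?thesis
      using infsum_prod unfolding s2_def infsum_cmult_right'[of "- u", symmetric] by fast
  qed
  \<comment> \<open>The odd class produces the argument \<open>Q ^ 2 * (u / v)\<close>; removing
    \<open>Q ^ 2\<close> lets the two building blocks in \<open>u / v\<close> be the same for every
    weight.\<close>
  also have "s2 (\<lambda>_. 1) (Q ^ 2 * (u / v)) = s2 (\<lambda>_. 1) (u / v) / (u / v)"
    using assms by (intro s2_shift) auto
  finally show ?thesis using assms by simp
qed

lemma theta_mult_parity:
  assumes "u \<noteq> 0" "v \<noteq> 0"
  shows "theta Q u * theta Q v = s2 (\<lambda>_. 1) (u * v) * s2 (\<lambda>_. 1) (Q * (u / v))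
           - v * s2 (\<lambda>_. 1) (Q * (u * v)) * s2 (\<lambda>_. 1) (u / v)"
  using bconv_parity[OF assms, of "\<lambda>_. 1" 1] bconv_one[OF assms] by simp

text \<open>The change-of-parameter formula for Appell-Lerch sums. For a fixed product
  \<open>c\<close> of the arguments, both \<open>B\<close> and the product of theta functions are
  combinations of the same two functions of the quotient, so the left-hand side is a 2 by 2
  determinant \<open>W\<close> depending on \<open>c\<close> alone, times an antisymmetric
  expression that is again a product of theta functions.\<close>

lemma B_cross:
  assumes uv: "u \<noteq> 0" "v \<noteq> 0" "u' \<noteq> 0" "v' \<noteq> 0" "u * v = u' * v'"
    and "theta Q u \<noteq> 0" "theta Q v \<noteq> 0"
  shows "B u v * theta Q u' * theta Q v' - B u' v' * theta Q u * theta Q v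
           = K * v' * theta Q (u' / v) * theta Q (v / v')"
proof -
  define c W where "c = u * v" and "W = s2 (\<lambda>r. h (2 * r)) c * s2 (\<lambda>_. 1) (Q * c)
      - s2 (\<lambda>r. h (2 * r + 1)) (Q * c) * s2 (\<lambda>_. 1) c"
  have *: "B u v * theta Q u' * theta Q v' - B u' v' * theta Q u * theta Q v
      = - W * v' * theta Q (u' / v) * theta Q (v / v')"
    if u'v': "u' \<noteq> 0" "v' \<noteq> 0" "u' * v' = c" for u' v'
  proof -
    define a a' b b' where ab: "a = s2 (\<lambda>_. 1) (Q * (u / v))" "a' = s2 (\<lambda>_. 1) (Q * (u' / v'))"
      "b = s2 (\<lambda>_. 1) (u / v)" "b' = s2 (\<lambda>_. 1) (u' / v')"
    have q: "(u' / v) * (v / v') = u' / v'" "(u' / v) / (v / v') = u / v"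
      using uv u'v' unfolding c_def by (auto simp: field_simps)
    have "theta Q (u' / v) * theta Q (v / v') = b' * a - (v / v') * a' * b"
      using theta_mult_parity[of "u' / v" "v / v'"] uv u'v' unfolding q by (simp add: ab)
    hence "v' * (theta Q (u' / v) * theta Q (v / v')) = v' * b' * a - v * a' * b"
      using u'v' by (simp add: field_simps)
    moreover have "B u v = s2 (\<lambda>r. h (2 * r)) c * a - v * s2 (\<lambda>r. h (2 * r + 1)) (Q * c) * b"
      using bconv_parity[OF uv(1,2) h_bound] by (simp add: ab c_def)
    moreover have "B u' v' = s2 (\<lambda>r. h (2 * r)) c * a' - v' * s2 (\<lambda>r. h (2 * r + 1)) (Q * c) * b'"
      using bconv_parity[OF u'v'(1,2) h_bound] u'v' by (simp add: ab)
    moreover have "theta Q u * theta Q v = s2 (\<lambda>_. 1) c * a - v * s2 (\<lambda>_. 1) (Q * c) * b"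
      using theta_mult_parity[OF uv(1,2)] by (simp add: ab c_def)
    moreover have "theta Q u' * theta Q v' = s2 (\<lambda>_. 1) c * a' - v' * s2 (\<lambda>_. 1) (Q * c) * b'"
      using theta_mult_parity[OF u'v'(1,2)] u'v' by (simp add: ab)
    ultimately show ?thesis unfolding W_def by algebra
  qed
  have c: "c \<noteq> 0" using uv by (simp add: c_def)
  have vc: "v / c = 1 / u" using uv(1,2) by (simp add: c_def)
  \<comment> \<open>\<open>W\<close> is identified at the pair \<open>(1, c)\<close>, where one
    theta product vanishes and \<open>B\<close> is \<open>- K\<close>.\<close>
  have "K * (theta Q u * theta Q v) = - W * c * theta Q (1 / v) * theta Q (1 / u)"
    using *[of 1 c] c by (simp add: B_1 vc mult_ac)
  also have "\<dots> = - W * (theta Q u * theta Q v)"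
    using uv(1,2) by (simp add: theta_inverse c_def)
  finally have "(W + K) * (theta Q u * theta Q v) = 0" by (simp add: algebra_simps)
  hence "W = - K" using assms(6,7) by (simp add: eq_neg_iff_add_eq_0)
  thus ?thesis using *[of u' v'] uv by (simp add: c_def)
qed

end

section \<open>Infinite products\<close>

lemma qpoch_0 [simp]: "qpoch a q 0 = 1" by (simp add: qpoch_def)

lemma qpoch_Suc: "qpoch a q (Suc n) = qpoch a q n * (1 - a * q ^ n)"
  by (simp add: qpoch_def)

lemma qpoch_Suc': "qpoch a q (Suc n) = (1 - a) * qpoch (a * q) q n"
  by (induction n) (auto simp: qpoch_Suc mult_ac)

text \<open>Dominated convergence for sums over the integers: an enumeration of the integers reduces
  it to the theorem of Tannery for series.\<close>

lemma infsum_int_dominated: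
  fixes f :: "nat \<Rightarrow> int \<Rightarrow> complex"
  assumes lim: "\<And>n. (\<lambda>N. f N n) \<longlonglongrightarrow> g n"
    and bd: "\<And>N n. norm (f N n) \<le> M n" and M: "M summable_on UNIV"
  shows "(\<lambda>N. \<Sum>\<^sub>\<infinity>n. f N n) \<longlonglongrightarrow> (\<Sum>\<^sub>\<infinity>n. g n)"
proof -
  have sm: "F summable_on UNIV" if "\<And>n. norm (F n) \<le> M n" for F :: "int \<Rightarrow> complex"
    by (rule abs_summable_summable, rule Infinite_Sum.abs_summable_on_comparison_test'[OF M]) (use that in auto)
  have eq: "infsum F UNIV = (\<Sum>k. F (int_decode k))" if "F summable_on UNIV" for F :: "int \<Rightarrow> complex"
  proof -
    have "((\<lambda>k. F (int_decode k)) has_sum infsum F UNIV) UNIV"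
      using that bij_int_decode by (subst has_sum_reindex_bij_betw) auto
    thus ?thesis using has_sum_imp_sums sums_unique by blast
  qed
  have bg: "norm (g n) \<le> M n" for n
    using lim[of n] by (rule LIMSEQ_le_const2[OF tendsto_norm]) (use bd in auto)
  have "summable (\<lambda>k. M (int_decode k))"
    using M bij_int_decode by (intro summable_on_imp_summable) (subst summable_on_reindex_bij_betw)
  hence "(\<lambda>N. \<Sum>k. f N (int_decode k)) \<longlonglongrightarrow> (\<Sum>k. g (int_decode k))"
    using tannerys_theorem[where a = "\<lambda>k N. f N (int_decode k)" and b = "\<lambda>k. g (int_decode k)"
        and M = "\<lambda>k. M (int_decode k)" and F = sequentially] lim bd
    by (auto intro!: always_eventually)
  thus ?thesis using sm bd bg by (simp add: eq)
qed

locale qdisc =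
  fixes q :: complex
  assumes q1: "norm q < 1"
begin

lemma qpoch_conv: "convergent_prod (\<lambda>i. 1 - a * q ^ i)"
proof -
  have "summable (\<lambda>i. norm a * norm q ^ i)"
    using q1 by (intro summable_mult summable_geometric) auto
  hence "summable (\<lambda>i. norm (- a * q ^ i))" by (simp add: norm_mult norm_power)
  hence "abs_convergent_prod (\<lambda>i. 1 + (- a * q ^ i))"
    by (intro summable_imp_abs_convergent_prod) simp
  thus ?thesis using abs_convergent_prod_imp_convergent_prod by fastforce
qed

lemma qpoch_tendsto: "qpoch a q \<longlonglongrightarrow> qpoch_inf a q"
proof -
  have "(\<lambda>n. qpoch a q (Suc n)) \<longlonglongrightarrow> qpoch_inf a q"
    using convergent_prod_LIMSEQ[OF qpoch_conv, of a] unfolding qpoch_inf_def qpoch_def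
    by (simp add: lessThan_Suc_atMost)
  thus ?thesis by (rule LIMSEQ_imp_Suc)
qed

lemma qpoch_subseq: "strict_mono f \<Longrightarrow> (\<lambda>n. qpoch a q (f n)) \<longlonglongrightarrow> qpoch_inf a q"
  using LIMSEQ_subseq_LIMSEQ[OF qpoch_tendsto, of f a] by (simp add: o_def)

lemma qpoch_inf_nz: "(\<And>i. a * q ^ i \<noteq> 1) \<Longrightarrow> qpoch_inf a q \<noteq> 0"
  unfolding qpoch_inf_def by (rule prodinf_nonzero[OF qpoch_conv]) auto

lemma norm_q_pow: "norm (q ^ n) \<le> 1" using q1 by (simp add: norm_power power_le_one)

lemma qpoch_inf_nz': assumes "norm a < 1" shows "qpoch_inf a q \<noteq> 0"
proof (rule qpoch_inf_nz)
  fix i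
  have "norm (a * q ^ i) \<le> norm a * 1" using norm_q_pow[of i] by (simp add: norm_mult mult_left_le)
  thus "a * q ^ i \<noteq> 1" using assms by (metis linorder_not_less mult_1_right norm_one)
qed

lemma qpoch_nz: assumes "\<And>i. i < n \<Longrightarrow> a * q ^ i \<noteq> 1" shows "qpoch a q n \<noteq> 0"
  using assms by (auto simp: qpoch_def)

lemma qpoch_nz': assumes "norm a < 1" shows "qpoch a q n \<noteq> 0"
proof (rule qpoch_nz)
  fix i
  have "norm (a * q ^ i) \<le> norm a * 1" using norm_q_pow[of i] by (simp add: norm_mult mult_left_le)
  thus "a * q ^ i \<noteq> 1" using assms by (metis linorder_not_less mult_1_right norm_one)
qed

lemma qpoch_inf_Suc: "qpoch_inf a q = (1 - a) * qpoch_inf (a * q) q"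
proof (rule LIMSEQ_unique)
  show "(\<lambda>n. qpoch a q (Suc n)) \<longlonglongrightarrow> qpoch_inf a q" by (rule qpoch_subseq) (simp add: strict_mono_def)
  show "(\<lambda>n. qpoch a q (Suc n)) \<longlonglongrightarrow> (1 - a) * qpoch_inf (a * q) q"
    unfolding qpoch_Suc' by (intro tendsto_intros qpoch_tendsto)
qed

lemma qpoch_inf_split: "qpoch_inf a q = qpoch a q n * qpoch_inf (a * q ^ n) q"
  by (induction n) (auto simp: qpoch_Suc qpoch_inf_Suc[of "a * q ^ _"] mult_ac)

lemma qpoch_bounded: "\<exists>C. \<forall>n. norm (qpoch a q n) \<le> C"
  using qpoch_tendsto[of a] Bseq_def convergent_imp_Bseq[of "qpoch a q"] convergent_def by metis

lemma qpoch_inverse_bounded: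
  assumes "\<And>i. a * q ^ i \<noteq> 1" shows "\<exists>C. \<forall>n. norm (1 / qpoch a q n) \<le> C"
proof -
  have "(\<lambda>n. 1 / qpoch a q n) \<longlonglongrightarrow> 1 / qpoch_inf a q"
    by (intro tendsto_intros qpoch_tendsto qpoch_inf_nz assms)
  thus ?thesis using Bseq_def convergent_imp_Bseq[of "\<lambda>n. 1 / qpoch a q n"] convergent_def by metis
qed

lemma qdisc_power: "n > 0 \<Longrightarrow> qdisc (q ^ n)"
  using q1 by (auto simp: qdisc_def norm_power power_less_one_iff)

lemma qpoch_inf_2: "qpoch_inf a q = qpoch_inf a (q^2) * qpoch_inf (a * q) (q^2)"
proof (rule LIMSEQ_unique)
  interpret q2: qdisc "q^2" by (rule qdisc_power) auto
  have "qpoch a q (2 * n) = qpoch a (q^2) n * qpoch (a * q) (q^2) n" for n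
    by (induction n) (auto simp: qpoch_Suc mult_ac simp flip: power_mult)
  thus "(\<lambda>n. qpoch a q (2 * n)) \<longlonglongrightarrow> qpoch_inf a (q^2) * qpoch_inf (a * q) (q^2)"
    by (simp, intro tendsto_mult q2.qpoch_tendsto)
  show "(\<lambda>n. qpoch a q (2 * n)) \<longlonglongrightarrow> qpoch_inf a q" by (rule qpoch_subseq) (simp add: strict_mono_def)
qed

lemma qpoch_inf_3: "qpoch_inf a q = qpoch_inf a (q^3) * qpoch_inf (a * q) (q^3) * qpoch_inf (a * q^2) (q^3)"
proof (rule LIMSEQ_unique)
  interpret q3: qdisc "q^3" by (rule qdisc_power) auto
  have "qpoch a q (3 * n) = qpoch a (q^3) n * qpoch (a * q) (q^3) n * qpoch (a * q^2) (q^3) n" for n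
  proof (induction n)
    case (Suc n)
    have "qpoch a q (3 * Suc n) = qpoch a q (3 * n) * ((1 - a * q ^ (3 * n)) * (1 - a * q ^ Suc (3 * n)) * (1 - a * q ^ Suc (Suc (3 * n))))"
    proof -
      have "3 * Suc n = Suc (Suc (Suc (3 * n)))" by simp
      thus ?thesis by (simp only: qpoch_Suc mult.assoc)
    qed
    also have "\<dots> = qpoch a (q^3) (Suc n) * qpoch (a * q) (q^3) (Suc n) * qpoch (a * q^2) (q^3) (Suc n)"
      unfolding Suc qpoch_Suc power_mult[symmetric] by (simp add: power2_eq_square mult_ac)
    finally show ?case .
  qed auto
  thus "(\<lambda>n. qpoch a q (3 * n)) \<longlonglongrightarrow> qpoch_inf a (q^3) * qpoch_inf (a * q) (q^3) * qpoch_inf (a * q^2) (q^3)"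
    by (simp, intro tendsto_mult q3.qpoch_tendsto)
  show "(\<lambda>n. qpoch a q (3 * n)) \<longlonglongrightarrow> qpoch_inf a q" by (rule qpoch_subseq) (simp add: strict_mono_def)
qed

lemma qpoch_inf_minus: "qpoch_inf a q * qpoch_inf (- a) q = qpoch_inf (a^2) (q^2)"
proof (rule LIMSEQ_unique)
  interpret q2: qdisc "q^2" by (rule qdisc_power) auto
  have "qpoch a q n * qpoch (- a) q n = qpoch (a^2) (q^2) n" for n
    by (induction n) (auto simp: qpoch_Suc algebra_simps power2_eq_square power_mult_distrib)
  thus "(\<lambda>n. qpoch a q n * qpoch (- a) q n) \<longlonglongrightarrow> qpoch_inf (a^2) (q^2)"
    by (simp, intro q2.qpoch_tendsto)
qed (intro tendsto_mult qpoch_tendsto)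

text \<open>Holds factor by factor, from
  \<open>(1 - x) * (1 - w * x) * (1 - w^2 * x) = 1 - x^3\<close>.\<close>

lemma qpoch_inf_cubic:
  assumes "1 + w + w^2 = 0"
  shows "qpoch_inf a q * qpoch_inf (w * a) q * qpoch_inf (w^2 * a) q = qpoch_inf (a^3) (q^3)"
proof (rule LIMSEQ_unique)
  interpret q3: qdisc "q^3" by (rule qdisc_power) auto
  have w: "(1 - x) * (1 - w * x) * (1 - w^2 * x) = 1 - x^3" for x
    using assms by algebra
  have "qpoch a q n * qpoch (w * a) q n * qpoch (w^2 * a) q n = qpoch (a^3) (q^3) n" for n
  proof (induction n)
    case (Suc n)
    have "qpoch a q (Suc n) * qpoch (w * a) q (Suc n) * qpoch (w^2 * a) q (Suc n) =
       (qpoch a q n * qpoch (w * a) q n * qpoch (w^2 * a) q n) *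
       ((1 - a * q^n) * (1 - w * (a * q^n)) * (1 - w^2 * (a * q^n)))"
      by (simp add: qpoch_Suc mult_ac)
    also have "\<dots> = qpoch (a^3) (q^3) (Suc n)"
      unfolding Suc w qpoch_Suc by (simp add: power_mult_distrib power_commutes flip: power_mult) (simp add: mult_ac)
    finally show ?case .
  qed auto
  thus "(\<lambda>n. qpoch a q n * qpoch (w * a) q n * qpoch (w^2 * a) q n) \<longlonglongrightarrow> qpoch_inf (a^3) (q^3)"
    by (simp, intro q3.qpoch_tendsto)
qed (intro tendsto_mult qpoch_tendsto)

text \<open>The partial products converge uniformly on a ball around \<open>a\<close>, by the
  Weierstrass test. Continuity serves the limit \<open>z\<close> to 1 in
  \<open>K_product\<close>.\<close>

lemma qpoch_inf_continuous: "isCont (\<lambda>a. qpoch_inf a q) a"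
proof -
  define A where "A = cball (0 :: complex) (norm a + 1)"
  have "uniformly_convergent_on A (\<lambda>N x. \<Sum>n<N. norm (1 - x * q ^ n - 1))"
  proof (rule Weierstrass_m_test')
    show "summable (\<lambda>n. (norm a + 1) * norm q ^ n)"
      using q1 by (intro summable_mult summable_geometric) auto
    show "norm (norm (1 - x * q ^ n - 1)) \<le> (norm a + 1) * norm q ^ n" if "x \<in> A" for x n
      using that by (auto simp: A_def norm_mult norm_power intro!: mult_right_mono)
  qed
  hence "uniformly_convergent_on A (\<lambda>N x. \<Prod>n<N. 1 - x * q ^ n)"
    by (intro uniformly_convergent_on_prod') (auto simp: A_def intro!: continuous_intros)
  hence "uniformly_convergent_on A (\<lambda>N x. qpoch x q N)" by (simp add: qpoch_def)
  then obtain l where l: "uniform_limit A (\<lambda>N x. qpoch x q N) l sequentially"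
    by (auto simp: uniformly_convergent_on_def)
  have eq: "l x = qpoch_inf x q" if "x \<in> A" for x
    using tendsto_uniform_limitI[OF l that] qpoch_tendsto LIMSEQ_unique by blast
  have "continuous_on A l"
    by (rule uniform_limit_theorem[OF _ l]) (auto simp: qpoch_def intro!: always_eventually continuous_intros)
  hence "continuous_on A (\<lambda>x. qpoch_inf x q)" using eq by (simp cong: continuous_on_cong)
  moreover have "a \<in> interior A" by (simp add: A_def interior_cball)
  ultimately show ?thesis by (rule continuous_on_interior)
qed

end

section \<open>The Jacobi triple product\<close>

sublocale nome \<subseteq> qdisc Q by unfold_locales (rule lt1)

context nome
begin

text \<open>The reciprocal of \<open>qpoch Q Q k\<close> with value 0 at negative \<open>k\<close>.
  With this convention \<open>iq_rec\<close> holds at every integer, and finite sums can be written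
  over all integers without boundary terms.\<close>

definition iq :: "int \<Rightarrow> complex" where
  "iq k = (if k < 0 then 0 else 1 / qpoch Q Q (nat k))"

lemma qQ_nz [simp]: "qpoch Q Q n \<noteq> 0" by (rule qpoch_nz') (rule lt1)

lemma iq_rec: "iq (k - 1) = (1 - Q powi k) * iq k"
proof -
  consider "k < 0" | "k = 0" | n where "k = int (Suc n)"
    by (cases k rule: int_cases) (metis not0_implies_Suc of_nat_0, simp)
  thus ?thesis
  proof cases
    case 3
    have nz: "qpoch Q Q (Suc n) \<noteq> 0" by simp
    have "Q powi k = Q * Q ^ n" using 3 by (simp add: power_int_add)
    thus ?thesis using 3 nz by (simp add: iq_def nat_add_distrib qpoch_Suc)
  qed (auto simp: iq_def)
qed

lemma iq_tendsto: "(\<lambda>N. iq (int N + k)) \<longlonglongrightarrow> 1 / qpoch_inf Q Q"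
proof -
  have "(\<lambda>N. 1 / qpoch Q Q (N + nat k)) \<longlonglongrightarrow> 1 / qpoch_inf Q Q" if "k \<ge> 0"
    by (intro tendsto_intros qpoch_subseq qpoch_inf_nz' lt1) (simp add: strict_mono_def)
  moreover have "(\<lambda>N. iq (int N + k)) \<longlonglongrightarrow> 1 / qpoch_inf Q Q" if "k < 0"
  proof (rule LIMSEQ_offset[of _ "nat (-k)"])
    have "(\<lambda>N. 1 / qpoch Q Q N) \<longlonglongrightarrow> 1 / qpoch_inf Q Q"
      by (intro tendsto_intros qpoch_tendsto qpoch_inf_nz' lt1)
    thus "(\<lambda>N. iq (int (N + nat (- k)) + k)) \<longlonglongrightarrow> 1 / qpoch_inf Q Q" using that by (simp add: iq_def)
  qed
  ultimately show ?thesis by (cases "k \<ge> 0") (auto simp: iq_def nat_add_distrib)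
qed

lemma iq_bounded: "\<exists>C>0. \<forall>k. norm (iq k) \<le> C"
proof -
  have "Q * Q ^ i \<noteq> 1" for i
    using Q_powi_eq_1[of "int (Suc i)"] unfolding power_int_of_nat power_Suc by auto
  then obtain C where "\<And>n. norm (1 / qpoch Q Q n) \<le> C" using qpoch_inverse_bounded[of Q] by auto
  hence "norm (iq k) \<le> max 1 C" for k by (auto simp: iq_def le_max_iff_disj)
  thus ?thesis by (intro exI[of _ "max 1 C"]) auto
qed

text \<open>The finite form of the triple product; \<open>iq\<close> makes the sum run over \<open>- N \<le> n \<le> N\<close>.\<close>

definition jac :: "nat \<Rightarrow> complex \<Rightarrow> complex" where
  "jac N z = qpoch Q Q (2 * N) * (\<Sum>\<^sub>\<infinity>n. qt Q n * z powi n * (iq (int N + n) * iq (int N - n)))"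

lemma iq_prod_bounded: "\<exists>C. \<forall>a b. norm (iq a * iq b) \<le> C"
proof -
  obtain C where C: "C > 0" "\<And>k. norm (iq k) \<le> C" using iq_bounded by auto
  have "norm (iq a * iq b) \<le> C * C" for a b
    unfolding norm_mult using C by (intro mult_mono) auto
  thus ?thesis by blast
qed

lemma jac_summable:
  assumes "z \<noteq> 0"
  shows "(\<lambda>n. qt Q n * z powi n * (iq (int N + n) * iq (int N - n))) summable_on UNIV"
  using iq_prod_bounded theta_bounded_summable[OF assms] by meson

text \<open>Induction on \<open>N\<close>. The two new factors turn the sum into a combination of
  itself and its shifts by one in either direction; comparing terms leaves a polynomial identity in
  \<open>x = Q powi (N + n)\<close> and \<open>y = Q powi (N - n)\<close>, where
  \<open>x * y = Q ^ (2 * N)\<close>.\<close>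

lemma jac_product:
  assumes z: "z \<noteq> 0"
  shows "jac N z = qpoch z Q N * qpoch (Q / z) Q N"
proof (induction N)
  case 0
  have "jac 0 z = (\<Sum>\<^sub>\<infinity>n\<in>{0}. qt Q n * z powi n * (iq (int 0 + n) * iq (int 0 - n)))"
  proof -
    have "(\<Sum>\<^sub>\<infinity>n. qt Q n * z powi n * (iq (int 0 + n) * iq (int 0 - n))) =
        (\<Sum>\<^sub>\<infinity>n\<in>{0}. qt Q n * z powi n * (iq (int 0 + n) * iq (int 0 - n)))"
      by (intro infsum_cong_neutral) (auto simp: iq_def)
    thus ?thesis by (simp add: jac_def)
  qed
  thus ?case by (simp add: iq_def)
next
  case (Suc N)
  let ?c = "\<lambda>N n. iq (int N + n) * iq (int N - n)"
  let ?f = "\<lambda>n. qt Q n * z powi n * ?c N n"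
  have Q2N: "Q ^ (2 * N) = Q powi (int N + n) * Q powi (int N - n)" for n
  proof -
    have "Q powi (int N + n) * Q powi (int N - n) = Q powi (int (2 * N))"
      by (subst power_int_add[symmetric]) auto
    thus ?thesis by (simp only: power_int_of_nat)
  qed
  have "(1 - z * Q ^ N) * (1 - Q / z * Q ^ N) = 1 + Q ^ (2 * N + 1) - z * Q ^ N - Q ^ (N + 1) / z"
    using z by (simp add: field_simps power_add mult_2_right)
  hence "qpoch z Q (Suc N) * qpoch (Q / z) Q (Suc N) = (1 + Q ^ (2 * N + 1) - z * Q ^ N - Q ^ (N + 1) / z) * jac N z"
    unfolding Suc qpoch_Suc by (simp add: mult_ac)
  also have "\<dots> = qpoch Q Q (2 * N) * ((1 + Q ^ (2 * N + 1)) * (\<Sum>\<^sub>\<infinity>n. ?f n)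
      + (- z * Q ^ N) * (\<Sum>\<^sub>\<infinity>n. ?f (n + - 1)) + (- (Q ^ (N + 1)) / z) * (\<Sum>\<^sub>\<infinity>n. ?f (n + 1)))"
    unfolding jac_def infsum_int_shift[of ?f] by (simp add: algebra_simps)
  also have "(1 + Q ^ (2 * N + 1)) * (\<Sum>\<^sub>\<infinity>n. ?f n)
      + (- z * Q ^ N) * (\<Sum>\<^sub>\<infinity>n. ?f (n + - 1)) + (- (Q ^ (N + 1)) / z) * (\<Sum>\<^sub>\<infinity>n. ?f (n + 1)) =
     (\<Sum>\<^sub>\<infinity>n. (1 + Q ^ (2 * N + 1)) * ?f n + (- z * Q ^ N) * ?f (n + - 1) + (- (Q ^ (N + 1)) / z) * ?f (n + 1))"
    unfolding infsum_cmult_right'[symmetric]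
    by (subst infsum_add; (intro summable_on_add summable_on_cmult_right)?; (subst summable_int_shift)?;
        (rule jac_summable[OF z])?)
       (subst infsum_add; (intro summable_on_cmult_right)?; (subst summable_int_shift)?;
        (rule jac_summable[OF z])?; simp)
  also have "\<dots> = (\<Sum>\<^sub>\<infinity>n. ((1 - Q ^ (2 * N + 1)) * (1 - Q ^ (2 * N + 2))) * (qt Q n * z powi n * ?c (Suc N) n))"
  proof (intro infsum_cong)
    fix n
    define x y where "x = Q powi (int N + n)" and "y = Q powi (int N - n)"
    define a b where "a = iq (int N + n + 1)" and "b = iq (int N - n + 1)"
    have xy: "Q ^ (2 * N) = x * y" unfolding x_def y_def by (rule Q2N)
    have c: "iq (int N + n) = (1 - Q * x) * a" "iq (int N + n - 1) = (1 - x) * ((1 - Q * x) * a)"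
      "iq (int N - n) = (1 - Q * y) * b" "iq (int N - n - 1) = (1 - y) * ((1 - Q * y) * b)"
      using iq_rec[of "int N + n + 1"] iq_rec[of "int N - n + 1"] iq_rec[of "int N + n"] iq_rec[of "int N - n"]
      by (simp_all add: a_def b_def x_def y_def power_int_add_1')
    have e1: "- z * Q ^ N * (qt Q (n + - 1) * z powi (n + - 1)) = qt Q n * z powi n * (Q * y)"
    proof -
      have "Q ^ N * Q powi (1 - n) = Q * y"
        by (simp add: y_def power_int_diff)
      moreover have "z * z powi (n - 1) = z powi n" using z by (simp add: power_int_diff)
      moreover have "- z * Q ^ N * (qt Q (n + - 1) * z powi (n + - 1)) =
          qt Q n * (z * z powi (n - 1)) * (Q ^ N * Q powi (1 - n))"
        using qt_minus1[of n] by (simp add: mult_ac)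
      ultimately show ?thesis by simp
    qed
    have e2: "- (Q ^ (N + 1)) / z * (qt Q (n + 1) * z powi (n + 1)) = qt Q n * z powi n * (Q * x)"
      using z by (simp add: qt_add1 x_def power_int_add)
    have i: "int N + (n + - 1) = int N + n - 1" "int N - (n + - 1) = int N - n + 1"
       "int N + (n + 1) = int N + n + 1" "int N - (n + 1) = int N - n - 1"
       "int (Suc N) + n = int N + n + 1" "int (Suc N) - n = int N - n + 1" by auto
    have "(1 + Q ^ (2 * N + 1)) * ?f n + (- z * Q ^ N) * ?f (n + - 1) + (- (Q ^ (N + 1)) / z) * ?f (n + 1) =
       (1 + Q * (x * y)) * (qt Q n * z powi n * (((1 - Q * x) * a) * ((1 - Q * y) * b)))
       + (- z * Q ^ N * (qt Q (n + - 1) * z powi (n + - 1))) * (((1 - x) * ((1 - Q * x) * a)) * b)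
       + (- (Q ^ (N + 1)) / z * (qt Q (n + 1) * z powi (n + 1))) * (a * ((1 - y) * ((1 - Q * y) * b)))"
      unfolding i unfolding c by (simp only: a_def[symmetric] b_def[symmetric] xy[symmetric]) (simp add: mult_ac)
    also have "\<dots> = ((1 - Q * (x * y)) * (1 - Q ^ 2 * (x * y))) * (qt Q n * z powi n * (a * b))"
      unfolding e1 e2 by algebra
    also have "\<dots> = ((1 - Q ^ (2 * N + 1)) * (1 - Q ^ (2 * N + 2))) * (qt Q n * z powi n * ?c (Suc N) n)"
      unfolding i by (simp add: a_def b_def xy[symmetric] power2_eq_square mult_ac)
    finally show "(1 + Q ^ (2 * N + 1)) * ?f n + (- z * Q ^ N) * ?f (n + - 1) + (- (Q ^ (N + 1)) / z) * ?f (n + 1)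
      = ((1 - Q ^ (2 * N + 1)) * (1 - Q ^ (2 * N + 2))) * (qt Q n * z powi n * ?c (Suc N) n)" .
  qed
  also have "qpoch Q Q (2 * N) * \<dots> = jac (Suc N) z"
    unfolding infsum_cmult_right' jac_def by (simp add: qpoch_Suc)
  finally show ?case ..
qed

text \<open>The limit of \<open>jac_product\<close>. Both factors \<open>iq\<close> tend to the
  reciprocal of \<open>qpoch_inf Q Q\<close>, and their boundedness lets the theta series
  dominate.\<close>

theorem jacobi_triple:
  assumes z: "z \<noteq> 0"
  shows "theta Q z = jtheta z Q"
proof -
  obtain C where C: "\<And>n. norm (qpoch Q Q n) \<le> C" using qpoch_bounded[of Q] by auto
  obtain D where D: "\<And>a b. norm (iq a * iq b) \<le> D" using iq_prod_bounded by auto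
  have "C \<ge> 0" using C[of 0] norm_ge_zero order_trans by blast
  have i: "qpoch_inf Q Q \<noteq> 0" by (rule qpoch_inf_nz'[OF lt1])
  have "(\<lambda>N. \<Sum>\<^sub>\<infinity>n. qpoch Q Q (2 * N) * (qt Q n * z powi n * (iq (int N + n) * iq (int N - n))))
     \<longlonglongrightarrow> (\<Sum>\<^sub>\<infinity>n. qpoch_inf Q Q * (qt Q n * z powi n * (1 / qpoch_inf Q Q * (1 / qpoch_inf Q Q))))"
  proof (rule infsum_int_dominated)
    show "(\<lambda>N. qpoch Q Q (2 * N) * (qt Q n * z powi n * (iq (int N + n) * iq (int N - n)))) \<longlonglongrightarrow>
        qpoch_inf Q Q * (qt Q n * z powi n * (1 / qpoch_inf Q Q * (1 / qpoch_inf Q Q)))" for n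
      using iq_tendsto[of n] iq_tendsto[of "- n"]
      by (intro tendsto_mult tendsto_const qpoch_subseq) (auto simp: strict_mono_def)
    show "norm (qpoch Q Q (2 * N) * (qt Q n * z powi n * (iq (int N + n) * iq (int N - n)))) \<le>
        C * (norm (qt Q n * z powi n) * D)" for N n
      unfolding norm_mult[of "qpoch Q Q (2 * N)"] norm_mult[of "qt Q n * z powi n"]
      using C D \<open>C \<ge> 0\<close> by (intro mult_mono) auto
    show "(\<lambda>n. C * (norm (qt Q n * z powi n) * D)) summable_on UNIV"
      using theta_summable[OF z]
      by (intro summable_on_cmult_right summable_on_cmult_left) (simp add: summable_on_iff_abs_summable_on_complex)
  qed
  hence "jac' \<longlonglongrightarrow> theta Q z / qpoch_inf Q Q" if "jac' = (\<lambda>N. jac N z)" for jac'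
    unfolding that jac_def infsum_cmult_right' infsum_cmult_left' theta_def using i by simp
  moreover have "(\<lambda>N. jac N z) \<longlonglongrightarrow> qpoch_inf z Q * qpoch_inf (Q / z) Q"
    unfolding jac_product[OF z] by (intro tendsto_mult qpoch_tendsto)
  ultimately have "theta Q z / qpoch_inf Q Q = qpoch_inf z Q * qpoch_inf (Q / z) Q"
    using LIMSEQ_unique by blast
  thus ?thesis using i by (simp add: jtheta_def field_simps)
qed

text \<open>The quotient \<open>theta Q z / (1 - 1 / z)\<close> is known both as a series, from
  \<open>theta_divide\<close> with \<open>m = 0\<close>, and as a product, from the triple product.
  Both sides are compared in the limit \<open>z\<close> to 1.\<close>

lemma K_product: "K = qpoch_inf Q Q ^ 3"
proof -
  \<comment> \<open>The values tend to 1 without reaching it, so the division is legitimate. Their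
    norms lie between 1 and 2, so that each power is dominated by \<open>2 powi i + 1\<close>
    uniformly in \<open>N\<close>.\<close>
  define z :: "nat \<Rightarrow> complex" where "z = (\<lambda>N. of_real (1 + 1 / (real N + 1)))"
  have z_lim: "z \<longlonglongrightarrow> 1"
  proof -
    have "(\<lambda>N. 1 + inverse (real (Suc N))) \<longlonglongrightarrow> 1 + 0" by (intro tendsto_intros LIMSEQ_inverse_real_of_nat)
    from tendsto_of_real[OF this, where ?'a = complex] show ?thesis
      unfolding z_def by (simp add: inverse_eq_divide add.commute)
  qed
  have norm_z: "norm (z N) = 1 + 1 / (real N + 1)" for N
    unfolding z_def norm_of_real by simp
  have z_ge: "norm (z N) \<ge> 1" "norm (z N) \<le> 2" "norm (z N) > 1" for N by (auto simp: norm_z field_simps)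
  have z: "z N \<noteq> 0" "z N \<noteq> 1" for N using z_ge(3)[of N] by auto
  have powi_le: "norm (z N powi i) \<le> 2 powi i + 1" for N i
  proof (cases "i \<ge> 0")
    case True
    hence "norm (z N) powi i \<le> 2 powi i" using z_ge by (intro power_int_mono) auto
    thus ?thesis by (simp add: norm_power_int)
  next
    case False
    hence "norm (z N) powi i \<le> 1" using z_ge(1)[of N] by (simp add: power_int_def power_le_one inverse_le_1_iff)
    moreover have "(0::real) \<le> 2 powi i" by simp
    ultimately show ?thesis unfolding norm_power_int by linarith
  qed
  have lim1: "(\<lambda>N. \<Sum>\<^sub>\<infinity>i. qt Q i * z N powi i * h i) \<longlonglongrightarrow> (\<Sum>\<^sub>\<infinity>i. qt Q i * 1 powi i * h i)"
  proof (rule infsum_int_dominated)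
    show "(\<lambda>N. qt Q n * z N powi n * h n) \<longlonglongrightarrow> qt Q n * 1 powi n * h n" for n
      by (intro tendsto_intros z_lim) auto
    show "norm (qt Q n * z N powi n * h n) \<le> (norm (qt Q n) * (2 powi n + 1)) * qt_mass" for N n
      unfolding norm_mult using powi_le[of N n] h_bound[of n]
      by (intro mult_mono mult_nonneg_nonneg add_nonneg_nonneg) auto
    have "(\<lambda>n. norm (qt Q n * 2 powi n) + norm (qt Q n * 1 powi n)) summable_on UNIV"
      using theta_summable[of 2] theta_summable[of 1]
      by (intro summable_on_add) (simp_all only: summable_on_iff_abs_summable_on_complex, simp_all)
    thus "(\<lambda>n. norm (qt Q n) * (2 powi n + 1) * qt_mass) summable_on UNIV"
      by (intro summable_on_cmult_left) (simp add: norm_mult norm_power_int algebra_simps)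
  qed
  have "(\<Sum>\<^sub>\<infinity>i. qt Q i * z N powi i * h i) = - z N * qpoch_inf (z N * Q) Q * qpoch_inf (Q / z N) Q * qpoch_inf Q Q" for N
  proof -
    have "theta Q (z N) = (1 - z N) * (qpoch_inf (z N * Q) Q * qpoch_inf (Q / z N) Q * qpoch_inf Q Q)"
      using z by (simp add: jacobi_triple jtheta_def qpoch_inf_Suc[of "z N"])
    moreover have "theta Q (z N) / (1 - 1 / z N) = (\<Sum>\<^sub>\<infinity>i. qt Q i * z N powi i * h i)"
      using theta_divide[of "z N" 0] z by simp
    moreover have "(1 - z N) / (1 - 1 / z N) = - z N" using z[of N] by (simp add: field_simps)
    ultimately show ?thesis by (metis (no_types, lifting) mult.assoc times_divide_eq_left)
  qed
  moreover have "(\<lambda>N. - z N * qpoch_inf (z N * Q) Q * qpoch_inf (Q / z N) Q * qpoch_inf Q Q) \<longlonglongrightarrow>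
      - 1 * qpoch_inf (1 * Q) Q * qpoch_inf (Q / 1) Q * qpoch_inf Q Q"
    by (intro tendsto_mult tendsto_minus tendsto_const z_lim isCont_tendsto_compose[OF qpoch_inf_continuous]
        tendsto_divide) auto
  ultimately have "(\<Sum>\<^sub>\<infinity>i. qt Q i * 1 powi i * h i) = - (qpoch_inf Q Q ^ 3)"
    using LIMSEQ_unique[OF lim1] by (simp add: power3_eq_cube)
  thus ?thesis by (simp add: K_def hsum_def)
qed

end

section \<open>Watson's identity\<close>

text \<open>The integers are folded along the reflection of \<open>k\<close> to
  \<open>- k - 1\<close>, the symmetry of Watson's series.\<close>

lemma infsum_int_nat:
  fixes f :: "int \<Rightarrow> complex"
  assumes "f summable_on UNIV"
  shows "(\<lambda>k. f (int k) + f (- int k - 1)) summable_on UNIV"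
    and "(\<Sum>\<^sub>\<infinity>n. f n) = (\<Sum>\<^sub>\<infinity>k. f (int k) + f (- int k - 1))"
proof -
  have sub: "f summable_on A" for A by (rule summable_on_subset_banach[OF assms]) auto
  have inj: "inj_on (\<lambda>k. - int k - 1) UNIV" by (auto simp: inj_on_def)
  have s: "(\<lambda>k. f (int k)) summable_on UNIV" "(\<lambda>k. f (- int k - 1)) summable_on UNIV"
    using sub[of "range int"] sub[of "range (\<lambda>k. - int k - 1)"] inj
    by (simp_all add: summable_on_reindex o_def)
  thus "(\<lambda>k. f (int k) + f (- int k - 1)) summable_on UNIV" by (rule summable_on_add)
  have "x \<in> range int \<union> range (\<lambda>k. - int k - 1)" for x
    by (cases x rule: int_cases) auto
  hence U: "(UNIV :: int set) = range int \<union> range (\<lambda>k. - int k - 1)" by auto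
  have "(\<Sum>\<^sub>\<infinity>n. f n) = infsum f (range int) + infsum f (range (\<lambda>k. - int k - 1))"
    by (subst U, rule infsum_Un_disjoint) (auto intro: sub)
  also have "\<dots> = (\<Sum>\<^sub>\<infinity>k. f (int k)) + (\<Sum>\<^sub>\<infinity>k. f (- int k - 1))"
    using inj by (simp add: infsum_reindex o_def)
  also have "\<dots> = (\<Sum>\<^sub>\<infinity>k. f (int k) + f (- int k - 1))"
    by (rule infsum_add[symmetric]) (fact s)+
  finally show "(\<Sum>\<^sub>\<infinity>n. f n) = (\<Sum>\<^sub>\<infinity>k. f (int k) + f (- int k - 1))" .
qed

lemma tri_neg: "tri (- k) = tri k + k"
  using two_tri[of "- k"] two_tri[of k] by (simp add: algebra_simps)

lemma tri_neg1: "tri (- k - 1) = tri k + 2 * k + 1"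
  using two_tri[of "- k - 1"] two_tri[of k] by (simp add: algebra_simps)

lemma convergent_bounded:
  fixes f :: "nat \<Rightarrow> complex"
  assumes "f \<longlonglongrightarrow> l"
  obtains C where "C > 0" "\<And>n. norm (f n) \<le> C"
  using convergent_imp_Bseq[of f] assms unfolding convergent_def Bseq_def by blast

lemma (in nome) nome_power: "n > 0 \<Longrightarrow> nome (Q ^ n)"
  using lt1 by (auto simp: nome_def norm_power power_less_one_iff)

context qdisc
begin

lemma q_pow_tendsto: "(\<lambda>n. q ^ n) \<longlonglongrightarrow> 0"
  using q1 by (rule LIMSEQ_power_zero)

lemma geom_summable_on: "(\<lambda>n. norm q ^ n) summable_on UNIV"
  using q1 by (subst summable_on_UNIV_nonneg_real_iff) (auto intro!: summable_geometric)

lemma geom_bounded_summable: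
  fixes f :: "nat \<Rightarrow> complex"
  assumes "\<And>n. norm (f n) \<le> C * norm q ^ n"
  shows "summable f" "f summable_on UNIV"
proof -
  have *: "summable (\<lambda>n. C * norm q ^ n)"
    using q1 by (intro summable_mult summable_geometric) auto
  show "summable f" by (rule summable_comparison_test'[OF *]) (use assms in auto)
  have "summable (\<lambda>n. norm (f n))" by (rule summable_comparison_test'[OF *]) (use assms in auto)
  thus "f summable_on UNIV" by (rule norm_summable_imp_summable_on)
qed

lemma geom_bounded_summable2:
  fixes f :: "nat \<times> nat \<Rightarrow> complex"
  assumes "\<And>m n. norm (f (m, n)) \<le> C * (norm q ^ m * norm q ^ n)"
  shows "f summable_on UNIV"
proof -
  have "(\<lambda>n. complex_of_real (norm q) ^ n) summable_on UNIV"
    using summable_on_of_real[OF geom_summable_on, where ?'a = complex] by simp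
  from abs_summable_prod[OF this this]
  have "(\<lambda>p. C * (norm q ^ fst p * norm q ^ snd p)) summable_on UNIV"
    by (intro summable_on_cmult_right) (simp add: case_prod_unfold norm_mult norm_power)
  hence "(\<lambda>p. norm (f p)) summable_on UNIV"
    by (rule Infinite_Sum.abs_summable_on_comparison_test') (use assms in auto)
  thus ?thesis by (rule abs_summable_summable)
qed

end

context nome
begin

text \<open>In the negative direction the term is rewritten as \<open>Q ^ k / (Q ^ k - x)\<close>,
  which tends to 0. Both tails converge, hence are bounded.\<close>

lemma appell_denom_bounded:
  assumes "x \<noteq> 0"
  obtains C where "\<And>m. norm (1 / (1 - x * Q powi m)) \<le> C"
proof -
  have "(\<lambda>k. 1 / (1 - x * Q ^ k)) \<longlonglongrightarrow> 1 / (1 - x * 0)"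
    by (intro tendsto_intros q_pow_tendsto) auto
  then obtain C where C: "C > 0" "\<And>k. norm (1 / (1 - x * Q ^ k)) \<le> C"
    by (rule convergent_bounded) blast
  have "(\<lambda>k. Q ^ k / (Q ^ k - x)) \<longlonglongrightarrow> 0 / (0 - x)"
    using assms by (intro tendsto_intros q_pow_tendsto) auto
  then obtain D where D: "D > 0" "\<And>k. norm (Q ^ k / (Q ^ k - x)) \<le> D"
    by (rule convergent_bounded) blast
  have "norm (1 / (1 - x * Q powi m)) \<le> max C D" for m
  proof (cases "m \<ge> 0")
    case True
    thus ?thesis using C(2)[of "nat m"] by (simp add: power_int_def le_max_iff_disj)
  next
    case False
    hence "1 / (1 - x * Q powi m) = Q ^ nat (- m) / (Q ^ nat (- m) - x)"
      by (simp add: power_int_def power_inverse divide_simps)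
    thus ?thesis using D(2)[of "nat (- m)"] by (simp add: le_max_iff_disj)
  qed
  thus ?thesis using that by blast
qed

lemma appell_summable:
  assumes "x \<noteq> 0" "y \<noteq> 0"
  shows "(\<lambda>n. qt Q n * y powi n / (1 - x * Q powi n)) summable_on UNIV"
proof -
  obtain C where C: "\<And>m. norm (1 / (1 - x * Q powi m)) \<le> C"
    using appell_denom_bounded[OF assms(1)] by blast
  from theta_bounded_summable[OF assms(2) this] show ?thesis by simp
qed

text \<open>The weight of the partitions whose Durfee rectangle is \<open>j\<close> by \<open>j + N\<close>.\<close>

definition durf :: "nat \<Rightarrow> nat \<Rightarrow> complex" where
  "durf N j = Q ^ (j * j + j * N) / (qpoch Q Q j * qpoch Q Q (j + N))"

lemma durf_bound: obtains C where "\<And>N j. norm (durf N j) \<le> C * norm Q ^ j"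
proof -
  obtain C where C: "C > 0" "\<And>k. norm (iq k) \<le> C" using iq_bounded by auto
  have "norm (durf N j) \<le> (C * C) * norm Q ^ j" for N j
  proof -
    have "durf N j = Q ^ (j * j + j * N) * (iq (int j) * iq (int (j + N)))"
      by (simp add: durf_def iq_def flip: of_nat_add)
    moreover have "norm (iq (int j) * iq (int (j + N))) \<le> C * C"
      unfolding norm_mult using C by (intro mult_mono) auto
    moreover have "norm (Q ^ (j * j + j * N)) \<le> norm Q ^ j"
      unfolding norm_power using lt1 by (intro power_decreasing) (auto simp: trans_le_add1)
    ultimately have "norm (durf N j) \<le> norm Q ^ j * (C * C)"
      unfolding \<open>durf N j = _\<close> norm_mult[of "Q ^ _"] by (intro mult_mono) auto
    thus ?thesis by (simp add: mult_ac)
  qed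
  thus ?thesis using that by blast
qed

lemma durf_summable: "summable (durf N)"
  using durf_bound geom_bounded_summable(1) by metis

text \<open>The difference of the terms at \<open>N\<close> and \<open>N + 1\<close> is
  \<open>a j - b j\<close>, where \<open>a\<close> carries the factor \<open>1 - Q ^ j\<close> and
  vanishes at 0. So the sum of \<open>a\<close> may be shifted by one, and
  \<open>a (j + 1) - b j\<close> is \<open>- (Q ^ (N + 1))\<close> times the corresponding
  difference at \<open>N + 1\<close>.\<close>

lemma durf_rec: "(\<Sum>j. durf N j) - (\<Sum>j. durf (Suc N) j)
     = - (Q ^ Suc N) * ((\<Sum>j. durf (Suc N) j) - (\<Sum>j. durf (Suc (Suc N)) j))"
proof -
  define I where "I n = 1 / qpoch Q Q n" for n
  define a b where "a j = Q ^ (j * j + j * N) * (1 - Q ^ j) * (I j * I (j + Suc N))"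
    and "b j = Q ^ (j * j + j * N) * Q ^ (j + Suc N) * (I j * I (j + Suc N))" for j
  have durf_I: "durf N j = Q ^ (j * j + j * N) * (I j * I (j + N))" for N j
    by (simp add: durf_def I_def)
  have I_rec: "I n = (1 - Q * Q ^ n) * I (Suc n)" for n
    using qQ_nz[of "Suc n"] unfolding qpoch_Suc I_def by simp
  have ab: "durf N j - durf (Suc N) j = a j - b j" for j
    unfolding durf_I a_def b_def add_Suc_right I_rec[of "j + N"] by (simp add: power_add algebra_simps)
  have ab': "a (Suc j) - b j = - (Q ^ Suc N) * (durf (Suc N) j - durf (Suc (Suc N)) j)" for j
    unfolding durf_I a_def b_def add_Suc_right add_Suc I_rec[of j] I_rec[of "Suc (j + N)"]
    by (simp add: power_add algebra_simps)
  have "b = (\<lambda>j. Q ^ Suc N * durf (Suc N) j)"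
    by (auto simp: b_def durf_I power_add fun_eq_iff)
  hence sb: "summable b" using durf_summable by (simp add: summable_mult)
  have "a = (\<lambda>j. durf N j - durf (Suc N) j + b j)" using ab by (auto simp: fun_eq_iff)
  hence sa: "summable a" using durf_summable sb by (auto intro!: summable_add summable_diff)
  have "(\<Sum>j. durf N j) - (\<Sum>j. durf (Suc N) j) = (\<Sum>j. a j - b j)"
    unfolding ab[symmetric] by (rule suminf_diff) (rule durf_summable)+
  also have "\<dots> = (\<Sum>j. a j) - (\<Sum>j. b j)" using sa sb by (rule suminf_diff[symmetric])
  also have "(\<Sum>j. a j) = (\<Sum>j. a (Suc j))"
  proof -
    have "a 0 = 0" by (simp add: a_def)
    thus ?thesis using suminf_split_head[OF sa] by simp
  qed
  also have "\<dots> - (\<Sum>j. b j) = (\<Sum>j. a (Suc j) - b j)"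
    using sa sb by (intro suminf_diff) (simp_all add: summable_Suc_iff)
  also have "\<dots> = - (Q ^ Suc N) * (\<Sum>j. durf (Suc N) j - durf (Suc (Suc N)) j)"
    unfolding ab' by (rule suminf_mult) (intro summable_diff durf_summable)
  also have "\<dots> = - (Q ^ Suc N) * ((\<Sum>j. durf (Suc N) j) - (\<Sum>j. durf (Suc (Suc N)) j))"
    by (simp add: suminf_diff[OF durf_summable durf_summable])
  finally show ?thesis .
qed

text \<open>Every partition has a Durfee rectangle of each excess \<open>N\<close>, so the sum is
  independent of \<open>N\<close>. The proof is analytic: by \<open>durf_rec\<close> the successive
  differences cannot decrease in norm as \<open>N\<close> grows, yet they tend to 0, so they all
  vanish, and the constant is the limit, to which only \<open>j = 0\<close> contributes.\<close>

lemma durfee: "(\<Sum>j. durf N j) = 1 / qpoch_inf Q Q"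
proof -
  define d where "d N = (\<Sum>j. durf N j)" for N
  have lim: "d \<longlonglongrightarrow> 1 / qpoch_inf Q Q"
  proof -
    obtain C where C: "\<And>N j. norm (durf N j) \<le> C * norm Q ^ j" using durf_bound by blast
    have "(\<lambda>N. durf N j) \<longlonglongrightarrow> (if j = 0 then 1 / qpoch_inf Q Q else 0)" for j
    proof (cases "j = 0")
      case True
      have "(\<lambda>N. 1 / qpoch Q Q N) \<longlonglongrightarrow> 1 / qpoch_inf Q Q"
        by (intro tendsto_intros qpoch_tendsto qpoch_inf_nz' lt1)
      thus ?thesis using True by (simp add: durf_def)
    next
      case False
      have "strict_mono (\<lambda>N. j + N)" by (simp add: strict_mono_def)
      moreover have "(\<lambda>N. Q ^ (j * j) * (Q ^ j) ^ N / (qpoch Q Q j * qpoch Q Q (j + N))) \<longlonglongrightarrow>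
          Q ^ (j * j) * 0 / (qpoch Q Q j * qpoch_inf Q Q)"
        using lt1 False \<open>strict_mono _\<close>
        by (intro tendsto_intros qpoch_subseq LIMSEQ_power_zero mult_nonneg_nonneg)
           (auto simp: norm_power power_less_one_iff qpoch_inf_nz')
      thus ?thesis using False by (simp add: durf_def power_add power_mult)
    qed
    moreover have "summable (\<lambda>j. C * norm Q ^ j)"
      using lt1 by (intro summable_mult summable_geometric) auto
    ultimately have "(\<lambda>N. \<Sum>j. durf N j) \<longlonglongrightarrow> (\<Sum>j. if j = 0 then 1 / qpoch_inf Q Q else 0)"
      using tannerys_theorem[where a = "\<lambda>j N. durf N j" and M = "\<lambda>j. C * norm Q ^ j" and F = sequentially
          and b = "\<lambda>j. if j = 0 then 1 / qpoch_inf Q Q else 0"] C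
      by (auto intro!: always_eventually)
    also have "(\<Sum>j::nat. if j = 0 then 1 / qpoch_inf Q Q else 0) = 1 / qpoch_inf Q Q"
      by (subst suminf_finite[of "{0}"]) auto
    finally show ?thesis by (simp add: d_def[abs_def])
  qed
  have step: "norm (d N - d (Suc N)) \<le> norm (d (N + k) - d (Suc (N + k)))" for N k
  proof (induction k)
    case (Suc k)
    have "norm (d (N + k) - d (Suc (N + k))) \<le> norm (d (Suc (N + k)) - d (Suc (Suc (N + k))))"
      unfolding d_def durf_rec[of "N + k"] norm_mult norm_minus_cancel using norm_q_pow[of "Suc (N + k)"]
      by (intro mult_left_le_one_le) auto
    thus ?case using Suc by simp
  qed simp
  have "d N = d (Suc N)" for N
  proof -
    have "strict_mono (\<lambda>k. N + k)" "strict_mono (\<lambda>k. Suc (N + k))" by (auto simp: strict_mono_def)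
    hence "(\<lambda>k. norm (d (N + k) - d (Suc (N + k)))) \<longlonglongrightarrow> norm (1 / qpoch_inf Q Q - 1 / qpoch_inf Q Q)"
      using LIMSEQ_subseq_LIMSEQ[OF lim] by (intro tendsto_norm tendsto_diff) (auto simp: o_def)
    hence "norm (d N - d (Suc N)) \<le> 0"
      by (intro LIMSEQ_le_const[where X = "\<lambda>k. norm (d (N + k) - d (Suc (N + k)))"]) (use step in auto)
    thus ?thesis by simp
  qed
  hence d0: "d N = d 0" for N by (induction N) auto
  hence "d = (\<lambda>_. d 0)" by auto
  hence "d 0 = 1 / qpoch_inf Q Q" using lim LIMSEQ_unique[of d] tendsto_const by metis
  thus ?thesis using d0[of N] by (simp add: d_def)
qed

text \<open>The residues of the product of the \<open>1 / a k\<close> in \<open>partial_fractions\<close>.\<close>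

definition pfc :: "nat \<Rightarrow> nat \<Rightarrow> complex" where
  "pfc n k = qt Q (- int k) * (1 - Q ^ (2 * k + 1)) * iq (int n - int k) * iq (int n + int k + 1)"

text \<open>Up to the factor \<open>Q ^ N\<close>, these are the terms of the finite triple product
  at \<open>z = 1\<close>, paired as \<open>k\<close> and \<open>- k - 1\<close>; that product
  contains the factor \<open>1 - z\<close>.\<close>

lemma pfc_sum_0:
  assumes "N > 0"
  shows "(\<Sum>k\<le>N. pfc N k * Q ^ (N - k)) = 0"
proof -
  define f where "f n = qt Q n * (iq (int N + n) * iq (int N - n))" for n
  have eq: "pfc N k * Q ^ (N - k) = Q ^ N * (f (int k) + f (- int k - 1))" if "k \<le> N" for k
  proof -
    define a b where "a = iq (int N - int k)" and "b = iq (int N + int k + 1)"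
    have i: "int N + - int k - 1 = int N - int k - 1" "int N - (- int k - 1) = int N + int k + 1"
      "int N + (- int k - 1) = int N - int k - 1" by auto
    have 1: "iq (int N + int k) = (1 - Q ^ (N + k + 1)) * b"
      using iq_rec[of "int N + int k + 1"] by (simp add: b_def power_int_add power_add)
    have "Q powi (int N - int k) = Q ^ (N - k)" using that by (simp flip: of_nat_diff)
    hence 2: "iq (int N - int k - 1) = (1 - Q ^ (N - k)) * a"
      using iq_rec[of "int N - int k"] by (simp add: a_def)
    have t: "tri (- int k - 1) = tri (int k) + 2 * int k + 1" "tri (- int k) = tri (int k) + int k"
      by (rule tri_neg1, rule tri_neg)
    have s: "(-1 :: complex) powi (- int k - 1) = - ((-1) ^ k)" "(-1 :: complex) powi (- int k) = (-1) ^ k"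
      by (auto simp: power_int_diff power_int_minus_one_minus)
    have "Q powi (tri (int k) + 2 * int k + 1) = Q powi tri (int k) * Q powi int (2 * k + 1)"
      by (subst power_int_add[symmetric]) (auto simp: add_ac)
    hence q: "qt Q (- int k - 1) = - (qt Q (int k) * Q ^ (2 * k + 1))"
      unfolding qt_def t s power_int_of_nat by simp
    have "Q powi (tri (int k) + int k) = Q powi tri (int k) * Q powi int k"
      by (subst power_int_add) auto
    hence q': "qt Q (- int k) = qt Q (int k) * Q ^ k"
      unfolding qt_def t s power_int_of_nat by simp
    have QN: "Q ^ N = Q ^ k * Q ^ (N - k)" using that by (simp flip: power_add)
    have Q2: "Q ^ (2 * k + 1) = Q ^ k * (Q ^ k * Q)" "Q ^ (N + k + 1) = Q ^ N * (Q ^ k * Q)"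
      by (simp_all add: mult_2 power_add)
    show ?thesis
      unfolding f_def pfc_def i 1 2 q q' a_def[symmetric] b_def[symmetric] Q2 QN by (simp add: algebra_simps)
  qed
  have sf: "f summable_on UNIV" using jac_summable[of 1 N] by (simp add: f_def[abs_def])
  have "0 = jac N 1" using jac_product[of 1 N] assms by (cases N) (auto simp: qpoch_Suc')
  hence "(\<Sum>\<^sub>\<infinity>n. f n) = 0" by (simp add: jac_def f_def)
  also have "(\<Sum>\<^sub>\<infinity>n. f n) = (\<Sum>\<^sub>\<infinity>k. f (int k) + f (- int k - 1))" by (rule infsum_int_nat(2)[OF sf])
  also have "\<dots> = (\<Sum>\<^sub>\<infinity>k\<in>{..N}. f (int k) + f (- int k - 1))"
    by (intro infsum_cong_neutral) (auto simp: f_def iq_def)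
  finally have "(\<Sum>k\<le>N. f (int k) + f (- int k - 1)) = 0" by simp
  thus ?thesis by (simp add: eq sum_distrib_left[symmetric])
qed

lemma partial_fractions:
  assumes x: "x \<noteq> 0" and a_def: "\<And>k. a k = (1 - x * Q ^ k) * (1 - Q ^ Suc k / x)"
    and a_nz: "\<And>k. a k \<noteq> 0"
  shows "1 / (\<Prod>k\<le>n. a k) = (\<Sum>k\<le>n. pfc n k / a k)"
proof (induction n)
  case 0
  have "Q \<noteq> 1" using lt1 by auto
  thus ?case by (simp add: pfc_def iq_def qpoch_def)
next
  case (Suc n)
  \<comment> \<open>Expanded, \<open>a k\<close> is
    \<open>1 + Q ^ (2 * k + 1) - Q ^ k * (x + Q / x)\<close>. Hence
    \<open>a (Suc n) - Q ^ (Suc n - k) * a k\<close> is free of \<open>x\<close>, and it factors as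
    shown.\<close>
  have rel: "a (Suc n) = Q ^ (Suc n - k) * a k + (1 - Q ^ (Suc n - k)) * (1 - Q ^ (n + k + 2))" if "k \<le> Suc n" for k
  proof -
    define E P where "E = Q ^ (Suc n - k)" and "P = Q ^ k"
    have R: "Q ^ Suc n = E * P" unfolding E_def P_def using that by (simp only: flip: power_add) simp
    have "Q ^ (n + k + 2) = Q * (Q ^ Suc n * P)" by (simp add: P_def power_add power2_eq_square mult_ac)
    hence R': "Q ^ (n + k + 2) = Q * (E * P * P)" using R by simp
    have "Q ^ Suc (Suc n) = Q * (E * P)" "Q ^ Suc k = Q * P" using R by (simp_all add: P_def)
    thus ?thesis unfolding a_def R' R E_def[symmetric] P_def[symmetric] using x by (simp add: field_simps)
  qed
  have step: "pfc (Suc n) k * ((1 - Q ^ (Suc n - k)) * (1 - Q ^ (n + k + 2))) = pfc n k" if "k \<le> Suc n" for k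
  proof -
    have "int (Suc n) - int k = int (Suc n - k)" using that by simp
    hence "Q powi (int (Suc n) - int k) = Q ^ (Suc n - k)" by (simp only: power_int_of_nat)
    hence "iq (int n - int k) = (1 - Q ^ (Suc n - k)) * iq (int (Suc n) - int k)"
      using iq_rec[of "int (Suc n) - int k"] by simp
    moreover have "iq (int n + int k + 1) = (1 - Q ^ (n + k + 2)) * iq (int (Suc n) + int k + 1)"
      using iq_rec[of "int (Suc n) + int k + 1"]
      by (simp add: add_ac power_int_add power_add power2_eq_square mult_ac)
    ultimately show ?thesis by (simp add: pfc_def mult_ac)
  qed
  have "a (Suc n) * (\<Sum>k\<le>Suc n. pfc (Suc n) k / a k) =
     (\<Sum>k\<le>Suc n. pfc (Suc n) k * Q ^ (Suc n - k) + pfc n k / a k)"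
    unfolding sum_distrib_left
  proof (rule sum.cong[OF refl])
    fix k assume k: "k \<in> {..Suc n}"
    have "a (Suc n) * (pfc (Suc n) k / a k) = pfc (Suc n) k * Q ^ (Suc n - k) +
       pfc (Suc n) k * ((1 - Q ^ (Suc n - k)) * (1 - Q ^ (n + k + 2))) / a k"
    proof -
      have "(E * A + X) * (p / A) = p * E + p * X / A" if "A \<noteq> 0" for A E X p :: complex
        using that by (simp add: field_simps)
      from this[OF a_nz] show ?thesis using rel[of k] k by simp
    qed
    thus "a (Suc n) * (pfc (Suc n) k / a k) = pfc (Suc n) k * Q ^ (Suc n - k) + pfc n k / a k"
      using step[of k] k by simp
  qed
  \<comment> \<open>The parts in which \<open>a k\<close> has cancelled add up to 0 by
    \<open>pfc_sum_0\<close>; the others lower the index of \<open>pfc\<close> by one.\<close>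
  also have "\<dots> = (\<Sum>k\<le>Suc n. pfc n k / a k)"
    using pfc_sum_0[of "Suc n"] by (simp add: sum.distrib del: sum.atMost_Suc)
  also have "\<dots> = (\<Sum>k\<le>n. pfc n k / a k)" by (simp add: pfc_def[of n "Suc n"] iq_def)
  finally have "a (Suc n) * (\<Sum>k\<le>Suc n. pfc (Suc n) k / a k) = 1 / (\<Prod>k\<le>n. a k)"
    using Suc by simp
  hence "(\<Sum>k\<le>Suc n. pfc (Suc n) k / a k) = 1 / (\<Prod>k\<le>n. a k) / a (Suc n)"
    using a_nz[of "Suc n"] by (metis nonzero_mult_div_cancel_left)
  thus ?case by simp
qed

text \<open>The left-hand series is the universal mock theta function g_3. Each of its terms is
  expanded in partial fractions and the order of summation is interchanged: for a fixed pole index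
  \<open>k\<close> the sum over \<open>n\<close> is a Durfee rectangle sum of excess
  \<open>2 * k + 1\<close>, so each column contributes the same factor.\<close>

theorem watson:
  assumes x: "x \<noteq> 0" "\<And>m. x \<noteq> Q powi m"
  shows "qpoch_inf Q Q * (\<Sum>n. Q ^ (n * (n + 1)) / (qpoch x Q (n + 1) * qpoch (Q / x) Q (n + 1)))
     = (\<Sum>\<^sub>\<infinity>n. qt (Q ^ 3) n * (Q ^ 3) powi n / (1 - x * Q powi n))"
proof -
  interpret Q3: nome "Q ^ 3" by (rule nome_power) simp
  define a where "a k = (1 - x * Q ^ k) * (1 - Q ^ Suc k / x)" for k
  have nz1: "1 - x * Q ^ k \<noteq> 0" for k
    using x(2)[of "- int k"] by (auto simp: power_int_minus field_simps)
  have nz2: "1 - Q ^ Suc k / x \<noteq> 0" for k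
    using x(2)[of "int (Suc k)"] x(1) unfolding power_int_of_nat by (auto simp: field_simps)
  have a_nz: "a k \<noteq> 0" for k using nz1 nz2 by (simp add: a_def)
  have "(\<lambda>k. 1 / a k) \<longlonglongrightarrow> 1 / ((1 - x * 0) * (1 - Q * 0 / x))"
    unfolding a_def power_Suc using x by (intro tendsto_intros q_pow_tendsto) auto
  then obtain A where A: "A > 0" "\<And>k. norm (1 / a k) \<le> A" by (rule convergent_bounded) blast
  obtain D where D: "\<And>a b. norm (iq a * iq b) \<le> D" using iq_prod_bounded by auto
  have "D \<ge> 0" using D norm_ge_zero order_trans by blast
  \<comment> \<open>As \<open>pfc n k\<close> vanishes for \<open>k > n\<close>, the triangular
    double sum can be taken over all pairs; for \<open>k\<close> up to \<open>n\<close> the exponent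
    \<open>n * (n + 1)\<close> is at least \<open>n + k\<close>, which yields a geometric bound in
    both indices.\<close>
  define F where "F = (\<lambda>(n, k). Q ^ (n * (n + 1)) * (pfc n k / a k))"
  have F_bd: "norm (F (n, k)) \<le> (2 * D * A) * (norm Q ^ n * norm Q ^ k)" for n k
  proof (cases "k \<le> n")
    case True
    have "norm (Q ^ (n * (n + 1))) \<le> norm Q ^ (n + k)"
      unfolding norm_power using lt1 True by (intro power_decreasing) (auto intro: order.trans[OF _ le_square])
    moreover have "norm (pfc n k / a k) \<le> 2 * D * A"
    proof -
      have "norm (qt Q (- int k)) \<le> 1"
        using lt1 tri_nonneg by (simp add: qt_def norm_mult norm_power_int power_int_le_one)
      moreover have "norm (1 - Q ^ (2 * k + 1)) \<le> 2"
        using norm_triangle_ineq4[of 1 "Q ^ (2 * k + 1)"] norm_q_pow[of "2 * k + 1"] by simp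
      ultimately have "norm (qt Q (- int k)) * norm (1 - Q ^ (2 * k + 1)) *
          norm (iq (int n - int k) * iq (int n + int k + 1)) * norm (1 / a k) \<le> 1 * 2 * D * A"
        using D A \<open>D \<ge> 0\<close> by (intro mult_mono) auto
      thus ?thesis by (simp add: pfc_def norm_mult norm_divide mult_ac)
    qed
    ultimately have "norm (Q ^ (n * (n + 1))) * norm (pfc n k / a k) \<le> norm Q ^ (n + k) * (2 * D * A)"
      by (intro mult_mono) auto
    thus ?thesis unfolding F_def prod.case norm_mult[of "Q ^ (n * (n + 1))"] by (simp only: power_add mult_ac)
  next
    case False
    thus ?thesis using \<open>D \<ge> 0\<close> A by (simp add: F_def pfc_def iq_def)
  qed
  have F: "F summable_on UNIV" by (rule geom_bounded_summable2[OF F_bd])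
  have Fs: "(\<lambda>(k, n). F (n, k)) summable_on UNIV"
    using F by (subst summable_on_reindex_bij_witness[of _ prod.swap prod.swap _ F]) auto
  have row: "(\<Sum>\<^sub>\<infinity>k. F (n, k)) = Q ^ (n * (n + 1)) / (qpoch x Q (n + 1) * qpoch (Q / x) Q (n + 1))" for n
  proof -
    have "(\<Sum>\<^sub>\<infinity>k. F (n, k)) = (\<Sum>\<^sub>\<infinity>k\<in>{..n}. F (n, k))"
      by (intro infsum_cong_neutral) (auto simp: F_def pfc_def iq_def)
    also have "\<dots> = Q ^ (n * (n + 1)) * (1 / (\<Prod>k\<le>n. a k))"
      by (subst partial_fractions[OF x(1) a_def a_nz]) (simp add: F_def sum_distrib_left)
    also have "(\<Prod>k\<le>n. a k) = qpoch x Q (n + 1) * qpoch (Q / x) Q (n + 1)"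
      by (simp add: a_def prod.distrib qpoch_def lessThan_Suc_atMost mult_ac)
    finally show ?thesis by simp
  qed
  have col: "(\<Sum>\<^sub>\<infinity>n. F (n, k)) = 1 / qpoch_inf Q Q *
      (qt Q (- int k) * Q ^ (k * (k + 1)) * (1 - Q ^ (2 * k + 1)) / a k)" for k
  proof -
    have "(\<Sum>\<^sub>\<infinity>n. F (n, k)) = (\<Sum>\<^sub>\<infinity>n\<in>range (\<lambda>j. j + k). F (n, k))"
    proof (intro infsum_cong_neutral)
      fix n assume "n \<in> UNIV - range (\<lambda>j. j + k)"
      hence "n < k" by (metis DiffD2 le_add_diff_inverse2 not_le_imp_less rangeI)
      thus "F (n, k) = 0" by (simp add: F_def pfc_def iq_def)
    qed auto
    also have "\<dots> = (\<Sum>\<^sub>\<infinity>j. F (j + k, k))"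
      by (subst infsum_reindex) (auto simp: o_def inj_on_def)
    also have "\<dots> = (\<Sum>\<^sub>\<infinity>j. (qt Q (- int k) * Q ^ (k * (k + 1)) * (1 - Q ^ (2 * k + 1)) / a k) * durf (2 * k + 1) j)"
    proof (intro infsum_cong)
      fix j
      have "Q ^ ((j + k) * (j + k + 1)) = Q ^ (k * (k + 1)) * Q ^ (j * j + j * (2 * k + 1))"
        unfolding power_add[symmetric] by (rule arg_cong[of _ _ "power Q"]) (simp add: algebra_simps)
      thus "F (j + k, k) = (qt Q (- int k) * Q ^ (k * (k + 1)) * (1 - Q ^ (2 * k + 1)) / a k) * durf (2 * k + 1) j"
        by (simp add: F_def pfc_def iq_def durf_def nat_add_distrib mult_2_right add_ac mult_ac)
    qed
    also have "\<dots> = (qt Q (- int k) * Q ^ (k * (k + 1)) * (1 - Q ^ (2 * k + 1)) / a k) * (1 / qpoch_inf Q Q)"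
    proof -
      obtain C where "\<And>N j. norm (durf N j) \<le> C * norm Q ^ j" using durf_bound by blast
      hence "durf (2 * k + 1) summable_on UNIV" by (rule geom_bounded_summable(2))
      hence "(durf (2 * k + 1) has_sum infsum (durf (2 * k + 1)) UNIV) UNIV" by simp
      from sums_unique[OF has_sum_imp_sums[OF this]] show ?thesis
        unfolding infsum_cmult_right' durfee by simp
    qed
    finally show ?thesis by simp
  qed
  let ?g = "\<lambda>n. qt (Q ^ 3) n * (Q ^ 3) powi n / (1 - x * Q powi n)"
  have gs: "?g summable_on UNIV"
  proof -
    obtain C where C: "\<And>m. norm (1 / (1 - x * Q powi m)) \<le> C"
      using appell_denom_bounded[OF x(1)] by blast
    from Q3.theta_bounded_summable[of "Q ^ 3", OF _ this] show ?thesis by simp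
  qed
  \<comment> \<open>The terms \<open>k\<close> and \<open>- k - 1\<close> of the bilateral series
    have opposite numerators; over the common denominator \<open>a k\<close> they leave the factor
    \<open>1 - Q ^ (2 * k + 1)\<close>.\<close>
  have pair: "qt Q (- int k) * Q ^ (k * (k + 1)) * (1 - Q ^ (2 * k + 1)) / a k = ?g (int k) + ?g (- int k - 1)" for k
  proof -
    define c where "c = qt (Q ^ 3) (int k) * (Q ^ 3) ^ k"
    note t1 = tri_neg[of "int k"] and t = tri_neg1[of "int k"]
    have k2: "int (k * (k + 1)) = 2 * tri (int k) + 2 * int k" using two_tri[of "int k"] by (simp add: algebra_simps)
    have kk: "Q ^ (k * (k + 1)) = Q powi (2 * tri (int k) + 2 * int k)" unfolding k2[symmetric] power_int_of_nat ..
    have c3: "(Q ^ 3) powi tri (int k) = Q powi (3 * tri (int k))" "(Q ^ 3) ^ k = Q powi (3 * int k)"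
    proof -
      have "(Q ^ 3) ^ k = Q powi int (3 * k)" unfolding power_int_of_nat power_mult ..
      thus "(Q ^ 3) ^ k = Q powi (3 * int k)" by simp
    qed (simp add: power_int_power)
    have "Q powi (tri (int k) + int k) * Q powi (2 * tri (int k) + 2 * int k) = Q powi (3 * tri (int k)) * Q powi (3 * int k)"
      by (subst (1 2) power_int_add[symmetric]) auto
    moreover have "(-1 :: complex) powi (- int k) = (-1) ^ k" by (simp add: power_int_minus_one_minus)
    ultimately have 1: "qt Q (- int k) * Q ^ (k * (k + 1)) = c"
      unfolding c_def qt_def t1 kk c3 by simp
    have 2: "qt (Q ^ 3) (- int k - 1) * (Q ^ 3) powi (- int k - 1) = - c"
    proof -
      have "(-1 :: complex) powi (- int k - 1) = - ((-1) ^ k)" by (auto simp: power_int_diff power_int_minus_one_minus)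
      moreover have "(Q ^ 3) powi tri (- int k - 1) * (Q ^ 3) powi (- int k - 1) = (Q ^ 3) powi tri (int k) * (Q ^ 3) ^ k"
        unfolding t power_int_of_nat[symmetric] by (subst (1 2) power_int_add[symmetric]) (auto simp: add.commute)
      ultimately show ?thesis by (simp add: qt_def c_def)
    qed
    have "Q powi (- int k - 1) = 1 / Q ^ Suc k"
      by (simp add: power_int_diff power_int_minus field_simps)
    hence 3: "- c / (1 - x * Q powi (- int k - 1)) = c * (Q ^ Suc k / x) / (1 - Q ^ Suc k / x)"
    proof -
      have "- c / (1 - x * (1 / P)) = c * (P / x) / (1 - P / x)" if "P \<noteq> 0" "x \<noteq> P" for P
      proof -
        have "1 - x * (1 / P) = (P - x) / P" "1 - P / x = - ((P - x) / x)"
          using that x(1) by (simp_all add: field_simps)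
        thus ?thesis using that x(1) by simp
      qed
      moreover have "x \<noteq> Q ^ Suc k" using nz2[of k] x(1) by auto
      ultimately show ?thesis unfolding \<open>Q powi _ = _\<close> using nz by (metis power_not_zero)
    qed
    have "?g (int k) + ?g (- int k - 1) = c / (1 - x * Q ^ k) + c * (Q ^ Suc k / x) / (1 - Q ^ Suc k / x)"
      unfolding 2 3[symmetric] by (simp add: c_def)
    also have "\<dots> = c * (((1 - Q ^ Suc k / x) + (Q ^ Suc k / x) * (1 - x * Q ^ k)) / a k)"
      using nz1[of k] nz2[of k] unfolding a_def by (subst add_frac_eq) (auto simp: algebra_simps)
    also have "(1 - Q ^ Suc k / x) + (Q ^ Suc k / x) * (1 - x * Q ^ k) = 1 - Q ^ (2 * k + 1)"
    proof -
      have "(1 - R / x) + (R / x) * (1 - x * P) = 1 - R * P" for R P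
        using x(1) by (simp add: field_simps)
      moreover have "Q ^ (2 * k + 1) = Q ^ Suc k * Q ^ k" by (simp add: mult_2 power_add)
      ultimately show ?thesis by metis
    qed
    finally show ?thesis unfolding 1 by simp
  qed
  have "(\<Sum>n. Q ^ (n * (n + 1)) / (qpoch x Q (n + 1) * qpoch (Q / x) Q (n + 1))) = (\<Sum>\<^sub>\<infinity>n. \<Sum>\<^sub>\<infinity>k. F (n, k))"
  proof -
    have "(\<lambda>n. \<Sum>\<^sub>\<infinity>k. F (n, k)) summable_on UNIV"
      using summable_on_Sigma_banach[of "\<lambda>n k. F (n, k)" UNIV "\<lambda>_. UNIV"] F by simp
    hence "((\<lambda>n. \<Sum>\<^sub>\<infinity>k. F (n, k)) has_sum (\<Sum>\<^sub>\<infinity>n. \<Sum>\<^sub>\<infinity>k. F (n, k))) UNIV" by simp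
    from sums_unique[OF has_sum_imp_sums[OF this]] show ?thesis unfolding row by simp
  qed
  also have "\<dots> = (\<Sum>\<^sub>\<infinity>k. \<Sum>\<^sub>\<infinity>n. F (n, k))"
    using infsum_swap_banach[of "\<lambda>n k. F (n, k)" UNIV UNIV] F by simp
  also have "\<dots> = 1 / qpoch_inf Q Q * (\<Sum>\<^sub>\<infinity>k. ?g (int k) + ?g (- int k - 1))"
    unfolding col pair by (rule infsum_cmult_right')
  also have "\<dots> = 1 / qpoch_inf Q Q * (\<Sum>\<^sub>\<infinity>n. ?g n)" unfolding infsum_int_nat(2)[OF gs] ..
  finally show ?thesis using qpoch_inf_nz'[OF lt1] by simp
qed

end

section \<open>The rank generating function\<close>

lemma has_sum_prod:
  fixes f :: "'a \<Rightarrow> complex" and g :: "'b \<Rightarrow> complex"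
  assumes "(f has_sum a) A" "(g has_sum b) B"
  shows "((\<lambda>(x, y). f x * g y) has_sum (a * b)) (A \<times> B)"
proof -
  have s: "(\<lambda>(x, y). f x * g y) summable_on A \<times> B"
    using abs_summable_prod[OF has_sum_imp_summable[OF assms(1)] has_sum_imp_summable[OF assms(2)]]
    by (rule abs_summable_summable)
  hence "infsum (\<lambda>(x, y). f x * g y) (A \<times> B) = infsum f A * infsum g B"
    using infsum_Sigma_banach[OF s] by (simp add: infsum_cmult_right' infsum_cmult_left')
  thus ?thesis using s assms by (metis has_sum_infsum infsumI)
qed

definition all_op :: "(nat multiset \<times> nat set) set" where
  "all_op = {(A, S). 0 \<notin># A \<and> S \<subseteq> set_mset A}"

definition op_le :: "nat \<Rightarrow> (nat multiset \<times> nat set) set" where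
  "op_le L = {(A, S). 0 \<notin># A \<and> S \<subseteq> set_mset A \<and> set_mset A \<subseteq> {..L}}"

text \<open>The largest part is \<open>Suc L\<close>, so the empty overpartition, whose rank is a
  convention, lies in no class and is treated apart.\<close>

definition op_max :: "nat \<Rightarrow> (nat multiset \<times> nat set) set" where
  "op_max L = {(A, S). 0 \<notin># A \<and> S \<subseteq> set_mset A \<and> set_mset A \<subseteq> {..Suc L} \<and> Suc L \<in># A}"

lemma op_le_0: "op_le 0 = {({#}, {})}"
proof -
  have "A = {#}" if "0 \<notin># A" "set_mset A \<subseteq> {..0}" for A :: "nat multiset"
    using that by (metis atMost_0 set_mset_eq_empty_iff singletonD subset_singletonD insertI1)
  thus ?thesis by (auto simp: op_le_def)
qed

lemma op_le_Suc: "op_le (Suc L) = op_le L \<union> op_max L" "op_le L \<inter> op_max L = {}"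
  by (auto simp: op_le_def op_max_def atMost_Suc)

lemma op_max_rank: "(A, S) \<in> op_max L \<Longrightarrow> overpartition_rank (A, S) = int (Suc L) - int (size A)"
proof -
  assume *: "(A, S) \<in> op_max L"
  hence "Max (set_mset A) = Suc L" by (intro Max_eqI) (auto simp: op_max_def)
  thus ?thesis using * by (auto simp: op_max_def)
qed

text \<open>Splitting off the copies of the largest part \<open>L + 1\<close>; the Boolean records
  whether its first occurrence is overlined.\<close>

lemma op_max_bij:
  "bij_betw (\<lambda>((A, S), (j, b)). (A + replicate_mset (Suc j) (Suc L), if b then insert (Suc L) S else S))
     (op_le L \<times> UNIV) (op_max L)"
proof -
  let ?f = "\<lambda>((A, S), (j, b)). (A + replicate_mset (Suc j) (Suc L), if b then insert (Suc L) S else S)"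
  let ?g = "\<lambda>(A, S). ((filter_mset (\<lambda>x. x \<le> L) A, S - {Suc L}), (count A (Suc L) - 1, Suc L \<in> S))"
  have 1: "\<forall>p\<in>op_le L \<times> UNIV. ?g (?f p) = p"
  proof
    fix p assume "p \<in> op_le L \<times> (UNIV :: (nat \<times> bool) set)"
    then obtain A S j b where p: "p = ((A, S), (j, b))" and "(A, S) \<in> op_le L" by auto
    hence *: "set_mset A \<subseteq> {..L}" "S \<subseteq> {..L}" by (auto simp: op_le_def)
    have "filter_mset (\<lambda>x. x \<le> L) A = A" using *(1) by (auto simp: filter_mset_eq_conv)
    moreover have "filter_mset (\<lambda>x. x \<le> L) (replicate_mset j (Suc L)) = {#}" for j
      by (induction j) auto
    moreover have "count A (Suc L) = 0" using *(1) by (auto simp: count_eq_zero_iff)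
    moreover have "Suc L \<notin> S" using *(2) by auto
    ultimately show "?g (?f p) = p"
      unfolding p by (cases b) auto
  qed
  have 2: "\<forall>p\<in>op_max L. ?f (?g p) = p"
  proof
    fix p assume "p \<in> op_max L"
    then obtain A S where p: "p = (A, S)" and "(A, S) \<in> op_max L" by (cases p) auto
    hence *: "set_mset A \<subseteq> {..Suc L}" "Suc L \<in># A" by (auto simp: op_max_def)
    have "filter_mset (\<lambda>x. x \<le> L) A + replicate_mset (count A (Suc L)) (Suc L) = A"
    proof (rule multiset_eqI)
      fix x
      have "x \<in># A \<Longrightarrow> x \<le> L \<or> x = Suc L" using *(1) by (auto simp: atMost_Suc)
      moreover have "x \<notin># A \<Longrightarrow> count A x = 0" by (simp add: not_in_iff)
      ultimately show "count (filter_mset (\<lambda>x. x \<le> L) A + replicate_mset (count A (Suc L)) (Suc L)) x = count A x"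
        by (cases "x \<in># A") auto
    qed
    moreover have "Suc (count A (Suc L) - 1) = count A (Suc L)" using *(2) by simp
    ultimately show "?f (?g p) = p"
      unfolding p by (auto simp del: replicate_mset_Suc)
  qed
  have 3: "?f ` (op_le L \<times> UNIV) \<subseteq> op_max L"
    by (fastforce simp: op_le_def op_max_def)
  have 4: "?g ` op_max L \<subseteq> op_le L \<times> UNIV"
    by (fastforce simp: op_le_def op_max_def atMost_Suc)
  show ?thesis by (rule bij_betw_byWitness[OF 1 2 3 4])
qed

section \<open>Weights of overpartitions with bounded parts\<close>

context qdisc
begin

lemma q_ne: "norm w \<le> 1 \<Longrightarrow> q ^ Suc n * w \<noteq> 1"
proof
  assume w: "norm w \<le> 1" "q ^ Suc n * w = 1"
  have "norm (q ^ Suc n * w) \<le> norm q * 1"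
    using w(1) norm_q_pow[of n] unfolding power_Suc norm_mult mult.assoc
    by (intro mult_left_mono mult_le_one) auto
  thus False using w q1 by simp
qed

text \<open>Here \<open>w\<close> marks the number of parts. Put \<open>x = q ^ Suc L * w\<close>:
  the copies of the new part, the first possibly overlined, contribute
  \<open>2 * x / (1 - x)\<close>, so admitting them multiplies the weight by
  \<open>1 + 2 * x / (1 - x) = (1 + x) / (1 - x)\<close>.\<close>

lemma op_sums:
  assumes w: "norm w \<le> 1"
  shows "((\<lambda>(A, S). w ^ size A * q ^ sum_mset A) has_sum (qpoch (- q * w) q L / qpoch (q * w) q L)) (op_le L)"
    and "((\<lambda>(A, S). w ^ size A * q ^ sum_mset A) has_sum
       (qpoch (- q * w) q L / qpoch (q * w) q L * (2 * (q ^ Suc L * w) / (1 - q ^ Suc L * w)))) (op_max L)"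
proof -
  let ?W = "\<lambda>(A, S :: nat set). w ^ size A * q ^ sum_mset A"
  have max: "(?W has_sum (P * (2 * (q ^ Suc L * w) / (1 - q ^ Suc L * w)))) (op_max L)"
    if "(?W has_sum P) (op_le L)" for L P
  proof -
    define x where "x = q ^ Suc L * w"
    have x1: "norm x < 1"
    proof -
      have "norm x \<le> norm q * 1"
        using w norm_q_pow[of L] unfolding x_def power_Suc norm_mult mult.assoc
        by (intro mult_left_mono mult_le_one) auto
      thus ?thesis using q1 by simp
    qed
    have "((\<lambda>j. x * x ^ j) has_sum (x * (1 / (1 - x)))) UNIV"
      using x1 by (intro has_sum_cmult_right norm_summable_imp_has_sum)
        (auto simp: norm_power intro!: summable_geometric geometric_sums)
    moreover have "((\<lambda>_. 1 :: complex) has_sum 2) (UNIV :: bool set)"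
      by (rule has_sum_finiteI) (auto simp: UNIV_bool)
    ultimately have "((\<lambda>(j, b :: bool). (x * x ^ j) * 1) has_sum (x * (1 / (1 - x)) * 2)) (UNIV \<times> UNIV)"
      by (rule has_sum_prod)
    from has_sum_prod[OF that this]
    have sum1: "((\<lambda>((A, S), (j, b :: bool)). w ^ size A * q ^ sum_mset A * (x * x ^ j)) has_sum
        (P * (2 * x / (1 - x)))) (op_le L \<times> UNIV)"
      by (simp add: case_prod_unfold mult_ac)
    have "(\<lambda>((A, S), (j, b :: bool)). w ^ size A * q ^ sum_mset A * (x * x ^ j)) =
        (\<lambda>p. ?W ((\<lambda>((A, S), (j, b)). (A + replicate_mset (Suc j) (Suc L), if b then insert (Suc L) S else S)) p))"
    proof
      fix p :: "(nat multiset \<times> nat set) \<times> (nat \<times> bool)"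
      obtain A S j b where p: "p = ((A, S), (j, b))" by (metis surj_pair)
      have "x * x ^ j = (q ^ Suc L * w) ^ Suc j" by (simp add: x_def)
      also have "\<dots> = w ^ Suc j * q ^ (Suc j * Suc L)"
        unfolding power_mult_distrib power_mult[symmetric] by (simp only: mult.commute)
      finally have xj: "x * x ^ j = w ^ Suc j * q ^ (Suc j * Suc L)" .
      have m: "size (A + replicate_mset (Suc j) (Suc L)) = size A + Suc j"
        "sum_mset (A + replicate_mset (Suc j) (Suc L)) = sum_mset A + Suc j * Suc L"
        by (simp_all only: size_union size_replicate_mset sum_mset.union sum_mset_replicate_mset of_nat_id)
      show "(\<lambda>((A, S), (j, b :: bool)). w ^ size A * q ^ sum_mset A * (x * x ^ j)) p =
          ?W ((\<lambda>((A, S), (j, b)). (A + replicate_mset (Suc j) (Suc L), if b then insert (Suc L) S else S)) p)"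
      proof -
        have "w ^ size A * q ^ sum_mset A * (x * x ^ j) = w ^ (size A + Suc j) * q ^ (sum_mset A + Suc j * Suc L)"
          unfolding xj power_add by (simp only: mult.assoc mult.left_commute[of "q ^ sum_mset A"])
        thus ?thesis unfolding p prod.case m .
      qed
    qed
    from sum1[unfolded this] show ?thesis unfolding x_def[symmetric]
      by (rule has_sum_reindex_bij_betw[OF op_max_bij[of L], of ?W, THEN iffD1])
  qed
  have le: "(?W has_sum (qpoch (- q * w) q L / qpoch (q * w) q L)) (op_le L)" for L
  proof (induction L)
    case 0
    show ?case by (simp add: op_le_0) (rule has_sum_finiteI, auto)
  next
    case (Suc L)
    have nz: "1 - q ^ Suc L * w \<noteq> 0" using q_ne[OF w, of L] by simp
    let ?P = "qpoch (- q * w) q L / qpoch (q * w) q L" and ?x = "q ^ Suc L * w"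
    have "(?W has_sum (?P + ?P * (2 * ?x / (1 - ?x)))) (op_le L \<union> op_max L)"
      by (intro has_sum_Un_disjoint max Suc op_le_Suc(2))
    moreover have "?P + ?P * (2 * ?x / (1 - ?x)) = ?P * ((1 + ?x) / (1 - ?x))"
    proof -
      have "p + p * (2 * x / (1 - x)) = p * ((1 + x) / (1 - x))" if "1 - x \<noteq> 0" for p x :: complex
        using that by (simp add: field_simps)
      from this[OF nz] show ?thesis .
    qed
    moreover have "?P * ((1 + ?x) / (1 - ?x)) = qpoch (- q * w) q (Suc L) / qpoch (q * w) q (Suc L)"
      by (simp add: qpoch_Suc mult_ac)
    ultimately show ?case unfolding op_le_Suc(1) by simp
  qed
  show "(?W has_sum (qpoch (- q * w) q L / qpoch (q * w) q L)) (op_le L)" by (rule le)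
  show "(?W has_sum (qpoch (- q * w) q L / qpoch (q * w) q L * (2 * (q ^ Suc L * w) / (1 - q ^ Suc L * w)))) (op_max L)"
    by (rule max[OF le])
qed

end

text \<open>A finite set of overpartitions lies in some \<open>op_le L\<close>, whose weight is a
  finite product. These products converge, hence are bounded in \<open>L\<close>.\<close>

lemma op_abs_summable:
  assumes "0 \<le> r" "r < (1 :: real)"
  shows "(\<lambda>p. r ^ sum_mset (fst p)) summable_on all_op"
proof -
  interpret qdisc "complex_of_real r" by unfold_locales (use assms in auto)
  let ?P = "\<lambda>L. qpoch (- complex_of_real r) (of_real r) L / qpoch (of_real r) (of_real r) L"
  have "complex_of_real r * of_real r ^ i \<noteq> 1" for i
    using q_ne[of 1 i] by simp
  hence "qpoch_inf (of_real r) (of_real r) \<noteq> 0" by (intro qpoch_inf_nz) auto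
  hence "?P \<longlonglongrightarrow> qpoch_inf (- complex_of_real r) (of_real r) / qpoch_inf (of_real r) (of_real r)"
    by (intro tendsto_intros qpoch_tendsto)
  then obtain C where C: "\<And>L. norm (?P L) \<le> C" by (rule convergent_bounded) blast
  show ?thesis
  proof (rule nonneg_bdd_above_summable_on)
    show "bdd_above (sum (\<lambda>p. r ^ sum_mset (fst p)) ` {F. F \<subseteq> all_op \<and> finite F})"
    proof (rule bdd_aboveI2[where M = C], safe)
      fix F assume F: "F \<subseteq> all_op" "finite F"
      define L where "L = Max (insert 0 (\<Union>p\<in>F. set_mset (fst p)))"
      have "x \<le> L" if "p \<in> F" "x \<in># fst p" for p x
        unfolding L_def using that F by (intro Max_ge) auto
      hence sub: "F \<subseteq> op_le L" using F(1) by (fastforce simp: all_op_def op_le_def)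
      have "((\<lambda>p. complex_of_real (r ^ sum_mset (fst p))) has_sum ?P L) (op_le L)"
        using op_sums(1)[of 1 L] by (simp add: case_prod_unfold)
      hence s: "((\<lambda>p. r ^ sum_mset (fst p)) has_sum Re (?P L)) (op_le L)"
        using has_sum_Re by (metis (no_types, lifting) Re_complex_of_real has_sum_cong)
      have "(\<Sum>p\<in>F. r ^ sum_mset (fst p)) \<le> Re (?P L)"
        using F sub assms by (intro finite_sum_le_has_sum[OF s]) auto
      also have "\<dots> \<le> C" using C[of L] complex_Re_le_cmod order_trans by blast
      finally show "(\<Sum>p\<in>F. r ^ sum_mset (fst p)) \<le> C" .
    qed
  qed (use assms in auto)
qed

lemma overpartitions_subset: "overpartitions n \<subseteq> all_op" "p \<in> overpartitions n \<Longrightarrow> sum_mset (fst p) = n"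
  by (auto simp: overpartitions_def all_op_def)

text \<open>Finiteness is read off from convergence: on overpartitions of \<open>n\<close> the
  weight is the constant \<open>(1/2) ^ n\<close>, which is not summable over an infinite
  set.\<close>

lemma finite_overpartitions: "finite (overpartitions n)"
proof (rule ccontr)
  assume inf: "infinite (overpartitions n)"
  have "(\<lambda>p. (1/2 :: real) ^ sum_mset (fst p)) summable_on overpartitions n"
    by (rule summable_on_subset_banach[OF op_abs_summable overpartitions_subset(1)]) auto
  hence "(\<lambda>p :: nat multiset \<times> nat set. (1/2 :: real) ^ n) summable_on overpartitions n"
    by (rule summable_on_cong[THEN iffD1, rotated]) (simp add: overpartitions_subset(2))
  moreover have "\<not> (\<lambda>p :: nat multiset \<times> nat set. (1/2 :: real) ^ n) summable_on overpartitions n"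
    by (rule infsum_diverge_constant[OF inf]) auto
  ultimately show False by blast
qed

section \<open>The rank generating function by size and by largest part\<close>

definition rank_sum :: "complex \<Rightarrow> nat \<Rightarrow> complex" where
  "rank_sum z n = (\<Sum>p\<in>overpartitions n. z powi overpartition_rank p)"

definition rank_gf :: "complex \<Rightarrow> complex \<Rightarrow> complex" where
  "rank_gf z q = (\<Sum>\<^sub>\<infinity>p\<in>all_op. z powi overpartition_rank p * q ^ sum_mset (fst p))"

context qdisc
begin

lemma rank_gf_summable:
  assumes "norm z = 1"
  shows "(\<lambda>p. z powi overpartition_rank p * q ^ sum_mset (fst p)) summable_on all_op"
proof (rule abs_summable_summable)
  have "(\<lambda>p. norm q ^ sum_mset (fst p)) summable_on all_op" using q1 by (intro op_abs_summable) auto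
  thus "(\<lambda>p. norm (z powi overpartition_rank p * q ^ sum_mset (fst p))) summable_on all_op"
    by (simp add: norm_mult norm_power_int norm_power assms)
qed

lemma rank_gf_coeff:
  assumes "norm z = 1"
  shows "(\<lambda>n. rank_sum z n * q ^ n) summable_on UNIV"
    and "rank_gf z q = (\<Sum>\<^sub>\<infinity>n. rank_sum z n * q ^ n)"
proof -
  let ?f = "\<lambda>p. z powi overpartition_rank p * q ^ sum_mset (fst p)"
  have bij: "bij_betw snd (Sigma UNIV overpartitions) all_op"
  proof (rule bij_betw_byWitness[where f' = "\<lambda>p. (sum_mset (fst p), p)"])
    show "snd ` Sigma UNIV overpartitions \<subseteq> all_op" using overpartitions_subset(1) by fastforce
  qed (auto simp: overpartitions_def all_op_def)
  have s: "(\<lambda>(n, p). ?f p) summable_on Sigma UNIV overpartitions"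
    using rank_gf_summable[OF assms] summable_on_reindex_bij_betw[OF bij, of ?f] by (simp add: case_prod_unfold)
  have row: "(\<Sum>\<^sub>\<infinity>p\<in>overpartitions n. ?f p) = rank_sum z n * q ^ n" for n
    using finite_overpartitions[of n] by (simp add: rank_sum_def sum_distrib_right overpartitions_subset(2))
  show "(\<lambda>n. rank_sum z n * q ^ n) summable_on UNIV"
    using summable_on_Sigma_banach[OF s] unfolding row .
  show "rank_gf z q = (\<Sum>\<^sub>\<infinity>n. rank_sum z n * q ^ n)"
    using infsum_Sigma_banach[OF s] infsum_reindex_bij_betw[OF bij, of ?f]
    unfolding rank_gf_def by (simp add: case_prod_unfold row)
qed

text \<open>The term 1 is the empty overpartition. In the class of largest part \<open>Suc L\<close>
  the rank contributes \<open>z ^ Suc L\<close> once and a factor \<open>1 / z\<close> for each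
  part, so \<open>op_sums\<close> applies with \<open>w = 1 / z\<close>.\<close>

lemma rank_gf_largest_part:
  assumes z: "norm z = 1"
  shows "rank_gf z q = 1 + (\<Sum>\<^sub>\<infinity>L. z ^ Suc L * (qpoch (- q / z) q L / qpoch (q / z) q L * (2 * (q ^ Suc L / z) / (1 - q ^ Suc L / z))))"
proof -
  let ?f = "\<lambda>p. z powi overpartition_rank p * q ^ sum_mset (fst p)"
  have z0: "z \<noteq> 0" using z by auto
  have eq: "all_op = {({#}, {})} \<union> (\<Union>L. op_max L)"
  proof (rule set_eqI, clarify)
    fix A S
    show "(A, S) \<in> all_op \<longleftrightarrow> (A, S) \<in> {({#}, {})} \<union> (\<Union>L. op_max L)"
    proof (cases "A = {#}")
      case False
      hence m: "Max (set_mset A) \<in># A" by simp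
      show ?thesis
      proof
        assume *: "(A, S) \<in> all_op"
        hence "0 \<notin># A" by (simp add: all_op_def)
        hence "Max (set_mset A) \<noteq> 0" using m by metis
        then obtain L where L: "Max (set_mset A) = Suc L" using not0_implies_Suc by blast
        have "x \<le> Suc L" if "x \<in># A" for x using Max_ge[of "set_mset A" x] that L by simp
        hence "(A, S) \<in> op_max L" using * m L by (auto simp: op_max_def all_op_def)
        thus "(A, S) \<in> {({#}, {})} \<union> (\<Union>L. op_max L)" by blast
      qed (auto simp: all_op_def op_max_def False)
    qed (auto simp: all_op_def op_max_def)
  qed
  have sub: "?f summable_on X" if "X \<subseteq> all_op" for X
    by (rule summable_on_subset_banach[OF rank_gf_summable[OF z] that])
  have "rank_gf z q = infsum ?f {({#}, {})} + infsum ?f (\<Union>L. op_max L)"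
    unfolding rank_gf_def by (subst eq, rule infsum_Un_disjoint; (rule sub)?) (auto simp: eq op_max_def)
  also have "infsum ?f {({#}, {})} = 1" by simp
  also have "infsum ?f (\<Union>L. op_max L) = (\<Sum>\<^sub>\<infinity>L. infsum ?f (op_max L))"
  proof -
    have inj: "L = L'" if "p \<in> op_max L" "p \<in> op_max L'" for p L L'
      using that by (cases p) (auto simp: op_max_def intro!: antisym)
    hence bij: "bij_betw snd (Sigma UNIV op_max) (\<Union>L. op_max L)"
      by (auto simp: bij_betw_def inj_on_def image_iff)
    have "?f summable_on (\<Union>L. op_max L)" by (rule sub) (auto simp: eq)
    hence s: "(\<lambda>(n, p). ?f p) summable_on Sigma UNIV op_max"
      using summable_on_reindex_bij_betw[OF bij, of ?f] by (simp add: case_prod_unfold)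
    show ?thesis using infsum_Sigma_banach[OF s] infsum_reindex_bij_betw[OF bij, of ?f]
      by (simp add: case_prod_unfold)
  qed
  also have "(\<Sum>\<^sub>\<infinity>L. infsum ?f (op_max L)) = (\<Sum>\<^sub>\<infinity>L. z ^ Suc L * (qpoch (- q / z) q L / qpoch (q / z) q L * (2 * (q ^ Suc L / z) / (1 - q ^ Suc L / z))))"
  proof (rule infsum_cong)
    fix L
    have "infsum ?f (op_max L) = (\<Sum>\<^sub>\<infinity>p\<in>op_max L. z ^ Suc L * (case p of (A, S) \<Rightarrow> (1 / z) ^ size A * q ^ sum_mset A))"
    proof (rule infsum_cong, clarify)
      fix A S assume "(A, S) \<in> op_max L"
      hence "z powi overpartition_rank (A, S) = z ^ Suc L * (1 / z) ^ size A"
        unfolding op_max_rank using z0 by (simp add: power_int_diff power_one_over op_max_rank del: power_Suc overpartition_rank.simps)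
           (metis power_int_of_nat of_nat_Suc divide_inverse)
      thus "z powi overpartition_rank (A, S) * q ^ sum_mset (fst (A, S)) =
          z ^ Suc L * ((1 / z) ^ size A * q ^ sum_mset A)" by simp
    qed
    also have "\<dots> = z ^ Suc L * (qpoch (- q * (1 / z)) q L / qpoch (q * (1 / z)) q L * (2 * (q ^ Suc L * (1 / z)) / (1 - q ^ Suc L * (1 / z))))"
      unfolding infsum_cmult_right' using z by (subst infsumI[OF op_sums(2)]) (auto simp: norm_divide)
    finally show "infsum ?f (op_max L) = z ^ Suc L * (qpoch (- q / z) q L / qpoch (q / z) q L * (2 * (q ^ Suc L / z) / (1 - q ^ Suc L / z)))"
      by simp
  qed
  finally show ?thesis .
qed

end

lemma infsum_int_sym:
  fixes f :: "int \<Rightarrow> complex"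
  assumes "f summable_on UNIV"
  shows "(\<lambda>k. f (int (Suc k)) + f (- int (Suc k))) summable_on UNIV"
    and "(\<Sum>\<^sub>\<infinity>n. f n) = f 0 + (\<Sum>\<^sub>\<infinity>k. f (int (Suc k)) + f (- int (Suc k)))"
proof -
  have sub: "f summable_on A" for A by (rule summable_on_subset_banach[OF assms]) auto
  have inj: "inj_on (\<lambda>k. int (Suc k)) UNIV" "inj_on (\<lambda>k. - int (Suc k)) UNIV" by (auto simp: inj_on_def)
  have s: "(\<lambda>k. f (int (Suc k))) summable_on UNIV" "(\<lambda>k. f (- int (Suc k))) summable_on UNIV"
    using sub[of "range (\<lambda>k. int (Suc k))"] sub[of "range (\<lambda>k. - int (Suc k))"]
    unfolding summable_on_reindex[OF inj(1)] summable_on_reindex[OF inj(2)] by (simp_all add: o_def)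
  thus "(\<lambda>k. f (int (Suc k)) + f (- int (Suc k))) summable_on UNIV" by (rule summable_on_add)
  have "x \<in> {0} \<union> (range (\<lambda>k. int (Suc k)) \<union> range (\<lambda>k. - int (Suc k)))" for x
  proof (cases x rule: int_cases3)
    case (pos n)
    thus ?thesis by (auto simp: image_iff gr0_conv_Suc)
  next
    case (neg n)
    thus ?thesis by (auto simp: image_iff gr0_conv_Suc)
  qed auto
  hence U: "(UNIV :: int set) = {0} \<union> (range (\<lambda>k. int (Suc k)) \<union> range (\<lambda>k. - int (Suc k)))" by blast
  have "(\<Sum>\<^sub>\<infinity>n. f n) = infsum f {0} + infsum f (range (\<lambda>k. int (Suc k)) \<union> range (\<lambda>k. - int (Suc k)))"
    by (subst U, rule infsum_Un_disjoint; (rule sub)?) auto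
  also have "infsum f (range (\<lambda>k. int (Suc k)) \<union> range (\<lambda>k. - int (Suc k))) =
      infsum f (range (\<lambda>k. int (Suc k))) + infsum f (range (\<lambda>k. - int (Suc k)))"
    by (rule infsum_Un_disjoint; (rule sub)?) auto
  also have "\<dots> = (\<Sum>\<^sub>\<infinity>k. f (int (Suc k))) + (\<Sum>\<^sub>\<infinity>k. f (- int (Suc k)))"
    using infsum_reindex[OF inj(1), of f] infsum_reindex[OF inj(2), of f] by (simp add: o_def)
  also have "\<dots> = (\<Sum>\<^sub>\<infinity>k. f (int (Suc k)) + f (- int (Suc k)))"
    by (rule infsum_add[symmetric]) (fact s)+
  finally show "(\<Sum>\<^sub>\<infinity>n. f n) = f 0 + (\<Sum>\<^sub>\<infinity>k. f (int (Suc k)) + f (- int (Suc k)))" by simp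
qed

section \<open>From the largest part to a Lambert series\<close>

context nome
begin

text \<open>The coefficients \<open>ec\<close> of \<open>qpoch_inf (- y) Q / qpoch_inf y Q\<close> and, together with \<open>dc\<close>,
  the residues of \<open>qpoch (- Q * w) Q n / qpoch (Q * w) Q (Suc n)\<close>.\<close>

definition ec :: "nat \<Rightarrow> complex" where "ec j = qpoch (-1) Q j / qpoch Q Q j"
definition dc :: "nat \<Rightarrow> complex" where "dc i = (-1) ^ i * qpoch (-Q) Q i / qpoch Q Q i"

lemma one_minus_Q_nz [simp]: "1 - Q * Q ^ n \<noteq> 0"
  using qQ_nz[of "Suc n"] unfolding qpoch_Suc by auto

lemma one_plus_Q_nz [simp]: "1 + Q * Q ^ n \<noteq> 0"
proof
  assume "1 + Q * Q ^ n = 0"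
  hence "(1 - Q * Q ^ n) * (1 + Q * Q ^ n) = 0" by simp
  hence "1 - Q * Q ^ (2 * n + 1) = 0" by (simp add: algebra_simps mult_2_right power_add)
  thus False using one_minus_Q_nz[of "2 * n + 1"] by blast
qed

lemma ec_0 [simp]: "ec 0 = 1" and dc_0 [simp]: "dc 0 = 1" by (simp_all add: ec_def dc_def)

lemma ec_rec: "ec (Suc j) * (1 - Q ^ Suc j) = ec j * (1 + Q ^ j)"
  using one_minus_Q_nz[of j] by (simp add: ec_def qpoch_Suc)

lemma dc_rec: "dc (Suc i) * (1 - Q ^ Suc i) = - (dc i * (1 + Q ^ Suc i))"
  using one_minus_Q_nz[of i] by (simp add: dc_def qpoch_Suc)

lemma ec_dc_bounded: "\<exists>M\<ge>1. (\<forall>i j. norm (dc i * ec j) \<le> M) \<and> (\<forall>j. norm (ec j) \<le> M)"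
proof -
  have nz: "qpoch_inf Q Q \<noteq> 0" by (rule qpoch_inf_nz'[OF lt1])
  have "ec \<longlonglongrightarrow> qpoch_inf (-1) Q / qpoch_inf Q Q"
    unfolding ec_def[abs_def] by (intro tendsto_intros qpoch_tendsto nz)
  then obtain C where C: "C > 0" "\<And>j. norm (ec j) \<le> C" by (rule convergent_bounded) blast
  have "(\<lambda>i. qpoch (-Q) Q i / qpoch Q Q i) \<longlonglongrightarrow> qpoch_inf (-Q) Q / qpoch_inf Q Q"
    by (intro tendsto_intros qpoch_tendsto nz)
  then obtain D where D: "D > 0" "\<And>i. norm (qpoch (-Q) Q i / qpoch Q Q i) \<le> D" by (rule convergent_bounded) blast
  have D': "norm (dc i) \<le> D" for i using D(2)[of i] by (simp add: dc_def norm_mult norm_power norm_divide)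
  have "norm (dc i * ec j) \<le> D * C" for i j
    unfolding norm_mult using C D(1) D' by (intro mult_mono) auto
  thus ?thesis using C by (intro exI[of _ "max 1 (max (D * C) C)"]) (auto simp: le_max_iff_disj)
qed

text \<open>The factor \<open>1 - Q ^ (Suc n - i)\<close> kills the term \<open>i = Suc n\<close>
  and lowers the index of \<open>ec\<close> by its recurrence.\<close>

lemma conv_step:
  "(\<Sum>i\<le>Suc n. dc i * ec (Suc n - i) * (1 - Q ^ (Suc n - i)) * f i) = (\<Sum>i\<le>n. dc i * ec (n - i) * (1 + Q ^ (n - i)) * f i)"
proof -
  have "(\<Sum>i\<le>Suc n. dc i * ec (Suc n - i) * (1 - Q ^ (Suc n - i)) * f i) =
      (\<Sum>i\<le>n. dc i * ec (Suc n - i) * (1 - Q ^ (Suc n - i)) * f i)" by simp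
  also have "\<dots> = (\<Sum>i\<le>n. dc i * ec (n - i) * (1 + Q ^ (n - i)) * f i)"
  proof (rule sum.cong[OF refl])
    fix i assume "i \<in> {..n}"
    hence "Suc n - i = Suc (n - i)" by auto
    thus "dc i * ec (Suc n - i) * (1 - Q ^ (Suc n - i)) * f i = dc i * ec (n - i) * (1 + Q ^ (n - i)) * f i"
      using ec_rec[of "n - i"] by (simp add: mult.assoc mult.left_commute)
  qed
  finally show ?thesis .
qed

text \<open>By the q-binomial theorem \<open>ec\<close> and \<open>dc\<close> are the coefficients
  of \<open>qpoch_inf (- y) Q / qpoch_inf y Q\<close> and
  \<open>qpoch_inf (Q * y) Q / qpoch_inf (- y) Q\<close>, whose product is
  \<open>1 / (1 - y)\<close>. The induction is the coefficient form, using \<open>1 - Q ^ Suc n = (1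
  - Q ^ (Suc n - i)) + (1 - Q ^ i) * Q ^ (Suc n - i)\<close>.\<close>

lemma conv_one: "(\<Sum>i\<le>n. dc i * ec (n - i)) = 1"
proof (induction n)
  case (Suc n)
  have "(1 - Q ^ Suc n) * (\<Sum>i\<le>Suc n. dc i * ec (Suc n - i)) =
     (\<Sum>i\<le>Suc n. dc i * ec (Suc n - i) * (1 - Q ^ (Suc n - i)) * 1 + dc i * (1 - Q ^ i) * ec (Suc n - i) * Q ^ (Suc n - i))"
    unfolding sum_distrib_left
  proof (rule sum.cong[OF refl])
    fix i assume "i \<in> {..Suc n}"
    hence "Q ^ Suc n = Q ^ (Suc n - i) * Q ^ i" by (simp only: flip: power_add) simp
    thus "(1 - Q ^ Suc n) * (dc i * ec (Suc n - i)) =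
        dc i * ec (Suc n - i) * (1 - Q ^ (Suc n - i)) * 1 + dc i * (1 - Q ^ i) * ec (Suc n - i) * Q ^ (Suc n - i)"
      by (simp add: algebra_simps)
  qed
  also have "\<dots> = (\<Sum>i\<le>n. dc i * ec (n - i) * (1 + Q ^ (n - i)) * 1) +
      (\<Sum>i\<le>Suc n. dc i * (1 - Q ^ i) * ec (Suc n - i) * Q ^ (Suc n - i))"
    unfolding sum.distrib conv_step ..
  also have "(\<Sum>i\<le>Suc n. dc i * (1 - Q ^ i) * ec (Suc n - i) * Q ^ (Suc n - i)) =
      (\<Sum>i\<le>n. - (dc i * (1 + Q ^ Suc i)) * ec (n - i) * Q ^ (n - i))"
    unfolding sum.atMost_Suc_shift dc_rec by simp
  also have "(\<Sum>i\<le>n. dc i * ec (n - i) * (1 + Q ^ (n - i)) * 1) + \<dots> = (\<Sum>i\<le>n. (1 - Q ^ Suc n) * (dc i * ec (n - i)))"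
    unfolding sum.distrib[symmetric]
  proof (rule sum.cong[OF refl])
    fix i assume "i \<in> {..n}"
    hence "Q ^ Suc n = Q ^ (n - i) * Q ^ Suc i" by (simp only: flip: power_add) simp
    thus "dc i * ec (n - i) * (1 + Q ^ (n - i)) * 1 + - (dc i * (1 + Q ^ Suc i)) * ec (n - i) * Q ^ (n - i) =
        (1 - Q ^ Suc n) * (dc i * ec (n - i))"
      by (simp only:) (simp add: algebra_simps)
  qed
  also have "\<dots> = 1 - Q ^ Suc n" unfolding sum_distrib_left[symmetric] Suc by simp
  finally show ?case using one_minus_Q_nz[of n] by simp
qed auto

lemma conv_alternating:
  "(\<Sum>i\<le>Suc n. dc i * ec (Suc n - i) * Q ^ (Suc n - i)) = - (\<Sum>i\<le>n. dc i * ec (n - i) * Q ^ (n - i))"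
proof -
  have "- (\<Sum>i\<le>Suc n. dc i * ec (Suc n - i) * Q ^ (Suc n - i)) = (\<Sum>i\<le>n. dc i * ec (n - i) * Q ^ (n - i))"
    using conv_step[of n "\<lambda>_. 1"] conv_one[of n] conv_one[of "Suc n"]
    by (simp add: ring_distribs sum.distrib sum_subtractf del: sum.atMost_Suc power_Suc)
  thus ?thesis by (metis minus_minus)
qed

text \<open>In the induction the new denominator is distributed over the poles. The parts free of
  \<open>w\<close> form the sum of \<open>conv_alternating\<close>, whose change of sign makes them
  combine with the polar parts into the new numerator factor
  \<open>1 + Q ^ Suc n * w\<close>.\<close>

lemma overpartition_partial_fractions:
  assumes w: "norm w \<le> 1"
  shows "qpoch (- Q * w) Q n / qpoch (Q * w) Q (Suc n) = (\<Sum>i\<le>n. dc i * ec (n - i) / (1 - Q ^ Suc i * w))"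
proof (induction n)
  case 0
  show ?case by (simp add: qpoch_Suc)
next
  case (Suc n)
  have nz: "1 - Q ^ Suc i * w \<noteq> 0" for i using q_ne[OF w, of i] by simp
  have "(1 - Q ^ Suc (Suc n) * w) * (\<Sum>i\<le>Suc n. dc i * ec (Suc n - i) / (1 - Q ^ Suc i * w)) =
     (\<Sum>i\<le>Suc n. dc i * ec (Suc n - i) * (1 - Q ^ (Suc n - i)) * (1 / (1 - Q ^ Suc i * w)) + dc i * ec (Suc n - i) * Q ^ (Suc n - i))"
    unfolding sum_distrib_left
  proof (rule sum.cong[OF refl])
    fix i assume "i \<in> {..Suc n}"
    hence Q: "Q ^ Suc (Suc n) = Q ^ (Suc n - i) * Q ^ Suc i" by (simp only: flip: power_add) simp
    have "(1 - E * P * w) * (c / (1 - P * w)) = c * (1 - E) * (1 / (1 - P * w)) + c * E" if "1 - P * w \<noteq> 0" for c E P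
      using that by (simp add: divide_simps) (simp add: algebra_simps)
    from this[OF nz] show "(1 - Q ^ Suc (Suc n) * w) * (dc i * ec (Suc n - i) / (1 - Q ^ Suc i * w)) =
       dc i * ec (Suc n - i) * (1 - Q ^ (Suc n - i)) * (1 / (1 - Q ^ Suc i * w)) + dc i * ec (Suc n - i) * Q ^ (Suc n - i)"
      unfolding Q .
  qed
  also have "\<dots> = (\<Sum>i\<le>n. dc i * ec (n - i) * (1 + Q ^ (n - i)) * (1 / (1 - Q ^ Suc i * w))) - (\<Sum>i\<le>n. dc i * ec (n - i) * Q ^ (n - i))"
    unfolding sum.distrib conv_step conv_alternating by simp
  also have "\<dots> = (\<Sum>i\<le>n. (1 + Q ^ Suc n * w) * (dc i * ec (n - i) / (1 - Q ^ Suc i * w)))"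
    unfolding sum_subtractf[symmetric]
  proof (rule sum.cong[OF refl])
    fix i assume "i \<in> {..n}"
    hence Q: "Q ^ Suc n = Q ^ (n - i) * Q ^ Suc i" by (simp only: flip: power_add) simp
    have "c * (1 + E) * (1 / (1 - P * w)) - c * E = (1 + E * P * w) * (c / (1 - P * w))" if "1 - P * w \<noteq> 0" for c E P
      using that by (simp add: divide_simps) (simp add: algebra_simps)
    from this[OF nz] show "dc i * ec (n - i) * (1 + Q ^ (n - i)) * (1 / (1 - Q ^ Suc i * w)) - dc i * ec (n - i) * Q ^ (n - i) =
       (1 + Q ^ Suc n * w) * (dc i * ec (n - i) / (1 - Q ^ Suc i * w))"
      unfolding Q .
  qed
  also have "\<dots> = (1 + Q ^ Suc n * w) * (qpoch (- Q * w) Q n / qpoch (Q * w) Q (Suc n))"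
    unfolding sum_distrib_left[symmetric] Suc ..
  also have "\<dots> = qpoch (- Q * w) Q (Suc n) / qpoch (Q * w) Q (Suc n)"
  proof -
    have "qpoch (- Q * w) Q (Suc n) = (1 + Q ^ Suc n * w) * qpoch (- Q * w) Q n" by (simp add: qpoch_Suc mult_ac)
    thus ?thesis by (simp only: times_divide_eq_right)
  qed
  finally have *: "(1 - Q ^ Suc (Suc n) * w) * (\<Sum>i\<le>Suc n. dc i * ec (Suc n - i) / (1 - Q ^ Suc i * w)) =
     qpoch (- Q * w) Q (Suc n) / qpoch (Q * w) Q (Suc n)" .
  have "qpoch (- Q * w) Q (Suc n) / qpoch (Q * w) Q (Suc (Suc n)) =
     qpoch (- Q * w) Q (Suc n) / qpoch (Q * w) Q (Suc n) / (1 - Q ^ Suc (Suc n) * w)"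
    by (simp add: qpoch_Suc[of "Q * w" Q "Suc n"] mult_ac)
  also have "\<dots> = (\<Sum>i\<le>Suc n. dc i * ec (Suc n - i) / (1 - Q ^ Suc i * w))"
    by (rule eq_divide_imp[OF nz, symmetric]) (subst mult.commute, rule *)
  finally show ?case .
qed

text \<open>The coefficients of \<open>z ^ n * (1 / z) ^ r\<close> in the sum over the largest part. Their symmetry
  is proved from two recurrences that are exchanged by swapping \<open>n\<close> and \<open>r\<close>.\<close>

definition Dc :: "nat \<Rightarrow> nat \<Rightarrow> complex" where
  "Dc n r = Q ^ n * (\<Sum>i\<le>n. dc i * ec (n - i) * Q ^ (Suc i * r))"

lemma Dc_0_right: "Dc n 0 = Q ^ n" using conv_one[of n] by (simp add: Dc_def)
lemma Dc_0_left: "Dc 0 r = Q ^ r" by (simp add: Dc_def)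

lemma Dc_rec1: "Dc (Suc n) (Suc r) = Q * Dc n (Suc r) + Q ^ (n + 2) * (Dc (Suc n) r + Dc n r)"
proof -
  define C where "C n r = (\<Sum>i\<le>n. dc i * ec (n - i) * Q ^ (Suc i * r))" for n r
  have "C (Suc n) (Suc r) - Q ^ (n + 2) * C (Suc n) r =
     (\<Sum>i\<le>Suc n. dc i * ec (Suc n - i) * (1 - Q ^ (Suc n - i)) * (Q ^ (Suc i * r) * Q ^ Suc i))"
    unfolding C_def sum_distrib_left sum_subtractf[symmetric]
  proof (rule sum.cong[OF refl])
    fix i assume "i \<in> {..Suc n}"
    hence Q: "Q ^ (n + 2) = Q ^ (Suc n - i) * Q ^ Suc i" by (simp only: flip: power_add) simp
    have "Q ^ (Suc i * Suc r) = Q ^ (Suc i * r) * Q ^ Suc i" unfolding mult_Suc_right power_add by (rule mult.commute)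
    thus "dc i * ec (Suc n - i) * Q ^ (Suc i * Suc r) - Q ^ (n + 2) * (dc i * ec (Suc n - i) * Q ^ (Suc i * r)) =
        dc i * ec (Suc n - i) * (1 - Q ^ (Suc n - i)) * (Q ^ (Suc i * r) * Q ^ Suc i)"
      unfolding Q by (simp only:) (simp only: algebra_simps mult_1)
  qed
  also have "\<dots> = (\<Sum>i\<le>n. dc i * ec (n - i) * (1 + Q ^ (n - i)) * (Q ^ (Suc i * r) * Q ^ Suc i))" by (rule conv_step)
  also have "\<dots> = C n (Suc r) + Q ^ Suc n * C n r"
    unfolding C_def sum_distrib_left sum.distrib[symmetric]
  proof (rule sum.cong[OF refl])
    fix i assume "i \<in> {..n}"
    hence Q: "Q ^ Suc n = Q ^ (n - i) * Q ^ Suc i" by (simp only: flip: power_add) simp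
    have "Q ^ (Suc i * Suc r) = Q ^ (Suc i * r) * Q ^ Suc i" unfolding mult_Suc_right power_add by (rule mult.commute)
    thus "dc i * ec (n - i) * (1 + Q ^ (n - i)) * (Q ^ (Suc i * r) * Q ^ Suc i) =
        dc i * ec (n - i) * Q ^ (Suc i * Suc r) + Q ^ Suc n * (dc i * ec (n - i) * Q ^ (Suc i * r))"
      unfolding Q by (simp only:) (simp only: algebra_simps mult_1)
  qed
  finally have "C (Suc n) (Suc r) = Q ^ (n + 2) * C (Suc n) r + C n (Suc r) + Q ^ Suc n * C n r" by (simp add: algebra_simps)
  thus ?thesis unfolding Dc_def C_def[symmetric] by (simp add: algebra_simps)
qed

text \<open>Induction on \<open>n + r\<close>. In the interior, the left-hand side is expanded by
  \<open>Dc_rec1\<close> and then by the induction hypothesis, the right-hand side by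
  \<open>Dc_rec1\<close> alone; both reach the same expression because the two recurrences commute.
  The boundary cases use the explicit values \<open>Q ^ n\<close> and \<open>Q ^ r\<close>.\<close>

lemma Dc_rec2: "Dc (Suc n) (Suc r) = Q * Dc (Suc n) r + Q ^ (r + 2) * (Dc n (Suc r) + Dc n r)"
proof (induction "n + r" arbitrary: n r rule: less_induct)
  case less
  show ?case
  proof (cases n)
    case n: 0
    show ?thesis
    proof (cases r)
      case 0
      thus ?thesis using n Dc_rec1[of 0 0] by (simp add: Dc_0_right Dc_0_left algebra_simps)
    next
      case (Suc s)
      have IH: "Dc (Suc 0) (Suc s) = Q * Dc (Suc 0) s + Q ^ (s + 2) * (Dc 0 (Suc s) + Dc 0 s)"
        using less[of 0 s] n Suc by simp
      have "Dc (Suc 0) (Suc (Suc s)) = Q * Q ^ Suc (Suc s) + Q ^ 2 * (Dc (Suc 0) (Suc s) + Q ^ Suc s)"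
        using Dc_rec1[of 0 "Suc s"] by (simp add: Dc_0_left power2_eq_square)
      also have "Q ^ 2 * (Dc (Suc 0) (Suc s) + Q ^ Suc s) = Q ^ 2 * (Q * Dc (Suc 0) s + Q ^ (s + 2) * (Q ^ Suc s + Q ^ s) + Q ^ Suc s)"
        unfolding IH Dc_0_left ..
      moreover have "Dc (Suc 0) (Suc s) = Q * Q ^ Suc s + Q ^ 2 * (Dc (Suc 0) s + Q ^ s)"
        using Dc_rec1[of 0 s] by (simp add: Dc_0_left power2_eq_square)
      ultimately show ?thesis unfolding n Suc Dc_0_left
        by (simp only:) (simp add: algebra_simps power2_eq_square)
    qed
  next
    case n: (Suc m)
    show ?thesis
    proof (cases r)
      case 0
      have IH: "Dc (Suc m) (Suc 0) = Q * Dc (Suc m) 0 + Q ^ 2 * (Dc m (Suc 0) + Dc m 0)"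
        using less[of m 0] n 0 by (simp add: power2_eq_square)
      have e1: "Dc (Suc (Suc m)) (Suc 0) = Q * Dc (Suc m) (Suc 0) + Q ^ (m + 3) * (Q ^ Suc (Suc m) + Q ^ Suc m)"
        using Dc_rec1[of "Suc m" 0] by (simp add: Dc_0_right numeral_3_eq_3)
      have e2: "Dc (Suc m) (Suc 0) = Q * Q ^ Suc m + Q ^ 2 * (Dc m (Suc 0) + Q ^ m)" unfolding IH Dc_0_right ..
      have e3: "Dc (Suc m) (Suc 0) = Q * Dc m (Suc 0) + Q ^ (m + 2) * (Q ^ Suc m + Q ^ m)"
        using Dc_rec1[of m 0] by (simp add: Dc_0_right)
      have "Q * (Q * Q ^ Suc m + Q ^ 2 * (Dc m (Suc 0) + Q ^ m)) + Q ^ (m + 3) * (Q ^ Suc (Suc m) + Q ^ Suc m) =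
          Q * Q ^ Suc (Suc m) + Q ^ 2 * ((Q * Dc m (Suc 0) + Q ^ (m + 2) * (Q ^ Suc m + Q ^ m)) + Q ^ Suc m)"
        by (simp add: algebra_simps power2_eq_square numeral_3_eq_3)
      thus ?thesis unfolding n 0 Dc_0_right using e1[unfolded e2] unfolding e3[symmetric] by (simp add: power2_eq_square)
    next
      case r: (Suc s)
      define A B C E F G where "A = Dc m (Suc (Suc s))" and "B = Dc m (Suc s)" and "C = Dc m s"
        and "E = Dc (Suc m) (Suc s)" and "F = Dc (Suc m) s" and "G = Dc (Suc (Suc m)) s"
      have I1: "Dc (Suc m) (Suc (Suc s)) = Q * E + Q ^ (s + 3) * (A + B)"
        using less[of m "Suc s"] n r by (simp add: A_def B_def E_def numeral_3_eq_3)
      have I2: "Dc (Suc (Suc m)) (Suc s) = Q * G + Q ^ (s + 2) * (E + F)"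
        using less[of "Suc m" s] n r by (simp add: G_def F_def E_def)
      have I3: "E = Q * F + Q ^ (s + 2) * (B + C)"
        using less[of m s] n r by (simp add: E_def F_def B_def C_def)
      have R0: "Dc (Suc (Suc m)) (Suc (Suc s)) = Q * Dc (Suc m) (Suc (Suc s)) + Q ^ (m + 3) * (Dc (Suc (Suc m)) (Suc s) + E)"
        using Dc_rec1[of "Suc m" "Suc s"] by (simp add: E_def numeral_3_eq_3)
      have R1: "Dc (Suc m) (Suc (Suc s)) = Q * A + Q ^ (m + 2) * (E + B)"
        using Dc_rec1[of m "Suc s"] by (simp add: A_def B_def E_def)
      have R2: "Dc (Suc (Suc m)) (Suc s) = Q * E + Q ^ (m + 3) * (G + F)"
        using Dc_rec1[of "Suc m" s] by (simp add: G_def F_def E_def numeral_3_eq_3)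
      have R3: "E = Q * B + Q ^ (m + 2) * (F + C)"
        using Dc_rec1[of m s] by (simp add: E_def F_def B_def C_def)
      have p: "Q ^ (m + 3) = Q * Q ^ (m + 2)" "Q ^ (s + 3) = Q * Q ^ (s + 2)" by (simp_all add: numeral_3_eq_3)
      define X Y where "X = Q ^ (m + 2)" and "Y = Q ^ (s + 2)"
      note eqs = I1[unfolded p] I2 I3 R0[unfolded p] R1 R2[unfolded p] R3
      have "Q * (Q * E + Q * Y * (A + B)) + Q * X * (Q * G + Y * (E + F) + (Q * F + Y * (B + C))) =
            Q * (Q * E + Q * X * (G + F)) + Q * Y * ((Q * A + X * (E + B)) + (Q * B + X * (F + C)))"
        by (simp add: algebra_simps)
      moreover have "Dc (Suc (Suc m)) (Suc (Suc s)) =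
          Q * (Q * E + Q * Y * (A + B)) + Q * X * (Q * G + Y * (E + F) + (Q * F + Y * (B + C)))"
        using eqs(4) unfolding eqs(1,2) unfolding X_def[symmetric] Y_def[symmetric]
        by (simp only: eqs(3)[folded Y_def, symmetric])
      moreover have "Q * Dc (Suc (Suc m)) (Suc s) + Q * Y * (Dc (Suc m) (Suc (Suc s)) + E) =
          Q * (Q * E + Q * X * (G + F)) + Q * Y * ((Q * A + X * (E + B)) + (Q * B + X * (F + C)))"
        unfolding eqs(5,6) X_def[symmetric] by (simp only: eqs(7)[folded X_def, symmetric])
      ultimately have "Dc (Suc (Suc m)) (Suc (Suc s)) = Q * Dc (Suc (Suc m)) (Suc s) + Q * Y * (Dc (Suc m) (Suc (Suc s)) + E)"
        by simp
      thus ?thesis unfolding n r E_def Y_def by (simp add: numeral_3_eq_3)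
    qed
  qed
qed

lemma Dc_sym: "Dc n r = Dc r n"
proof (induction "n + r" arbitrary: n r rule: less_induct)
  case less
  show ?case
  proof (cases n; cases r)
    fix m s assume nr: "n = Suc m" "r = Suc s"
    have "Dc m (Suc s) = Dc (Suc s) m" "Dc (Suc m) s = Dc s (Suc m)" "Dc m s = Dc s m"
      using less nr by auto
    thus ?thesis unfolding nr using Dc_rec1[of m s] Dc_rec2[of s m] by simp
  qed (auto simp: Dc_0_right Dc_0_left)
qed

text \<open>For \<open>r > 0\<close> the exponent \<open>Suc i * r\<close> is at least
  \<open>i + r\<close>, which leaves a geometric sum over \<open>i\<close>; for \<open>r = 0\<close>
  the value is known exactly.\<close>

lemma Dc_bound: obtains M where "\<And>n r. norm (Dc n r) \<le> M * (norm Q ^ n * norm Q ^ r)"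
proof -
  obtain M where M: "M \<ge> 1" "\<And>i j. norm (dc i * ec j) \<le> M" using ec_dc_bounded by auto
  let ?S = "\<Sum>i. norm Q ^ i"
  have sm: "summable (\<lambda>i. norm Q ^ i)" using lt1 by (intro summable_geometric) auto
  have S1: "?S \<ge> 1" using suminf_split_head[OF sm] suminf_nonneg[of "\<lambda>i. norm Q ^ Suc i"] sm by (simp add: summable_Suc_iff)
  have "norm (Dc n r) \<le> (M * ?S) * (norm Q ^ n * norm Q ^ r)" for n r
  proof (cases "r = 0")
    case True
    have "1 * norm Q ^ n \<le> (M * ?S) * norm Q ^ n"
      using M S1 by (intro mult_right_mono) (auto intro: order.trans[OF S1])
    thus ?thesis using True by (simp add: Dc_0_right norm_power)
  next
    case False
    have "norm (\<Sum>i\<le>n. dc i * ec (n - i) * Q ^ (Suc i * r)) \<le> (\<Sum>i\<le>n. M * (norm Q ^ i * norm Q ^ r))"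
    proof (rule sum_norm_le)
      fix i
      have "norm (Q ^ (Suc i * r)) \<le> norm Q ^ (i + r)"
        unfolding norm_power using lt1 False by (intro power_decreasing) auto
      thus "norm (dc i * ec (n - i) * Q ^ (Suc i * r)) \<le> M * (norm Q ^ i * norm Q ^ r)"
        unfolding norm_mult[of _ "Q ^ _"] power_add[symmetric] using M by (intro mult_mono) auto
    qed
    also have "\<dots> = M * norm Q ^ r * (\<Sum>i\<le>n. norm Q ^ i)" by (simp add: sum_distrib_left mult_ac)
    also have "\<dots> \<le> M * norm Q ^ r * ?S"
      using M sm by (intro mult_left_mono sum_le_suminf) auto
    finally have "norm Q ^ n * norm (\<Sum>i\<le>n. dc i * ec (n - i) * Q ^ (Suc i * r)) \<le> norm Q ^ n * (M * norm Q ^ r * ?S)"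
      by (intro mult_left_mono) auto
    thus ?thesis by (simp add: Dc_def norm_mult norm_power mult_ac)
  qed
  thus ?thesis using that by blast
qed

text \<open>A case of the q-binomial theorem. The recurrence of \<open>ec\<close> gives
  \<open>(1 - x) * f x = (1 + x) * f (Q * x)\<close>; iterating it moves the argument to 0, where
  \<open>f\<close> tends to 1.\<close>

lemma ec_sum:
  assumes y: "norm y < 1"
  shows "(\<Sum>\<^sub>\<infinity>j. ec j * y ^ j) = qpoch_inf (- y) Q / qpoch_inf y Q"
proof -
  obtain M where M: "M \<ge> 1" "\<And>j. norm (ec j) \<le> M" using ec_dc_bounded by auto
  have bd: "norm (ec j * x ^ j) \<le> M * norm x ^ j" for j x
    unfolding norm_mult norm_power using M by (intro mult_right_mono) auto
  have gs: "summable (\<lambda>j. M * norm x ^ j)" if "norm x < 1" for x :: complex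
    using that by (intro summable_mult summable_geometric) auto
  have sm: "summable (\<lambda>j. ec j * x ^ j)" if "norm x < 1" for x
    by (rule summable_comparison_test'[OF gs[OF that]]) (rule bd)
  define f where "f x = (\<Sum>j. ec j * x ^ j)" for x
  have step: "(1 - x) * f x = (1 + x) * f (Q * x)" if x: "norm x < 1" for x
  proof -
    have Qx: "norm (Q * x) < 1" using x lt1 unfolding norm_mult by (metis mult_left_le_one_le norm_ge_zero less_imp_le le_less_trans)
    have "f x - f (Q * x) = (\<Sum>j. ec j * (1 - Q ^ j) * x ^ j)"
      unfolding f_def suminf_diff[OF sm[OF x] sm[OF Qx]] by (simp add: algebra_simps power_mult_distrib)
    also have "\<dots> = (\<Sum>j. ec (Suc j) * (1 - Q ^ Suc j) * x ^ Suc j)"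
    proof -
      have "summable (\<lambda>j. ec j * (1 - Q ^ j) * x ^ j)"
        using summable_diff[OF sm[OF x] sm[OF Qx]] by (simp add: algebra_simps power_mult_distrib)
      thus ?thesis using suminf_split_head by fastforce
    qed
    also have "\<dots> = (\<Sum>j. x * (ec j * x ^ j + ec j * (Q * x) ^ j))"
      unfolding ec_rec by (simp add: algebra_simps power_mult_distrib)
    also have "\<dots> = x * (f x + f (Q * x))"
      unfolding f_def suminf_add[OF sm[OF x] sm[OF Qx]] by (intro suminf_mult summable_add sm x Qx)
    finally show ?thesis by (simp add: algebra_simps)
  qed
  have ylt: "norm (y * Q ^ n) < 1" for n
    using y norm_q_pow[of n] unfolding norm_mult by (meson le_less_trans mult_left_le norm_ge_zero)
  have iter: "qpoch y Q n * f y = qpoch (- y) Q n * f (y * Q ^ n)" for n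
  proof (induction n)
    case (Suc n)
    have "qpoch y Q (Suc n) * f y = (qpoch y Q n * f y) * (1 - y * Q ^ n)"
      unfolding qpoch_Suc by (simp add: mult_ac)
    also have "\<dots> = qpoch (- y) Q n * ((1 - y * Q ^ n) * f (y * Q ^ n))"
      unfolding Suc by (simp only: mult_ac)
    also have "\<dots> = qpoch (- y) Q n * ((1 + y * Q ^ n) * f (Q * (y * Q ^ n)))"
      unfolding step[OF ylt] ..
    also have "\<dots> = qpoch (- y) Q (Suc n) * f (y * Q ^ Suc n)" by (simp add: qpoch_Suc mult_ac)
    finally show ?case .
  qed auto
  have f1: "(\<lambda>n. f (y * Q ^ n)) \<longlonglongrightarrow> 1"
  proof -
    have "(\<lambda>n. ec j * (y * Q ^ n) ^ j) \<longlonglongrightarrow> (if j = 0 then 1 else 0)" for j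
    proof (cases "j = 0")
      case False
      have "(\<lambda>n. ec j * (y * Q ^ n) ^ j) \<longlonglongrightarrow> ec j * (y * 0) ^ j"
        by (intro tendsto_intros q_pow_tendsto)
      thus ?thesis using False by (simp add: zero_power)
    qed simp
    moreover have "norm (ec j * (y * Q ^ n) ^ j) \<le> M * norm y ^ j" for j n
    proof -
      have "norm (y * Q ^ n) \<le> norm y" using norm_q_pow[of n] unfolding norm_mult by (simp add: mult_left_le)
      hence "M * norm (y * Q ^ n) ^ j \<le> M * norm y ^ j" using M by (intro mult_left_mono power_mono) auto
      thus ?thesis using bd order_trans by blast
    qed
    ultimately have "(\<lambda>n. \<Sum>j. ec j * (y * Q ^ n) ^ j) \<longlonglongrightarrow> (\<Sum>j. if j = 0 then 1 else 0)"
      using tannerys_theorem[where a = "\<lambda>j n. ec j * (y * Q ^ n) ^ j" and M = "\<lambda>j. M * norm y ^ j"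
          and F = sequentially and b = "\<lambda>j. if j = 0 then 1 else 0"] gs[OF y]
      by (auto intro!: always_eventually)
    also have "(\<Sum>j::nat. if j = 0 then 1 else 0) = (1 :: complex)" by (subst suminf_finite[of "{0}"]) auto
    finally show ?thesis by (simp add: f_def)
  qed
  have "(\<lambda>n. qpoch y Q n * f y) \<longlonglongrightarrow> qpoch_inf y Q * f y" by (intro tendsto_intros qpoch_tendsto)
  moreover have "(\<lambda>n. qpoch y Q n * f y) \<longlonglongrightarrow> qpoch_inf (- y) Q * 1"
    unfolding iter by (intro tendsto_mult f1 qpoch_tendsto)
  ultimately have "qpoch_inf y Q * f y = qpoch_inf (- y) Q" using LIMSEQ_unique by fastforce
  moreover have "f y = (\<Sum>\<^sub>\<infinity>j. ec j * y ^ j)"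
  proof -
    have "summable (\<lambda>j. norm (ec j * y ^ j))" by (rule summable_comparison_test'[OF gs[OF y]]) (use bd in auto)
    hence "(\<lambda>j. ec j * y ^ j) summable_on UNIV" by (rule norm_summable_imp_summable_on)
    thus ?thesis unfolding f_def using has_sum_imp_sums[OF has_sum_infsum] sums_unique by metis
  qed
  ultimately show ?thesis using qpoch_inf_nz'[OF y] by (simp add: field_simps)
qed

text \<open>The generating function of all overpartitions.\<close>

definition P_over :: complex where "P_over = qpoch_inf (- Q) Q / qpoch_inf Q Q"

lemma geom_bounded_summable3:
  fixes f :: "nat \<times> nat \<times> nat \<Rightarrow> complex"
  assumes "\<And>i j t. norm (f (i, j, t)) \<le> C * (norm Q ^ i * (norm Q ^ j * norm Q ^ t))"
  shows "f summable_on UNIV"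
proof -
  have 1: "(\<lambda>n. complex_of_real (norm Q) ^ n) summable_on UNIV"
    using summable_on_of_real[OF geom_summable_on, where ?'a = complex] by simp
  have 2: "(\<lambda>(j, t). complex_of_real (norm Q) ^ j * complex_of_real (norm Q) ^ t) summable_on UNIV"
    using abs_summable_prod[OF 1 1] unfolding UNIV_Times_UNIV by (rule abs_summable_summable)
  have "(\<lambda>p. C * (norm Q ^ fst p * (norm Q ^ fst (snd p) * norm Q ^ snd (snd p)))) summable_on UNIV"
    using abs_summable_prod[OF 1 2]
    by (intro summable_on_cmult_right) (simp add: case_prod_unfold norm_mult norm_power)
  hence "(\<lambda>p. norm (f p)) summable_on UNIV"
    by (rule Infinite_Sum.abs_summable_on_comparison_test') (use assms in auto)
  thus ?thesis by (rule abs_summable_summable)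
qed

lemma geometric_infsum:
  assumes "norm x < 1" shows "(\<Sum>\<^sub>\<infinity>t::nat. x ^ t) = 1 / (1 - (x :: complex))"
proof -
  have "((\<lambda>t. x ^ t) has_sum (1 / (1 - x))) UNIV"
    using assms by (intro norm_summable_imp_has_sum) (auto simp: norm_power intro!: summable_geometric geometric_sums)
  thus ?thesis by (rule infsumI)
qed

lemma norm_Q_Suc_less: assumes "norm v \<le> 1" shows "norm (Q ^ Suc i * v) < 1"
proof -
  have "norm (Q ^ Suc i * v) \<le> norm Q * 1"
    using assms norm_q_pow[of i] unfolding power_Suc norm_mult mult.assoc
    by (intro mult_left_mono mult_le_one) auto
  thus ?thesis using lt1 by simp
qed

text \<open>Expand \<open>Dc\<close> and put \<open>n = i + j\<close>: the exponent splits into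
  separate contributions of \<open>i\<close>, \<open>j\<close> and \<open>t\<close>. The sum over
  \<open>t\<close> is geometric, the sum over \<open>j\<close> is \<open>ec_sum\<close>, and its
  tail products combine with \<open>dc i\<close> to \<open>P_over\<close>. The offset
  \<open>s\<close> will be 0 or 1, according to whether the diagonal is included.\<close>

lemma Dc_diagonal_sum:
  assumes v: "norm v = 1"
  shows "(\<Sum>\<^sub>\<infinity>(n, t). v ^ t * Dc n (n + t + s)) =
     (\<Sum>\<^sub>\<infinity>i. P_over * ((-1) ^ i * Q ^ (i * i + 2 * i + Suc i * s) * (1 - Q ^ Suc i) / ((1 + Q ^ Suc i) * (1 - Q ^ Suc i * v))))"
proof -
  define G where "G = (\<lambda>(i, j, t). (dc i * Q ^ (i * i + 2 * i + Suc i * s)) * ((ec j * (Q ^ Suc (Suc i)) ^ j) * (Q ^ Suc i * v) ^ t))"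
  obtain M where M: "M \<ge> 1" "\<And>i j. norm (dc i * ec j) \<le> M" using ec_dc_bounded by auto
  have G_bd: "norm (G (i, j, t)) \<le> M * (norm Q ^ i * (norm Q ^ j * norm Q ^ t))" for i j t
  proof -
    have le: "norm Q ^ m \<le> norm Q ^ n" if "n \<le> m" for m n
      using that lt1 by (intro power_decreasing) auto
    have "norm (G (i, j, t)) = norm (dc i * ec j) * (norm Q ^ (i * i + 2 * i + Suc i * s) * (norm Q ^ (Suc (Suc i) * j) * norm Q ^ (Suc i * t)))"
      by (simp only: G_def prod.case norm_mult norm_power v power_mult[symmetric] power_mult_distrib power_one mult_1_right)
         (simp only: mult_ac)
    also have "\<dots> \<le> M * (norm Q ^ i * (norm Q ^ j * norm Q ^ t))"
      using M by (intro mult_mono le) auto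
    finally show ?thesis .
  qed
  have G: "G summable_on UNIV" by (rule geom_bounded_summable3[OF G_bd])
  define X where "X = Sigma (UNIV :: (nat \<times> nat) set) (\<lambda>(n, t). {..n})"
  define H where "H = (\<lambda>((n, t), i). G (i, n - i, t))"
  have reidx: "infsum H X = infsum G UNIV" "H summable_on X"
  proof -
    have bij: "bij_betw (\<lambda>((n, t), i). (i, n - i, t)) X UNIV"
      by (rule bij_betw_byWitness[where f' = "\<lambda>(i, j, t). ((i + j, t), i)"]) (auto simp: X_def)
    show "infsum H X = infsum G UNIV"
      using infsum_reindex_bij_betw[OF bij, of G] by (simp add: H_def case_prod_unfold)
    show "H summable_on X"
      using summable_on_reindex_bij_betw[OF bij, of G] G by (simp add: H_def case_prod_unfold)
  qed
  have inner: "(\<Sum>\<^sub>\<infinity>i\<in>{..n}. H ((n, t), i)) = v ^ t * Dc n (n + t + s)" for n t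
  proof -
    have "H ((n, t), i) = v ^ t * (Q ^ n * (dc i * ec (n - i) * Q ^ (Suc i * (n + t + s))))" if i_le: "i \<le> n" for i
    proof -
      obtain j where j: "n = i + j" using le_Suc_ex[OF i_le] by auto
      have e1: "Q ^ (i * i + 2 * i + Suc i * s) * (Q ^ (Suc (Suc i) * j) * Q ^ (Suc i * t)) = Q ^ n * Q ^ (Suc i * (n + t + s))"
        unfolding power_add[symmetric] j by (rule arg_cong[of _ _ "power Q"]) (simp add: algebra_simps)
      have e2: "n - i = j" using j by simp
      have gen: "d * A * (e * B * (C * V)) = V * (D * (d * e * R))" if "A * (B * C) = D * R" for A B C D R V d e :: complex
      proof -
        have "d * A * (e * B * (C * V)) = (A * (B * C)) * (V * (d * e))" by (simp only: mult_ac)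
        thus ?thesis unfolding that by (simp only: mult_ac)
      qed
      show ?thesis unfolding H_def G_def prod.case power_mult_distrib power_mult[symmetric] e2 by (rule gen[OF e1])
    qed
    thus ?thesis by (simp add: Dc_def sum_distrib_left)
  qed
  have inner': "(\<Sum>\<^sub>\<infinity>i\<in>{..fst p}. H (p, i)) = v ^ snd p * Dc (fst p) (fst p + snd p + s)" for p
    using inner[of "fst p" "snd p"] unfolding prod.collapse .
  have "(\<Sum>\<^sub>\<infinity>(n, t). v ^ t * Dc n (n + t + s)) = infsum H X"
    using infsum_Sigma_banach[of H UNIV "\<lambda>(n, t). {..n}"] reidx(2)
    unfolding X_def by (simp add: case_prod_unfold inner' del: infsum_finite)
  also have "\<dots> = infsum G UNIV" by (rule reidx)
  also have "\<dots> = (\<Sum>\<^sub>\<infinity>i. \<Sum>\<^sub>\<infinity>p. G (i, p))"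
    using infsum_Sigma_banach[of G UNIV "\<lambda>_. UNIV"] G by simp
  also have "\<dots> = (\<Sum>\<^sub>\<infinity>i. P_over * ((-1) ^ i * Q ^ (i * i + 2 * i + Suc i * s) * (1 - Q ^ Suc i) / ((1 + Q ^ Suc i) * (1 - Q ^ Suc i * v))))"
  proof (rule infsum_cong)
    fix i :: nat
    have y: "norm (Q ^ Suc (Suc i)) < 1" using norm_Q_Suc_less[of 1 "Suc i"] by simp
    have x: "norm (Q ^ Suc i * v) < 1" using norm_Q_Suc_less[of v i] v by simp
    obtain M where M: "M \<ge> 1" "\<And>j. norm (ec j) \<le> M" using ec_dc_bounded by auto
    have s1: "(\<lambda>j. ec j * (Q ^ Suc (Suc i)) ^ j) summable_on UNIV"
    proof (rule geom_bounded_summable(2))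
      fix j
      have "norm ((Q ^ Suc (Suc i)) ^ j) \<le> norm Q ^ j"
        unfolding norm_power power_mult[symmetric] using lt1 by (intro power_decreasing) auto
      thus "norm (ec j * (Q ^ Suc (Suc i)) ^ j) \<le> M * norm Q ^ j"
        unfolding norm_mult[of "ec j"] using M by (intro mult_mono) auto
    qed
    have s2: "(\<lambda>t. (Q ^ Suc i * v) ^ t) summable_on UNIV"
      using x by (intro norm_summable_imp_summable_on) (auto simp: norm_power intro!: summable_geometric)
    have "(\<Sum>\<^sub>\<infinity>p. G (i, p)) = (dc i * Q ^ (i * i + 2 * i + Suc i * s)) *
        (\<Sum>\<^sub>\<infinity>(j, t). (ec j * (Q ^ Suc (Suc i)) ^ j) * (Q ^ Suc i * v) ^ t)"
      unfolding G_def by (simp add: case_prod_unfold infsum_cmult_right' del: power_Suc)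
    also have "(\<Sum>\<^sub>\<infinity>(j, t). (ec j * (Q ^ Suc (Suc i)) ^ j) * (Q ^ Suc i * v) ^ t) =
        qpoch_inf (- (Q ^ Suc (Suc i))) Q / qpoch_inf (Q ^ Suc (Suc i)) Q * (1 / (1 - Q ^ Suc i * v))"
      unfolding infsum_prod[OF s1 s2] geometric_infsum[OF x] ec_sum[OF y] ..
    also have "dc i * Q ^ (i * i + 2 * i + Suc i * s) * (qpoch_inf (- (Q ^ Suc (Suc i))) Q / qpoch_inf (Q ^ Suc (Suc i)) Q * (1 / (1 - Q ^ Suc i * v))) =
       P_over * ((-1) ^ i * Q ^ (i * i + 2 * i + Suc i * s) * (1 - Q ^ Suc i) / ((1 + Q ^ Suc i) * (1 - Q ^ Suc i * v)))"
    proof -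
      have "qpoch_inf (- Q) Q = qpoch (- Q) Q i * (1 + Q ^ Suc i) * qpoch_inf (- (Q ^ Suc (Suc i))) Q"
        using qpoch_inf_split[of "- Q" "Suc i"] by (simp add: qpoch_Suc mult_ac)
      moreover have "qpoch_inf Q Q = qpoch Q Q i * (1 - Q ^ Suc i) * qpoch_inf (Q ^ Suc (Suc i)) Q"
        using qpoch_inf_split[of Q "Suc i"] by (simp add: qpoch_Suc mult_ac)
      moreover have "qpoch_inf Q Q \<noteq> 0" by (rule qpoch_inf_nz'[OF lt1])
      moreover have "c * A / B * E * (A' / B' * (1 / u)) = A * a * A' / (B * b * B') * (c * E * b / (a * u))"
        if "a \<noteq> 0" "b \<noteq> 0" for A B E A' B' u a b c :: complex
        using that by simp
      ultimately show ?thesis unfolding dc_def P_over_def by simp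
    qed
    finally show "(\<Sum>\<^sub>\<infinity>p. G (i, p)) = P_over * ((-1) ^ i * Q ^ (i * i + 2 * i + Suc i * s) * (1 - Q ^ Suc i) / ((1 + Q ^ Suc i) * (1 - Q ^ Suc i * v)))" .
  qed
  finally show ?thesis .
qed

lemma rank_gf_Dc:
  assumes z: "norm z = 1"
  shows "rank_gf z Q = 1 + 2 * Q * (\<Sum>\<^sub>\<infinity>(n, r). z ^ n * (1 / z) ^ r * Dc n r)"
    and "(\<lambda>(n, r). z ^ n * (1 / z) ^ r * Dc n r) summable_on UNIV"
proof -
  have w: "norm (1 / z) = 1" using z by (simp add: norm_divide)
  obtain M where M: "\<And>n r. norm (Dc n r) \<le> M * (norm Q ^ n * norm Q ^ r)" using Dc_bound by blast
  show sm: "(\<lambda>(n, r). z ^ n * (1 / z) ^ r * Dc n r) summable_on UNIV"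
    by (rule geom_bounded_summable2[of _ M]) (use M z in \<open>simp add: norm_mult norm_power norm_divide\<close>)
  have "(\<Sum>\<^sub>\<infinity>(n, r). z ^ n * (1 / z) ^ r * Dc n r) = (\<Sum>\<^sub>\<infinity>n. \<Sum>\<^sub>\<infinity>r. z ^ n * (1 / z) ^ r * Dc n r)"
    using infsum_Sigma_banach[of "\<lambda>(n, r). z ^ n * (1 / z) ^ r * Dc n r" UNIV "\<lambda>_. UNIV"] sm by simp
  also have "2 * Q * \<dots> = (\<Sum>\<^sub>\<infinity>n. 2 * Q * (\<Sum>\<^sub>\<infinity>r. z ^ n * (1 / z) ^ r * Dc n r))"
    by (rule infsum_cmult_right'[symmetric])
  also have "\<dots> = (\<Sum>\<^sub>\<infinity>L. z ^ Suc L * (qpoch (- Q / z) Q L / qpoch (Q / z) Q L * (2 * (Q ^ Suc L / z) / (1 - Q ^ Suc L / z))))"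
  proof (rule infsum_cong)
    fix n
    have "(\<Sum>\<^sub>\<infinity>r. z ^ n * (1 / z) ^ r * Dc n r) = (\<Sum>\<^sub>\<infinity>r. z ^ n * Q ^ n * (\<Sum>i\<le>n. dc i * ec (n - i) * (Q ^ Suc i * (1 / z)) ^ r))"
    proof (rule infsum_cong)
      fix r
      have "(\<Sum>i\<le>n. dc i * ec (n - i) * (Q ^ Suc i * (1 / z)) ^ r) = (1 / z) ^ r * (\<Sum>i\<le>n. dc i * ec (n - i) * Q ^ (Suc i * r))"
        unfolding sum_distrib_left power_mult_distrib power_mult[symmetric] by (simp only: mult_ac)
      thus "z ^ n * (1 / z) ^ r * Dc n r = z ^ n * Q ^ n * (\<Sum>i\<le>n. dc i * ec (n - i) * (Q ^ Suc i * (1 / z)) ^ r)"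
        unfolding Dc_def by (simp only: mult_ac)
    qed
    also have "\<dots> = z ^ n * Q ^ n * (\<Sum>i\<le>n. \<Sum>\<^sub>\<infinity>r. dc i * ec (n - i) * (Q ^ Suc i * (1 / z)) ^ r)"
    proof -
      have s0: "(\<lambda>r. dc i * ec (n - i) * (Q ^ Suc i * (1 / z)) ^ r) summable_on UNIV" for i
        using norm_Q_Suc_less[of "1 / z" i] w
        by (intro summable_on_cmult_right norm_summable_imp_summable_on) (auto simp: norm_power intro!: summable_geometric)
      have sm: "((\<lambda>r. \<Sum>i\<in>I. dc i * ec (n - i) * (Q ^ Suc i * (1 / z)) ^ r) has_sum
          (\<Sum>i\<in>I. \<Sum>\<^sub>\<infinity>r. dc i * ec (n - i) * (Q ^ Suc i * (1 / z)) ^ r)) UNIV" if "finite I" for I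
        using that
      proof (induction I rule: finite_induct)
        case (insert x F)
        show ?case unfolding sum.insert[OF insert.hyps]
          by (intro has_sum_add insert.IH) (use s0 in \<open>simp only: has_sum_infsum\<close>)
      qed simp
      hence "(\<Sum>\<^sub>\<infinity>r. \<Sum>i\<le>n. dc i * ec (n - i) * (Q ^ Suc i * (1 / z)) ^ r) = (\<Sum>i\<le>n. \<Sum>\<^sub>\<infinity>r. dc i * ec (n - i) * (Q ^ Suc i * (1 / z)) ^ r)"
        by (intro infsumI sm) auto
      thus ?thesis unfolding infsum_cmult_right' by simp
    qed
    also have "\<dots> = z ^ n * Q ^ n * (\<Sum>i\<le>n. dc i * ec (n - i) / (1 - Q ^ Suc i * (1 / z)))"
    proof -
      have "(\<Sum>\<^sub>\<infinity>r. (Q ^ Suc i * (1 / z)) ^ r) = 1 / (1 - Q ^ Suc i * (1 / z))" for i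
        by (rule geometric_infsum[OF norm_Q_Suc_less]) (simp add: w)
      thus ?thesis unfolding infsum_cmult_right' by (simp only: times_divide_eq_right mult_1_right)
    qed
    also have "\<dots> = z ^ n * Q ^ n * (qpoch (- Q * (1 / z)) Q n / qpoch (Q * (1 / z)) Q (Suc n))"
      using overpartition_partial_fractions[of "1 / z" n] w by simp
    finally have "(\<Sum>\<^sub>\<infinity>r. z ^ n * (1 / z) ^ r * Dc n r) = z ^ n * Q ^ n * (qpoch (- Q / z) Q n / (qpoch (Q / z) Q n * (1 - Q ^ Suc n / z)))"
      by (simp add: qpoch_Suc)
    moreover have "z \<noteq> 0" using z by auto
    ultimately show "2 * Q * (\<Sum>\<^sub>\<infinity>r. z ^ n * (1 / z) ^ r * Dc n r) =
       z ^ Suc n * (qpoch (- Q / z) Q n / qpoch (Q / z) Q n * (2 * (Q ^ Suc n / z) / (1 - Q ^ Suc n / z)))" by simp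
  qed
  finally show "rank_gf z Q = 1 + 2 * Q * (\<Sum>\<^sub>\<infinity>(n, r). z ^ n * (1 / z) ^ r * Dc n r)"
    using rank_gf_largest_part[OF z] by simp
qed

text \<open>The double series is cut along the diagonal. By the symmetry of \<open>Dc\<close> the
  part below it is a diagonal sum as well, with \<open>z\<close> in place of \<open>1 / z\<close>,
  and the two Lambert series combine term by term.\<close>

lemma rank_gf_lambert:
  assumes z: "norm z = 1"
  shows "(\<lambda>i. (-1) ^ i * Q ^ (Suc i * Suc i) * (1 - Q ^ Suc i) ^ 2 / ((1 - z * Q ^ Suc i) * (1 - Q ^ Suc i / z))) summable_on UNIV" (is ?T1)
    and "rank_gf z Q = 1 + 2 * P_over * (\<Sum>\<^sub>\<infinity>i. (-1) ^ i * Q ^ (Suc i * Suc i) * (1 - Q ^ Suc i) ^ 2 / ((1 - z * Q ^ Suc i) * (1 - Q ^ Suc i / z)))"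
proof -
  let ?F = "\<lambda>(n, r). z ^ n * (1 / z) ^ r * Dc n r"
  have z0: "z \<noteq> 0" using z by auto
  have w: "norm (1 / z) = 1" using z by (simp add: norm_divide)
  have sub: "?F summable_on X" for X
    by (rule summable_on_subset_banach[OF rank_gf_Dc(2)[OF z]]) auto
  let ?a = "\<lambda>(n :: nat, t :: nat). (n, n + t)" and ?b = "\<lambda>(n :: nat, t :: nat). (n + t + 1, n)"
  have U: "(UNIV :: (nat \<times> nat) set) = range ?a \<union> range ?b"
  proof -
    have "(n, r) \<in> range ?a \<union> range ?b" for n r :: nat
    proof (cases "n \<le> r")
      case True
      hence "(n, r) = ?a (n, r - n)" by simp
      thus ?thesis by blast
    next
      case False
      hence "(n, r) = ?b (r, n - r - 1)" by simp
      thus ?thesis by blast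
    qed
    thus ?thesis by auto
  qed
  have dis: "range ?a \<inter> range ?b = {}" by auto
  have inj: "inj ?a" "inj ?b" by (auto simp: inj_on_def)
  have "infsum ?F UNIV = infsum ?F (range ?a) + infsum ?F (range ?b)"
    by (subst U, rule infsum_Un_disjoint[OF sub sub dis])
  also have "infsum ?F (range ?a) = (\<Sum>\<^sub>\<infinity>(n, t). (1 / z) ^ t * Dc n (n + t + 0))"
    unfolding infsum_reindex[OF inj(1)]
    by (rule infsum_cong) (auto simp: power_add power_one_over z0)
  also have "\<dots> = (\<Sum>\<^sub>\<infinity>i. P_over * ((-1) ^ i * Q ^ (i * i + 2 * i + Suc i * 0) * (1 - Q ^ Suc i) / ((1 + Q ^ Suc i) * (1 - Q ^ Suc i * (1 / z)))))"
    by (rule Dc_diagonal_sum[OF w])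
  also have "infsum ?F (range ?b) = (\<Sum>\<^sub>\<infinity>p. z * (case p of (n, t) \<Rightarrow> z ^ t * Dc n (n + t + 1)))"
    unfolding infsum_reindex[OF inj(2)]
  proof (rule infsum_cong, clarify)
    fix n t :: nat
    show "(?F \<circ> ?b) (n, t) = z * (z ^ t * Dc n (n + t + 1))"
      using Dc_sym[of "n + t + 1" n] z0 by (simp add: power_add power_one_over)
  qed
  also have "\<dots> = z * (\<Sum>\<^sub>\<infinity>(n, t). z ^ t * Dc n (n + t + 1))" by (rule infsum_cmult_right')
  also have "\<dots> = z * (\<Sum>\<^sub>\<infinity>i. P_over * ((-1) ^ i * Q ^ (i * i + 2 * i + Suc i * 1) * (1 - Q ^ Suc i) / ((1 + Q ^ Suc i) * (1 - Q ^ Suc i * z))))"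
    by (subst Dc_diagonal_sum[OF z]) simp
  finally have eq: "rank_gf z Q = 1 + 2 * Q * ((\<Sum>\<^sub>\<infinity>i. P_over * ((-1) ^ i * Q ^ (i * i + 2 * i + Suc i * 0) * (1 - Q ^ Suc i) / ((1 + Q ^ Suc i) * (1 - Q ^ Suc i * (1 / z)))))
     + z * (\<Sum>\<^sub>\<infinity>i. P_over * ((-1) ^ i * Q ^ (i * i + 2 * i + Suc i * 1) * (1 - Q ^ Suc i) / ((1 + Q ^ Suc i) * (1 - Q ^ Suc i * z)))))"
    unfolding rank_gf_Dc(1)[OF z] by simp
  have dinv: "\<exists>C. \<forall>i. norm (1 / (1 - Q ^ Suc i * v)) \<le> C" if "norm v = 1" for v
  proof -
    have "(\<lambda>i. 1 / (1 - Q ^ Suc i * v)) \<longlonglongrightarrow> 1 / (1 - 0 * v)"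
      by (rule tendsto_divide tendsto_diff tendsto_mult tendsto_const LIMSEQ_Suc[OF q_pow_tendsto])+ simp
    thus ?thesis by (rule convergent_bounded) blast
  qed
  have dinv2: "\<exists>C. \<forall>i. norm (1 / (1 + Q ^ Suc i)) \<le> C" using dinv[of "-1"] by simp
  have summ: "(\<lambda>i. P_over * ((-1) ^ i * Q ^ (i * i + 2 * i + Suc i * s) * (1 - Q ^ Suc i) / ((1 + Q ^ Suc i) * (1 - Q ^ Suc i * v)))) summable_on UNIV"
    if v: "norm v = 1" for v s
  proof -
    obtain C D where C: "\<And>i. norm (1 / (1 - Q ^ Suc i * v)) \<le> C" and D: "\<And>i. norm (1 / (1 + Q ^ Suc i)) \<le> D"
      using dinv[OF v] dinv2 by auto
    have CD: "C \<ge> 0" "D \<ge> 0" using C D norm_ge_zero order_trans by blast+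
    have "norm ((-1) ^ i * Q ^ (i * i + 2 * i + Suc i * s) * (1 - Q ^ Suc i) / ((1 + Q ^ Suc i) * (1 - Q ^ Suc i * v))) \<le> (2 * D * C) * norm Q ^ i" for i
    proof -
      have "norm (1 - Q ^ Suc i) \<le> 2" using norm_triangle_ineq4[of 1 "Q ^ Suc i"] norm_q_pow[of "Suc i"] by simp
      moreover have "norm Q ^ (i * i + 2 * i + Suc i * s) \<le> norm Q ^ i" using lt1 by (intro power_decreasing) auto
      ultimately have "norm Q ^ (i * i + 2 * i + Suc i * s) * norm (1 - Q ^ Suc i) * norm (1 / (1 + Q ^ Suc i)) * norm (1 / (1 - Q ^ Suc i * v))
          \<le> norm Q ^ i * 2 * D * C"
        using C D CD by (intro mult_mono) auto
      thus ?thesis by (simp add: norm_mult norm_power norm_divide mult_ac)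
    qed
    hence "(\<lambda>i. (-1) ^ i * Q ^ (i * i + 2 * i + Suc i * s) * (1 - Q ^ Suc i) / ((1 + Q ^ Suc i) * (1 - Q ^ Suc i * v))) summable_on UNIV"
      by (rule geom_bounded_summable(2))
    thus ?thesis by (rule summable_on_cmult_right)
  qed
  have pair: "2 * Q * (P_over * ((-1) ^ i * Q ^ (i * i + 2 * i + Suc i * 0) * (1 - Q ^ Suc i) / ((1 + Q ^ Suc i) * (1 - Q ^ Suc i * (1 / z)))) +
      z * (P_over * ((-1) ^ i * Q ^ (i * i + 2 * i + Suc i * 1) * (1 - Q ^ Suc i) / ((1 + Q ^ Suc i) * (1 - Q ^ Suc i * z))))) =
     2 * P_over * ((-1) ^ i * Q ^ (Suc i * Suc i) * (1 - Q ^ Suc i) ^ 2 / ((1 - z * Q ^ Suc i) * (1 - Q ^ Suc i / z)))" for i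
  proof -
    define x where "x = Q ^ Suc i"
    have nz: "1 + x \<noteq> 0" "1 - x * (1 / z) \<noteq> 0" "1 - x * z \<noteq> 0"
      using one_plus_Q_nz[of i] q_ne[of "1 / z" i] q_ne[of z i] w z by (auto simp: x_def)
    have e: "Q ^ (Suc i * Suc i) = Q * Q ^ (i * i + 2 * i)" "Q ^ (i * i + 2 * i + Suc i * 1) = Q ^ (i * i + 2 * i) * x"
      by (simp_all add: x_def power_add algebra_simps mult_2_right)
    have gen: "2 * Q * (p * (c * E * (1 - x) / ((1 + x) * A)) + z * (p * (c * (E * x) * (1 - x) / ((1 + x) * B)))) =
        2 * p * (c * (Q * E) * (1 - x) ^ 2 / (B * A))" if "A = 1 - x * (1 / z)" "B = 1 - x * z" for p c E A B
    proof -
      have "A \<noteq> 0" "B \<noteq> 0" using that nz by auto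
      \<comment> \<open>This identity supplies the factor \<open>1 + x\<close>, which cancels the
        denominator left over from \<open>Dc_diagonal_sum\<close>.\<close>
      moreover have "B + z * x * A = (1 + x) * (1 - x)" unfolding that using z0 by (simp add: algebra_simps)
      moreover have "2 * Q * (p * (c * E * (1 - x) / ((1 + x) * A)) + z * (p * (c * (E * x) * (1 - x) / ((1 + x) * B)))) =
         2 * Q * p * c * E * (1 - x) * (B + z * x * A) / ((1 + x) * (B * A))"
        using nz(1) calculation(1,2) by (simp add: divide_simps) (simp add: algebra_simps)
      ultimately show ?thesis using nz(1) by (simp add: power2_eq_square mult_ac)
    qed
    show ?thesis unfolding e x_def[symmetric] using gen[OF refl refl] by (simp add: mult.commute[of z] mult.commute[of "1 - x * z"])
  qed
  define f g where "f i = P_over * ((-1) ^ i * Q ^ (i * i + 2 * i + Suc i * 0) * (1 - Q ^ Suc i) / ((1 + Q ^ Suc i) * (1 - Q ^ Suc i * (1 / z))))"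
    and "g i = P_over * ((-1) ^ i * Q ^ (i * i + 2 * i + Suc i * 1) * (1 - Q ^ Suc i) / ((1 + Q ^ Suc i) * (1 - Q ^ Suc i * z)))" for i
  have fg: "f summable_on UNIV" "g summable_on UNIV"
    unfolding f_def[abs_def] g_def[abs_def] by (rule summ[OF w], rule summ[OF z])
  let ?T = "\<lambda>i. (-1) ^ i * Q ^ (Suc i * Suc i) * (1 - Q ^ Suc i) ^ 2 / ((1 - z * Q ^ Suc i) * (1 - Q ^ Suc i / z))"
  have pair': "2 * Q * (f i + z * g i) = 2 * P_over * ?T i" for i
    unfolding f_def g_def by (rule pair)
  have "rank_gf z Q = 1 + 2 * Q * (infsum f UNIV + z * infsum g UNIV)"
    unfolding f_def[abs_def] g_def[abs_def] by (rule eq)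
  also have "infsum f UNIV + z * infsum g UNIV = (\<Sum>\<^sub>\<infinity>i. f i + z * g i)"
    by (subst infsum_add[OF fg(1) summable_on_cmult_right[OF fg(2)]]) (simp add: infsum_cmult_right')
  also have "2 * Q * \<dots> = (\<Sum>\<^sub>\<infinity>i. 2 * P_over * ?T i)"
    unfolding infsum_cmult_right'[symmetric] pair' ..
  finally show "rank_gf z Q = 1 + 2 * P_over * (\<Sum>\<^sub>\<infinity>i. ?T i)" unfolding infsum_cmult_right' .
  have "(\<lambda>i. 2 * Q * (f i + z * g i)) summable_on UNIV"
    by (intro summable_on_cmult_right summable_on_add fg)
  moreover have "P_over \<noteq> 0"
    using qpoch_inf_nz'[of "- Q"] qpoch_inf_nz'[of Q] lt1 by (simp add: P_over_def)
  ultimately show ?T1 unfolding pair' by (subst (asm) summable_on_cmult_right') simp_all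
qed

section \<open>Cube and sixth roots of unity\<close>

definition J :: "nat \<Rightarrow> complex" where "J n = qpoch_inf (Q ^ n) (Q ^ n)"

lemma J_nz: assumes "n > 0" shows "J n \<noteq> 0"
proof -
  interpret Qn: nome "Q ^ n" by (rule nome_power) fact
  show ?thesis unfolding J_def by (rule Qn.qpoch_inf_nz'[OF Qn.lt1])
qed

lemma qpoch_inf_minus_Q: "qpoch_inf (- Q) Q * qpoch_inf Q Q = J 2"
  using qpoch_inf_minus[of Q] by (simp add: J_def mult.commute)

lemma P_over_J: "P_over = J 2 / J 1 ^ 2"
  using qpoch_inf_minus_Q J_nz[of 1] by (simp add: P_over_def J_def power2_eq_square field_simps)

text \<open>The theta function here is the sum of \<open>(-1) ^ n * Q ^ (n * n)\<close> over all
  integers, and this is Gauss's product for it. Hence it is the reciprocal of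
  \<open>P_over\<close>.\<close>

lemma phi_product: "theta (Q ^ 2) Q = J 1 ^ 2 / J 2"
proof -
  interpret Q2: nome "Q ^ 2" by (rule nome_power) simp
  have "Q ^ 2 / Q = Q" by (simp add: power2_eq_square)
  hence "theta (Q ^ 2) Q = qpoch_inf Q (Q ^ 2) ^ 2 * J 2"
    by (simp add: Q2.jacobi_triple jtheta_def J_def power2_eq_square[of "qpoch_inf _ _"])
  moreover have "J 1 = qpoch_inf Q (Q ^ 2) * J 2"
    using qpoch_inf_2[of Q, folded power2_eq_square] by (simp add: J_def)
  ultimately show ?thesis using J_nz[of 2] by (simp add: power2_eq_square field_simps)
qed

lemma phi_P_over: "P_over * theta (Q ^ 2) Q = 1"
  using J_nz[of 1] J_nz[of 2] by (simp add: P_over_J phi_product)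

lemma qt_sq: "qt (Q ^ 2) n * (Q ^ m) powi n = (-1) powi n * Q powi (n * n - n + int m * n)"
proof -
  have "int 2 * tri n = n * n - n" using two_tri[of n] by (simp add: algebra_simps)
  hence "(Q ^ 2) powi tri n = Q powi (n * n - n)" unfolding power_int_power by (simp only:)
  thus ?thesis by (simp add: qt_def power_int_power power_int_add)
qed

lemma minus_one_powi: "(-1 :: complex) powi int n = (-1) ^ n" "(-1 :: complex) powi (- int n) = (-1) ^ n"
  by (simp_all add: power_int_minus_one_minus)

lemma phi_series:
  "(\<lambda>i. (-1) ^ Suc i * Q ^ (Suc i * Suc i)) summable_on UNIV"
  "theta (Q ^ 2) Q = 1 + 2 * (\<Sum>\<^sub>\<infinity>i. (-1) ^ Suc i * Q ^ (Suc i * Suc i))"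
proof -
  interpret Q2: nome "Q ^ 2" by (rule nome_power) simp
  let ?f = "\<lambda>n. qt (Q ^ 2) n * Q powi n"
  have f: "?f n = (-1) powi n * Q powi (n * n)" for n using qt_sq[of n 1] by simp
  have s: "?f summable_on UNIV" by (rule Q2.theta_summable) simp
  have p: "?f (int (Suc k)) + ?f (- int (Suc k)) = 2 * ((-1) ^ Suc k * Q ^ (Suc k * Suc k))" for k
  proof -
    have "int (Suc k) * int (Suc k) = int (Suc k * Suc k)" by (simp only: of_nat_mult)
    thus ?thesis unfolding f minus_one_powi minus_mult_minus by (simp only: power_int_of_nat mult_2)
  qed
  have "(\<lambda>k. 1/2 * (2 * ((-1) ^ Suc k * Q ^ (Suc k * Suc k)))) summable_on UNIV"
    using infsum_int_sym(1)[OF s] unfolding p by (rule summable_on_cmult_right)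
  thus "(\<lambda>i. (-1) ^ Suc i * Q ^ (Suc i * Suc i)) summable_on UNIV" by simp
  show "theta (Q ^ 2) Q = 1 + 2 * (\<Sum>\<^sub>\<infinity>i. (-1) ^ Suc i * Q ^ (Suc i * Suc i))"
    unfolding theta_def infsum_int_sym(2)[OF s] p infsum_cmult_right' by simp
qed

text \<open>With \<open>x = Q ^ Suc i\<close>, split \<open>(1 - x) ^ 2\<close> as
  \<open>(1 - z * x) * (1 - x / z) - x * (1 - z) * (1 - 1 / z)\<close>. The first part sums to the
  series of \<open>theta (Q ^ 2) Q\<close>, and \<open>phi_P_over\<close> absorbs it together with
  the leading 1.\<close>

lemma rank_gf_appell:
  assumes z: "norm z = 1"
  defines "t \<equiv> \<lambda>i. (-1) ^ Suc i * Q ^ (Suc i * Suc i + Suc i) / ((1 - z * Q ^ Suc i) * (1 - Q ^ Suc i / z))"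
  shows "t summable_on UNIV"
    and "rank_gf z Q = P_over * (1 + 2 * (1 - z) * (1 - 1 / z) * (\<Sum>\<^sub>\<infinity>i. t i))"
proof -
  let ?T = "\<lambda>i. (-1) ^ i * Q ^ (Suc i * Suc i) * (1 - Q ^ Suc i) ^ 2 / ((1 - z * Q ^ Suc i) * (1 - Q ^ Suc i / z))"
  have z0: "z \<noteq> 0" using z by auto
  have w: "norm (1 / z) = 1" using z by (simp add: norm_divide)
  have nz: "1 - z * Q ^ Suc i \<noteq> 0" "1 - Q ^ Suc i / z \<noteq> 0" for i
    using q_ne[of z i] q_ne[of "1 / z" i] z w by (auto simp: mult.commute)
  show st: "t summable_on UNIV"
  proof -
    have lim: "(\<lambda>i. 1 / ((1 - z * Q ^ Suc i) * (1 - Q ^ Suc i / z))) \<longlonglongrightarrow> 1 / ((1 - z * 0) * (1 - 0 / z))"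
      using z0 by (intro tendsto_divide tendsto_mult tendsto_diff tendsto_const LIMSEQ_Suc[OF q_pow_tendsto]) auto
    obtain C where C: "C > 0" "\<And>i. norm (1 / ((1 - z * Q ^ Suc i) * (1 - Q ^ Suc i / z))) \<le> C"
      using convergent_bounded[OF lim] by blast
    have "norm (t i) \<le> C * norm Q ^ i" for i
    proof -
      have "norm Q ^ (Suc i * Suc i + Suc i) \<le> norm Q ^ i" using lt1 by (intro power_decreasing) auto
      hence "norm Q ^ (Suc i * Suc i + Suc i) * norm (1 / ((1 - z * Q ^ Suc i) * (1 - Q ^ Suc i / z))) \<le> norm Q ^ i * C"
        using C by (intro mult_mono) auto
      thus ?thesis by (simp add: t_def norm_mult norm_power norm_divide mult_ac)
    qed
    thus ?thesis by (rule geom_bounded_summable(2))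
  qed
  have T: "?T i = - ((-1) ^ Suc i * Q ^ (Suc i * Suc i)) + (1 - z) * (1 - 1 / z) * t i" for i
  proof -
    define x where "x = Q ^ Suc i"
    have "(1 - x) ^ 2 = (1 - z * x) * (1 - x / z) - x * ((1 - z) * (1 - 1 / z))"
      using z0 by (simp add: field_simps power2_eq_square)
    hence "?T i = (-1) ^ i * Q ^ (Suc i * Suc i) * ((1 - z * x) * (1 - x / z) - x * ((1 - z) * (1 - 1 / z))) / ((1 - z * x) * (1 - x / z))"
      unfolding x_def[symmetric] by simp
    also have "\<dots> = (-1) ^ i * Q ^ (Suc i * Suc i) - (-1) ^ i * (Q ^ (Suc i * Suc i) * x) * ((1 - z) * (1 - 1 / z)) / ((1 - z * x) * (1 - x / z))"
    proof -
      have "c * E * (A - y * D) / A = c * E - c * (E * y) * D / A" if "A \<noteq> 0" for A D E c y :: complex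
        using that by (simp add: field_simps)
      thus ?thesis using nz[of i] unfolding x_def[symmetric] by simp
    qed
    finally show ?thesis unfolding t_def x_def[symmetric] power_add by (simp add: mult_ac)
  qed
  have "(\<Sum>\<^sub>\<infinity>i. ?T i) = - (\<Sum>\<^sub>\<infinity>i. (-1) ^ Suc i * Q ^ (Suc i * Suc i)) + (1 - z) * (1 - 1 / z) * (\<Sum>\<^sub>\<infinity>i. t i)"
    unfolding T using phi_series(1) st
    by (subst infsum_add) (simp_all add: summable_on_uminus summable_on_cmult_right infsum_uminus infsum_cmult_right' del: power_Suc)
  hence "rank_gf z Q = 1 + 2 * P_over * (- (\<Sum>\<^sub>\<infinity>i. (-1) ^ Suc i * Q ^ (Suc i * Suc i)) + (1 - z) * (1 - 1 / z) * (\<Sum>\<^sub>\<infinity>i. t i))"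
    unfolding rank_gf_lambert(2)[OF z] by (simp only:)
  moreover have "1 + 2 * P_over * (- A + (1 - z) * (1 - 1 / z) * B) = P_over * (1 + 2 * (1 - z) * (1 - 1 / z) * B)"
    if "theta (Q ^ 2) Q = 1 + 2 * A" for A B
  proof -
    have "P_over * (1 + 2 * A) = 1" using phi_P_over that by simp
    hence "1 + 2 * P_over * (- A + c * B) = P_over * (1 + 2 * c * B)" for c by algebra
    from this[of "(1 - z) * (1 - 1 / z)"] show ?thesis by (simp only: mult.assoc)
  qed
  ultimately show "rank_gf z Q = P_over * (1 + 2 * (1 - z) * (1 - 1 / z) * (\<Sum>\<^sub>\<infinity>i. t i))"
    using phi_series(2) by (simp only:)
qed

lemma rank_gf_1: "rank_gf 1 Q = 1 / theta (Q ^ 2) Q"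
proof -
  have "theta (Q ^ 2) Q \<noteq> 0" using phi_P_over by auto
  thus ?thesis using rank_gf_appell(2)[of 1] phi_P_over by (simp add: eq_divide_eq)
qed

lemma rank_gf_inverse: assumes "norm z = 1" shows "rank_gf (1 / z) Q = rank_gf z Q"
proof -
  have "norm (1 / z) = 1" "z \<noteq> 0" using assms by (auto simp: norm_divide)
  have "1 / (1 / z) = z" by simp
  hence c: "2 * (1 - 1 / z) * (1 - 1 / (1 / z)) = 2 * (1 - z) * (1 - 1 / z)"
    by (simp only: mult.assoc mult.commute[of "1 - 1 / z"])
  have e: "(1 - 1 / z * x) * (1 - x / (1 / z)) = (1 - z * x) * (1 - x / z)" for x by (simp add: mult_ac)
  show ?thesis unfolding rank_gf_appell(2)[OF \<open>norm (1 / z) = 1\<close>] rank_gf_appell(2)[OF assms] c e ..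
qed

text \<open>In terms of \<open>x = Q ^ k\<close>, the primitive cube roots of unity \<open>w\<close> and sixth roots
  \<open>- w\<^sup>2\<close> give the denominators \<open>1 + x + x\<^sup>2\<close> and \<open>1 - x + x\<^sup>2\<close>, whose product only depends
  on \<open>x\<^sup>2\<close>. This turns the sum and the difference below into Appell sums with base \<open>Q\<^sup>2\<close>.\<close>

context
  fixes w :: complex
  assumes w: "1 + w + w ^ 2 = 0"
begin

lemma w3: "w ^ 3 = 1" using w by algebra
lemma w_nz: "w \<noteq> 0" using w by auto
lemma w_ne_1: "w \<noteq> 1" using w by auto
lemma w_norm: "norm w = 1"
proof -
  have "norm w ^ 3 = 1" using w3 by (metis norm_power norm_one)
  thus ?thesis using power_eq_imp_eq_base[of "norm w" 3 1] by simp
qed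
lemma w_inv: "1 / w = w ^ 2" using w3 w_nz by (simp add: field_simps power3_eq_cube power2_eq_square)

text \<open>The denominator is \<open>(1 + x + x ^ 2) * (1 - x + x ^ 2)\<close> with
  \<open>x = Q ^ Suc i\<close>, common to cube and sixth roots; \<open>m\<close> is the power of
  \<open>x\<close> in the numerator.\<close>

definition Lsum :: "nat \<Rightarrow> complex" where
  "Lsum m = (\<Sum>\<^sub>\<infinity>i. (-1) ^ Suc i * Q ^ (Suc i * Suc i + m * Suc i) / (1 + Q ^ (2 * Suc i) + Q ^ (4 * Suc i)))"

lemma Lsum_denom: "1 + Q ^ (2 * Suc i) + Q ^ (4 * Suc i) \<noteq> 0"
proof
  define X where "X = Q ^ (2 * Suc i)"
  have "4 * Suc i = 2 * Suc i * 2" by simp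
  hence X2: "Q ^ (4 * Suc i) = X ^ 2" by (simp only: X_def power_mult)
  assume "1 + Q ^ (2 * Suc i) + Q ^ (4 * Suc i) = 0"
  hence "1 + X + X ^ 2 = 0" unfolding X2 X_def .
  hence "1 - X ^ 3 = 0" by algebra
  moreover have "X ^ 3 = Q * Q ^ (6 * i + 5)" by (simp only: X_def flip: power_mult power_Suc) (simp add: algebra_simps)
  ultimately show False using one_minus_Q_nz by metis
qed

lemma Lsum_summable:
  "(\<lambda>i. (-1) ^ Suc i * Q ^ (Suc i * Suc i + m * Suc i) / (1 + Q ^ (2 * Suc i) + Q ^ (4 * Suc i))) summable_on UNIV"
proof -
  have "(\<lambda>i. 1 / (1 + (Q ^ Suc i) ^ 2 + (Q ^ Suc i) ^ 4)) \<longlonglongrightarrow> 1 / (1 + 0 ^ 2 + 0 ^ 4)"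
    by (intro tendsto_divide tendsto_add tendsto_power tendsto_const LIMSEQ_Suc[OF q_pow_tendsto]) auto
  hence lim: "(\<lambda>i. 1 / (1 + Q ^ (2 * Suc i) + Q ^ (4 * Suc i))) \<longlonglongrightarrow> 1 / (1 + 0 ^ 2 + 0 ^ 4)"
    by (simp only: power_mult[symmetric] mult.commute)
  obtain C where C: "C > 0" "\<And>i. norm (1 / (1 + Q ^ (2 * Suc i) + Q ^ (4 * Suc i))) \<le> C"
    using convergent_bounded[OF lim] by blast
  have "norm ((-1) ^ Suc i * Q ^ (Suc i * Suc i + m * Suc i) / (1 + Q ^ (2 * Suc i) + Q ^ (4 * Suc i))) \<le> C * norm Q ^ i" for i
  proof -
    have "norm Q ^ (Suc i * Suc i + m * Suc i) \<le> norm Q ^ i" using lt1 by (intro power_decreasing) auto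
    hence "norm Q ^ (Suc i * Suc i + m * Suc i) * norm (1 / (1 + Q ^ (2 * Suc i) + Q ^ (4 * Suc i))) \<le> norm Q ^ i * C"
      using C by (intro mult_mono) auto
    thus ?thesis by (simp add: norm_mult norm_power norm_divide mult_ac)
  qed
  thus ?thesis by (rule geom_bounded_summable(2))
qed

text \<open>Over the common denominator the numerators differ only in the sign of
  \<open>x ^ 2\<close>. As the outer constants are 6 and 2, three times the sixth root value plus or
  minus the cube root value isolates \<open>Lsum 1 + Lsum 3\<close> or
  \<open>Lsum 2\<close>.\<close>

lemma rank_gf_w: "rank_gf w Q = P_over * (1 + 6 * (Lsum 1 - Lsum 2 + Lsum 3))"
  and rank_gf_w6: "rank_gf (- (w ^ 2)) Q = P_over * (1 + 2 * (Lsum 1 + Lsum 2 + Lsum 3))"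
proof -
  let ?l = "\<lambda>m i. (-1) ^ Suc i * Q ^ (Suc i * Suc i + m * Suc i) / (1 + Q ^ (2 * Suc i) + Q ^ (4 * Suc i))"
  have den: "E / ((1 - w * x) * (1 - x / w)) = (E - E * x + E * x ^ 2) / (1 + x ^ 2 + x ^ 4)"
    "E / ((1 - (- (w ^ 2)) * x) * (1 - x / (- (w ^ 2)))) = (E + E * x + E * x ^ 2) / (1 + x ^ 2 + x ^ 4)"
    if "1 + x ^ 2 + x ^ 4 \<noteq> 0" for E x
  proof -
    have f: "1 + x ^ 2 + x ^ 4 = (1 + x + x ^ 2) * (1 - x + x ^ 2)" by algebra
    have 1: "(1 - w * x) * (1 - x / w) = 1 + x + x ^ 2"
    proof -
      have "x / w = w ^ 2 * x" using w_inv by (metis times_divide_eq_left mult_1)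
      thus ?thesis using w by (simp only:) algebra
    qed
    have 2: "(1 - (- (w ^ 2)) * x) * (1 - x / (- (w ^ 2))) = 1 - x + x ^ 2"
    proof -
      have "x / (- (w ^ 2)) = - (w * x)" using w3 w_nz by (simp add: field_simps power3_eq_cube power2_eq_square)
      thus ?thesis using w by (simp only:) algebra
    qed
    have nz: "1 + x + x ^ 2 \<noteq> 0" "1 - x + x ^ 2 \<noteq> 0" using that f by auto
    show "E / ((1 - w * x) * (1 - x / w)) = (E - E * x + E * x ^ 2) / (1 + x ^ 2 + x ^ 4)"
      "E / ((1 - (- (w ^ 2)) * x) * (1 - x / (- (w ^ 2)))) = (E + E * x + E * x ^ 2) / (1 + x ^ 2 + x ^ 4)"
      unfolding 1 2 f using nz by (simp_all add: divide_simps) (simp_all add: algebra_simps)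
  qed
  have x4: "(Q ^ Suc i) ^ 2 = Q ^ (2 * Suc i)" "(Q ^ Suc i) ^ 4 = Q ^ (4 * Suc i)" for i
    by (simp_all only: power_mult[symmetric] mult.commute)
  have l: "(-1) ^ Suc i * Q ^ (Suc i * Suc i + Suc i) * (Q ^ Suc i) ^ 2 = (-1) ^ Suc i * Q ^ (Suc i * Suc i + 3 * Suc i)"
    "(-1) ^ Suc i * Q ^ (Suc i * Suc i + Suc i) * Q ^ Suc i = (-1) ^ Suc i * Q ^ (Suc i * Suc i + 2 * Suc i)" for i
    unfolding mult.assoc power_mult[symmetric] power_add[symmetric]
    by (rule arg_cong[of _ _ "\<lambda>n. (-1) ^ Suc i * Q ^ n"], simp)+
  have nz: "1 + (Q ^ Suc i) ^ 2 + (Q ^ Suc i) ^ 4 \<noteq> 0" for i unfolding x4 by (rule Lsum_denom)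
  have t1: "(-1) ^ Suc i * Q ^ (Suc i * Suc i + Suc i) / ((1 - w * Q ^ Suc i) * (1 - Q ^ Suc i / w)) = ?l 1 i - ?l 2 i + ?l 3 i"
    and t2: "(-1) ^ Suc i * Q ^ (Suc i * Suc i + Suc i) / ((1 - (- (w ^ 2)) * Q ^ Suc i) * (1 - Q ^ Suc i / (- (w ^ 2)))) = ?l 1 i + ?l 2 i + ?l 3 i" for i
    unfolding den[OF nz] unfolding l unfolding x4 by (simp_all only: add_divide_distrib diff_divide_distrib mult_1)
  have s: "(\<Sum>\<^sub>\<infinity>i. ?l 1 i - ?l 2 i + ?l 3 i) = Lsum 1 - Lsum 2 + Lsum 3"
    "(\<Sum>\<^sub>\<infinity>i. ?l 1 i + ?l 2 i + ?l 3 i) = Lsum 1 + Lsum 2 + Lsum 3"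
  proof -
    have L: "(?l m has_sum Lsum m) UNIV" for m
      unfolding Lsum_def by (intro has_sum_infsum Lsum_summable)
    have "((\<lambda>i. - ?l 2 i) has_sum - Lsum 2) UNIV"
      unfolding has_sum_uminus minus_minus by (rule L)
    from has_sum_add[OF has_sum_add[OF L[of 1] this] L[of 3]]
    have "((\<lambda>i. ?l 1 i - ?l 2 i + ?l 3 i) has_sum (Lsum 1 - Lsum 2 + Lsum 3)) UNIV" by (simp only: diff_conv_add_uminus)
    thus "(\<Sum>\<^sub>\<infinity>i. ?l 1 i - ?l 2 i + ?l 3 i) = Lsum 1 - Lsum 2 + Lsum 3" by (rule infsumI)
    have "((\<lambda>i. ?l 1 i + ?l 2 i + ?l 3 i) has_sum (Lsum 1 + Lsum 2 + Lsum 3)) UNIV"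
      unfolding Lsum_def by (intro has_sum_add has_sum_infsum Lsum_summable)
    thus "(\<Sum>\<^sub>\<infinity>i. ?l 1 i + ?l 2 i + ?l 3 i) = Lsum 1 + Lsum 2 + Lsum 3" by (rule infsumI)
  qed
  have n6: "norm (- (w ^ 2)) = 1" by (simp add: norm_power w_norm)
  have c: "2 * (1 - w) * (1 - 1 / w) = 6" "2 * (1 - (- (w ^ 2))) * (1 - 1 / (- (w ^ 2))) = 2"
  proof -
    show "2 * (1 - w) * (1 - 1 / w) = 6" unfolding w_inv using w by algebra
    have "1 / (- (w ^ 2)) = - w" using w3 w_nz by (simp add: field_simps power3_eq_cube power2_eq_square)
    thus "2 * (1 - (- (w ^ 2))) * (1 - 1 / (- (w ^ 2))) = 2" using w by (simp only:) algebra
  qed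
  show "rank_gf w Q = P_over * (1 + 6 * (Lsum 1 - Lsum 2 + Lsum 3))"
    unfolding rank_gf_appell(2)[OF w_norm] t1 c s ..
  show "rank_gf (- (w ^ 2)) Q = P_over * (1 + 2 * (Lsum 1 + Lsum 2 + Lsum 3))"
    unfolding rank_gf_appell(2)[OF n6] t2 c s ..
qed

text \<open>The two products at \<open>w\<close> and at its conjugate \<open>w ^ 2\<close> join
  \<open>J 2\<close> in the cubic product formula.\<close>

lemma theta_w: "theta (Q ^ 2) w = (1 - w) * J 6" "theta (Q ^ 2) (w ^ 2) = (1 - w ^ 2) * J 6"
proof -
  interpret Q2: nome "Q ^ 2" by (rule nome_power) simp
  have "1 / w ^ 2 = w" using w3 w_nz by (simp add: field_simps power3_eq_cube power2_eq_square)
  hence i: "Q ^ 2 / w = w ^ 2 * Q ^ 2" "Q ^ 2 / w ^ 2 = w * Q ^ 2"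
    using w_inv by (metis mult.commute times_divide_eq_right mult_1_right)+
  have c: "qpoch_inf (Q ^ 2) (Q ^ 2) * qpoch_inf (w * Q ^ 2) (Q ^ 2) * qpoch_inf (w ^ 2 * Q ^ 2) (Q ^ 2) = J 6"
    using Q2.qpoch_inf_cubic[OF w, of "Q ^ 2"] by (simp add: J_def flip: power_mult)
  show "theta (Q ^ 2) w = (1 - w) * J 6"
    using w_nz by (simp add: Q2.jacobi_triple jtheta_def Q2.qpoch_inf_Suc[of w] i c[symmetric] mult_ac)
  show "theta (Q ^ 2) (w ^ 2) = (1 - w ^ 2) * J 6"
    using w_nz by (simp add: Q2.jacobi_triple jtheta_def Q2.qpoch_inf_Suc[of "w ^ 2"] i c[symmetric] mult_ac)
qed

lemma not_Q_powi: "norm u = 1 \<Longrightarrow> u \<noteq> 1 \<Longrightarrow> u \<noteq> (Q ^ 2) powi m"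
proof
  interpret R: nome "complex_of_real (norm Q)" using lt1 by unfold_locales auto
  assume u: "norm u = 1" "u \<noteq> 1" "u = (Q ^ 2) powi m"
  have "norm ((Q ^ 2) powi m) = norm Q powi (2 * m)" by (simp add: norm_power_int power_int_power norm_power)
  hence "complex_of_real (norm Q) powi (2 * m) = 1" using u by (simp flip: of_real_power_int)
  hence "m = 0" using R.Q_powi_eq_1 by fastforce
  thus False using u by simp
qed

lemma appell_w_split:
  fixes m :: nat
  assumes "m > 0"
  defines "e \<equiv> (\<lambda>n. qt (Q ^ 2) n * (Q ^ m) powi n / (1 - w * (Q ^ 2) powi n))"
  shows "appell (Q ^ 2) w (Q ^ m) = 1 / (1 - w) + (\<Sum>\<^sub>\<infinity>k. e (int (Suc k)) + e (- int (Suc k)))"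
    and "m \<le> 3 \<Longrightarrow> e (int (Suc k)) + e (- int (Suc k)) = (-1) ^ Suc k * Q ^ (Suc k * Suc k) *
       ((1 - w ^ 2 * Q ^ (2 * Suc k)) * Q ^ (m * Suc k) - w ^ 2 * (1 - w * Q ^ (2 * Suc k)) * Q ^ ((4 - m) * Suc k)) / (Q ^ Suc k * (1 + Q ^ (2 * Suc k) + Q ^ (4 * Suc k)))"
proof -
  interpret Q2: nome "Q ^ 2" by (rule nome_power) simp
  have "e summable_on UNIV" unfolding e_def using w_nz by (intro Q2.appell_summable) auto
  thus "appell (Q ^ 2) w (Q ^ m) = 1 / (1 - w) + (\<Sum>\<^sub>\<infinity>k. e (int (Suc k)) + e (- int (Suc k)))"
    unfolding appell_def using infsum_int_sym(2) by (simp add: e_def)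
  assume m: "m \<le> 3"
  define x X where "x = Q ^ Suc k" and "X = Q ^ (2 * Suc k)"
  have "4 * Suc k = 2 * Suc k * 2" by simp
  hence xX: "x \<noteq> 0" "X = x ^ 2" "X ^ 2 = Q ^ (4 * Suc k)" "X \<noteq> 0"
    unfolding x_def X_def by (simp, simp only: power_mult[symmetric] mult.commute, simp only: power_mult, simp)
  have X: "(Q ^ 2) powi int (Suc k) = X" "(Q ^ 2) powi (- int (Suc k)) = 1 / X"
    unfolding X_def power_int_minus_divide power_int_of_nat power_mult by simp_all
  have y: "(Q ^ m) powi (- int (Suc k)) = 1 / Q ^ (m * Suc k)" "(Q ^ m) powi (int (Suc k)) = Q ^ (m * Suc k)"
    unfolding power_int_minus_divide power_int_of_nat power_mult by simp_all
  have t: "qt (Q ^ 2) (int (Suc k)) = (-1) ^ Suc k * Q ^ (Suc k * Suc k) / x"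
    "qt (Q ^ 2) (- int (Suc k)) = (-1) ^ Suc k * Q ^ (Suc k * Suc k) * x"
  proof -
    have a: "int (Suc k) * int (Suc k) - int (Suc k) + int 0 * int (Suc k) = int (Suc k * Suc k) - int (Suc k)"
      "- int (Suc k) * - int (Suc k) - - int (Suc k) + int 0 * - int (Suc k) = int (Suc k * Suc k) + int (Suc k)" by (simp_all add: algebra_simps)
    have "qt (Q ^ 2) (int (Suc k)) = (-1) ^ Suc k * Q powi (int (Suc k * Suc k) - int (Suc k))"
      using qt_sq[of "int (Suc k)" 0] unfolding a minus_one_powi by simp
    thus "qt (Q ^ 2) (int (Suc k)) = (-1) ^ Suc k * Q ^ (Suc k * Suc k) / x"
      unfolding x_def by (simp only: power_int_diff nz simp_thms power_int_of_nat times_divide_eq_right)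
    have "qt (Q ^ 2) (- int (Suc k)) = (-1) ^ Suc k * Q powi (int (Suc k * Suc k) + int (Suc k))"
      using qt_sq[of "- int (Suc k)" 0] unfolding a minus_one_powi by simp
    thus "qt (Q ^ 2) (- int (Suc k)) = (-1) ^ Suc k * Q ^ (Suc k * Suc k) * x"
      unfolding x_def by (simp only: power_int_add nz simp_thms power_int_of_nat mult.assoc)
  qed
  \<comment> \<open>Reflecting \<open>k\<close> to \<open>- k\<close> turns the power
    \<open>m\<close> into \<open>4 - m\<close>; the bound on \<open>m\<close> makes the natural
    subtraction exact.\<close>
  have m4: "x * (X * (1 / Q ^ (m * Suc k))) = Q ^ ((4 - m) * Suc k) / x"
  proof -
    have "Q ^ ((4 - m) * Suc k) * Q ^ (m * Suc k) = Q ^ (4 * Suc k)"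
      unfolding power_add[symmetric] distrib_right[symmetric] using m by simp
    hence "Q ^ ((4 - m) * Suc k) * Q ^ (m * Suc k) = x * x * X" unfolding xX(3)[symmetric] by (simp add: xX(2) power2_eq_square)
    thus ?thesis using xX(1) by (simp add: field_simps)
  qed
  define Y c where "Y = Q ^ (m * Suc k)" and "c = (-1) ^ Suc k * Q ^ (Suc k * Suc k)"
  have nz: "1 + X + X ^ 2 \<noteq> 0" using Lsum_denom[of k] unfolding xX(3)[symmetric] X_def[symmetric] .
  have f: "(1 - w * X) * (1 - w ^ 2 * X) = 1 + X + X ^ 2" using w by algebra
  have nzs: "1 - w * X \<noteq> 0" "1 - w ^ 2 * X \<noteq> 0" using nz f by auto
  have inv: "1 / (1 - w * (1 / X)) = - (w ^ 2 * X) / (1 - w ^ 2 * X)"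
  proof -
    have "(1 - w * (1 / X)) * (- (w ^ 2 * X)) = 1 - w ^ 2 * X"
      using xX(4) w3 by (simp add: algebra_simps power3_eq_cube power2_eq_square)
    thus ?thesis using nzs by (metis (no_types, lifting) divide_eq_eq mult_eq_0_iff nonzero_eq_divide_eq divide_inverse_commute inverse_eq_divide mult.commute)
  qed
  have "e (int (Suc k)) + e (- int (Suc k)) = c / x * Y * (1 / (1 - w * X)) + c * x * (1 / Y) * (1 / (1 - w * (1 / X)))"
    unfolding e_def t X y c_def Y_def by simp
  also have "c * x * (1 / Y) * (1 / (1 - w * (1 / X))) = - (c * w ^ 2 * (x * (X * (1 / Y))) / (1 - w ^ 2 * X))"
    unfolding inv by (simp add: mult_ac)
  also have "x * (X * (1 / Y)) = Q ^ ((4 - m) * Suc k) / x" unfolding Y_def by (rule m4)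
  also have "c / x * Y * (1 / (1 - w * X)) + - (c * w ^ 2 * (Q ^ ((4 - m) * Suc k) / x) / (1 - w ^ 2 * X)) =
      c * ((1 - w ^ 2 * X) * Y - w ^ 2 * (1 - w * X) * Q ^ ((4 - m) * Suc k)) / (x * ((1 - w * X) * (1 - w ^ 2 * X)))"
    using nzs xX(1) by (simp add: divide_simps) (simp add: algebra_simps)
  finally show "e (int (Suc k)) + e (- int (Suc k)) = (-1) ^ Suc k * Q ^ (Suc k * Suc k) *
       ((1 - w ^ 2 * Q ^ (2 * Suc k)) * Q ^ (m * Suc k) - w ^ 2 * (1 - w * Q ^ (2 * Suc k)) * Q ^ ((4 - m) * Suc k)) / (Q ^ Suc k * (1 + Q ^ (2 * Suc k) + Q ^ (4 * Suc k)))"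
    unfolding f xX(3) by (simp only: c_def Y_def x_def X_def)
qed

end

section \<open>The sum and the difference at cube and sixth roots\<close>

lemma psi_product: "theta Q (-1) = 2 * (J 2 ^ 2 / J 1)"
proof -
  have "theta Q (-1) = 2 * qpoch_inf (- Q) Q * qpoch_inf (- Q) Q * qpoch_inf Q Q"
    using qpoch_inf_Suc[of "-1"] by (simp add: jacobi_triple jtheta_def)
  moreover have "qpoch_inf (- Q) Q = J 2 / J 1"
    using qpoch_inf_minus_Q J_nz[of 1] by (simp add: J_def field_simps)
  ultimately show ?thesis using J_nz[of 1] by (simp add: J_def power2_eq_square)
qed

context
  fixes w :: complex
  assumes w: "1 + w + w ^ 2 = 0"
begin

text \<open>The pairs \<open>k\<close> and \<open>- k\<close> of the Appell sum at
  \<open>y = Q ^ 2\<close> are proportional to the terms of \<open>Lsum 1 + Lsum 3\<close>. Since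
  \<open>y\<close> is then the nome, \<open>theta_appell_Q\<close> evaluates the sum.\<close>

lemma Lsum_1_3: "1 + 3 * (Lsum 1 + Lsum 3) = J 2 ^ 3 / J 6"
proof -
  interpret Q2: nome "Q ^ 2" by (rule nome_power) simp
  let ?l = "\<lambda>m i. (-1) ^ Suc i * Q ^ (Suc i * Suc i + m * Suc i) / (1 + Q ^ (2 * Suc i) + Q ^ (4 * Suc i))"
  let ?e = "\<lambda>n. qt (Q ^ 2) n * (Q ^ 2) powi n / (1 - w * (Q ^ 2) powi n)"
  have e: "?e (int (Suc k)) + ?e (- int (Suc k)) = (1 - w ^ 2) * (?l 1 k + ?l 3 k)" for k
  proof -
    define x where "x = Q ^ Suc k"
    have x: "Q ^ (2 * Suc k) = x ^ 2" "Q ^ (1 * Suc k) = x" "Q ^ (3 * Suc k) = x ^ 3"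
      by (simp_all only: x_def power_mult[symmetric] mult.commute mult_1_left)
    have "?e (int (Suc k)) + ?e (- int (Suc k)) = (-1) ^ Suc k * Q ^ (Suc k * Suc k) *
       ((1 - w ^ 2 * x ^ 2) * x ^ 2 - w ^ 2 * (1 - w * x ^ 2) * x ^ 2) / (x * (1 + x ^ 2 + Q ^ (4 * Suc k)))"
    proof -
      have "?e (int (Suc k)) + ?e (- int (Suc k)) = (-1) ^ Suc k * Q ^ (Suc k * Suc k) *
         ((1 - w ^ 2 * Q ^ (2 * Suc k)) * Q ^ (2 * Suc k) - w ^ 2 * (1 - w * Q ^ (2 * Suc k)) * Q ^ ((4 - 2) * Suc k)) / (Q ^ Suc k * (1 + Q ^ (2 * Suc k) + Q ^ (4 * Suc k)))"
        by (rule appell_w_split(2)[OF w]) simp_all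
      moreover have "(4 - 2) * Suc k = 2 * Suc k" by simp
      ultimately show ?thesis by (simp only: x x_def[symmetric])
    qed
    also have "(1 - w ^ 2 * x ^ 2) * x ^ 2 - w ^ 2 * (1 - w * x ^ 2) * x ^ 2 = x * ((1 - w ^ 2) * (x + x ^ 3))"
      using w by algebra
    also have "(-1) ^ Suc k * Q ^ (Suc k * Suc k) * (x * ((1 - w ^ 2) * (x + x ^ 3))) / (x * (1 + x ^ 2 + Q ^ (4 * Suc k))) =
        (1 - w ^ 2) * (?l 1 k + ?l 3 k)"
    proof -
      have gen: "c * (y * (u * (y + y'))) / (y * D) = u * (c * y / D + c * y' / D)" if "y \<noteq> 0" for c y y' u D :: complex
        using that by (simp add: add_divide_distrib distrib_left mult_ac)
      have "x \<noteq> 0" by (simp add: x_def)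
      from gen[OF this, of "(-1) ^ Suc k * Q ^ (Suc k * Suc k)" "1 - w ^ 2" "x ^ 3" "1 + x ^ 2 + Q ^ (4 * Suc k)"]
      show ?thesis unfolding power_add x by (simp only: mult.assoc)
    qed
    finally show ?thesis .
  qed
  have "appell (Q ^ 2) w (Q ^ 2) = 1 / (1 - w) + (1 - w ^ 2) * (\<Sum>\<^sub>\<infinity>k. ?l 1 k + ?l 3 k)"
    using appell_w_split(1)[OF w, of 2] unfolding e infsum_cmult_right' by (simp only: zero_less_numeral simp_thms)
  also have "(\<Sum>\<^sub>\<infinity>k. ?l 1 k + ?l 3 k) = Lsum 1 + Lsum 3"
    unfolding Lsum_def[OF w] by (rule infsum_add; rule Lsum_summable[OF w])
  finally have A: "appell (Q ^ 2) w (Q ^ 2) = 1 / (1 - w) + (1 - w ^ 2) * (Lsum 1 + Lsum 3)" .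
  have w1: "1 - w \<noteq> 0" using w_ne_1[OF w] by simp
  have "(1 - w) * appell (Q ^ 2) w (Q ^ 2) = 1 + ((1 - w) * (1 - w ^ 2)) * (Lsum 1 + Lsum 3)"
    unfolding A using w1 by (simp add: distrib_left)
  also have "(1 - w) * (1 - w ^ 2) = 3" using w by algebra
  finally have B: "(1 - w) * appell (Q ^ 2) w (Q ^ 2) = 1 + 3 * (Lsum 1 + Lsum 3)" .
  have "theta (Q ^ 2) w * appell (Q ^ 2) w (Q ^ 2) = Q2.K"
    using not_Q_powi[OF w w_norm[OF w] w_ne_1[OF w]] w_nz[OF w] by (intro Q2.theta_appell_Q) auto
  moreover have "Q2.K = J 2 ^ 3" unfolding Q2.K_product J_def ..
  ultimately have "J 6 * ((1 - w) * appell (Q ^ 2) w (Q ^ 2)) = J 2 ^ 3"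
    unfolding theta_w(1)[OF w] by (simp add: mult_ac)
  thus ?thesis unfolding B using J_nz[of 6] by (simp add: field_simps)
qed

lemma rank_gf_sum: "3 * rank_gf (- (w ^ 2)) Q + rank_gf w Q = theta Q (-1) ^ 2 / J 6"
proof -
  have "3 * rank_gf (- (w ^ 2)) Q + rank_gf w Q = 4 * (P_over * (1 + 3 * (Lsum 1 + Lsum 3)))"
    unfolding rank_gf_w[OF w] rank_gf_w6[OF w] by (simp add: algebra_simps)
  also have "\<dots> = 4 * (J 2 / J 1 ^ 2 * (J 2 ^ 3 / J 6))" unfolding Lsum_1_3 P_over_J ..
  also have "\<dots> = theta Q (-1) ^ 2 / J 6"
    unfolding psi_product by (simp add: power_mult_distrib power_divide power2_eq_square power3_eq_cube)
  finally show ?thesis .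
qed

text \<open>At \<open>y = Q ^ 3\<close> the numerator of a pair is a multiple of
  \<open>x ^ 2\<close> minus a multiple of the denominator \<open>D\<close>; the latter part leaves
  the series of \<open>theta (Q ^ 2) Q\<close>.\<close>

lemma Lsum_2: "appell (Q ^ 2) w (Q ^ 3) = 1 / (1 - w) + (1 - w) * Lsum 2 - w ^ 2 * ((theta (Q ^ 2) Q - 1) / 2)"
proof -
  let ?l = "\<lambda>m i. (-1) ^ Suc i * Q ^ (Suc i * Suc i + m * Suc i) / (1 + Q ^ (2 * Suc i) + Q ^ (4 * Suc i))"
  let ?c = "\<lambda>i. (-1) ^ Suc i * Q ^ (Suc i * Suc i)"
  let ?e = "\<lambda>n. qt (Q ^ 2) n * (Q ^ 3) powi n / (1 - w * (Q ^ 2) powi n)"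
  have e: "?e (int (Suc k)) + ?e (- int (Suc k)) = (1 - w) * ?l 2 k + (- (w ^ 2)) * ?c k" for k
  proof -
    define x where "x = Q ^ Suc k"
    have "4 * Suc k = Suc k * 2 * 2" by simp
    hence x4: "Q ^ (4 * Suc k) = (x ^ 2) ^ 2" by (simp only: x_def power_mult)
    have "Q ^ (2 * Suc k) = x ^ 2" "Q ^ ((4 - 3) * Suc k) = x" "Q ^ (3 * Suc k) = x ^ 3"
      by (simp_all add: x_def power_mult[symmetric] mult.commute del: power_Suc)
    note x = this x4
    define D where "D = 1 + x ^ 2 + (x ^ 2) ^ 2"
    have D: "D \<noteq> 0" "x \<noteq> 0" using Lsum_denom[OF w, of k] unfolding x D_def by (auto simp: x_def)
    have "?e (int (Suc k)) + ?e (- int (Suc k)) = ?c k *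
       ((1 - w ^ 2 * x ^ 2) * x ^ 3 - w ^ 2 * (1 - w * x ^ 2) * x) / (x * D)"
      using appell_w_split(2)[OF w, of 3 k] unfolding x x_def[symmetric] D_def by simp
    also have "(1 - w ^ 2 * x ^ 2) * x ^ 3 - w ^ 2 * (1 - w * x ^ 2) * x = x * ((1 - w) * x ^ 2 - w ^ 2 * D)"
      unfolding D_def using w by algebra
    also have "?c k * (x * ((1 - w) * x ^ 2 - w ^ 2 * D)) / (x * D) = (1 - w) * (?c k * x ^ 2 / D) + (- (w ^ 2)) * ?c k"
    proof -
      have "c * (x * (a - b * D)) / (x * D) = c * a / D + (- b) * c" for a b c
        using D by (simp add: field_simps)
      from this[of "?c k" "(1 - w) * x ^ 2" "w ^ 2"] show ?thesis by (simp only: mult.left_commute times_divide_eq_right)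
    qed
    also have "?c k * x ^ 2 / D = ?l 2 k" unfolding power_add x D_def by (simp only: mult.assoc)
    finally show ?thesis .
  qed
  have "((\<lambda>k. (1 - w) * ?l 2 k + (- (w ^ 2)) * ?c k) has_sum ((1 - w) * Lsum 2 + (- (w ^ 2)) * infsum ?c UNIV)) UNIV"
    unfolding Lsum_def[OF w]
    by (intro has_sum_add has_sum_cmult_right has_sum_infsum Lsum_summable[OF w] phi_series(1))
  hence "appell (Q ^ 2) w (Q ^ 3) = 1 / (1 - w) + ((1 - w) * Lsum 2 + (- (w ^ 2)) * infsum ?c UNIV)"
    using appell_w_split(1)[OF w, of 3] unfolding e by (simp add: infsumI del: power_Suc)
  moreover have "infsum ?c UNIV = (theta (Q ^ 2) Q - 1) / 2" using phi_series(2) by simp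
  ultimately show ?thesis by simp
qed

text \<open>The symmetry of \<open>B\<close> trades the theta function of \<open>Q\<close> in the denominator of the Appell sum
  for \<open>theta (Q ^ 2) (w ^ 2)\<close>, a function of \<open>Q ^ 6\<close> that is inert under the trisection.\<close>

lemma rank_gf_diff: "3 * rank_gf (- (w ^ 2)) Q - rank_gf w Q =
    6 * w ^ 2 / (1 - w) - 4 * appell (Q ^ 2) (1 / Q ^ 3) (w ^ 2) / (Q * J 6)"
proof -
  interpret Q2: nome "Q ^ 2" by (rule nome_power) simp
  define A where "A = appell (Q ^ 2) (1 / Q ^ 3) (w ^ 2)"
  define F where "F = theta (Q ^ 2) Q"
  have w1: "1 - w \<noteq> 0" and w2: "1 - w ^ 2 \<noteq> 0"
    using w_ne_1[OF w] w by (auto, algebra)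
  have n2: "norm (w ^ 2) = 1" using w_norm[OF w] by (simp add: norm_power)
  have "1 / w ^ 2 = w" using w3[OF w] w_nz[OF w] by (simp add: field_simps power3_eq_cube power2_eq_square)
  hence B1: "theta (Q ^ 2) (w ^ 2) * appell (Q ^ 2) w (Q ^ 3) = Q2.B (w ^ 2) (Q ^ 3)"
    using Q2.B_theta_appell[of "w ^ 2" "Q ^ 3"] not_Q_powi[OF w n2] w2 w_nz[OF w] by auto
  have B2: "theta (Q ^ 2) (Q ^ 3) * A = Q2.B (Q ^ 3) (w ^ 2)"
    unfolding A_def
  proof (rule Q2.B_theta_appell)
    fix m
    show "Q ^ 3 \<noteq> (Q ^ 2) powi m"
    proof
      assume "Q ^ 3 = (Q ^ 2) powi m"
      hence "Q powi 3 = Q powi (2 * m)" by (simp add: power_int_power)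
      hence "Q powi (2 * m - 3) = 1" by (simp add: power_int_diff)
      hence "2 * m - 3 = 0" by (rule Q_powi_eq_1)
      thus False by presburger
    qed
  qed (use w_nz[OF w] in auto)
  have "theta (Q ^ 2) (Q ^ 3) = - F / Q"
    using Q2.theta_mult_Q[of Q] by (simp add: F_def power3_eq_cube power2_eq_square mult_ac)
  hence "(1 - w ^ 2) * J 6 * appell (Q ^ 2) w (Q ^ 3) = - F / Q * A"
    using B1 B2 Q2.bconv_sym unfolding theta_w(2)[OF w] by metis
  hence a: "appell (Q ^ 2) w (Q ^ 3) = - F / Q * A / ((1 - w ^ 2) * J 6)"
    using J_nz[of 6] w2 by (simp add: field_simps)
  have PF: "P_over * F = 1" unfolding F_def by (rule phi_P_over)
  have L: "(1 - w) ^ 2 * Lsum 2 = (1 - w) * (- F / Q * A / ((1 - w ^ 2) * J 6)) - 1 + (1 - w) * w ^ 2 * ((F - 1) / 2)"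
  proof -
    have "(1 - w) * (- F / Q * A / ((1 - w ^ 2) * J 6)) = (1 - w) * (1 / (1 - w) + (1 - w) * Lsum 2 - w ^ 2 * ((F - 1) / 2))"
      using Lsum_2 unfolding a F_def[symmetric] by simp
    also have "\<dots> = 1 + (1 - w) ^ 2 * Lsum 2 - (1 - w) * w ^ 2 * ((F - 1) / 2)"
      using w1 by (simp add: distrib_left right_diff_distrib[of "1 - w"] power2_eq_square mult.assoc)
    finally show ?thesis by simp
  qed
  have "3 * rank_gf (- (w ^ 2)) Q - rank_gf w Q = P_over * (2 + 12 * Lsum 2)"
    unfolding rank_gf_w[OF w] rank_gf_w6[OF w] by (simp add: algebra_simps)
  hence "(1 - w) ^ 2 * (3 * rank_gf (- (w ^ 2)) Q - rank_gf w Q) = P_over * (2 * (1 - w) ^ 2 + 12 * ((1 - w) ^ 2 * Lsum 2))"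
    by (simp add: algebra_simps)
  also have "2 * (1 - w) ^ 2 + 12 * ((1 - w) ^ 2 * Lsum 2) =
      12 * ((1 - w) * (- F / Q * A / ((1 - w ^ 2) * J 6))) + 6 * (1 - w) * w ^ 2 * F + (2 * (1 - w) ^ 2 - 12 - 6 * (1 - w) * w ^ 2)"
  proof -
    define T G where "T = (1 - w) * (- F / Q * A / ((1 - w ^ 2) * J 6))" and "G = (F - 1) / 2"
    have F: "F = 2 * G + 1" by (simp add: G_def field_simps)
    have "2 * (1 - w) ^ 2 + 12 * (T - 1 + (1 - w) * w ^ 2 * G) = 12 * T + 6 * (1 - w) * w ^ 2 * F + (2 * (1 - w) ^ 2 - 12 - 6 * (1 - w) * w ^ 2)"
      unfolding F by algebra
    thus ?thesis unfolding L T_def G_def .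
  qed
  \<comment> \<open>The terms without \<open>F\<close> must vanish: there \<open>P_over\<close>
    would not meet its reciprocal and would survive.\<close>
  also have "2 * (1 - w) ^ 2 - 12 - 6 * (1 - w) * w ^ 2 = 0" using w by algebra
  also have "P_over * (12 * ((1 - w) * (- F / Q * A / ((1 - w ^ 2) * J 6))) + 6 * (1 - w) * w ^ 2 * F + 0) =
     (P_over * F) * (6 * (1 - w) * w ^ 2 - 12 * (1 - w) * A / (Q * ((1 - w ^ 2) * J 6)))"
    by (simp add: algebra_simps)
  also have "\<dots> = 6 * (1 - w) * w ^ 2 - (1 - w) ^ 2 * (12 / ((1 - w) * (1 - w ^ 2))) * A / (Q * J 6)"
    unfolding PF using w1 w2 by (simp add: power2_eq_square mult_ac)
  also have "(1 - w) * (1 - w ^ 2) = 3" using w by algebra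
  also have "6 * (1 - w) * w ^ 2 - (1 - w) ^ 2 * (12 / 3) * A / (Q * J 6) = (1 - w) ^ 2 * (6 * w ^ 2 / (1 - w) - 4 * A / (Q * J 6))"
  proof -
    have "6 * y * v - y ^ 2 * (12 / 3) * A / D = y ^ 2 * (6 * v / y - 4 * A / D)" if "y \<noteq> 0" for y v D
      using that by (simp add: right_diff_distrib power2_eq_square)
    from this[OF w1] show ?thesis .
  qed
  finally show ?thesis using w1 unfolding A_def by simp
qed

end

section \<open>The mock theta functions\<close>

lemma qt6: "qt (Q ^ 6) n * (Q ^ m) powi n = (-1) powi n * Q powi (3 * (n * n) - 3 * n + int m * n)"
proof -
  have "int 6 * tri n = 3 * (n * n) - 3 * n" using two_tri[of n] by (simp add: algebra_simps)
  hence "(Q ^ 6) powi tri n = Q powi (3 * (n * n) - 3 * n)" unfolding power_int_power by (simp only:)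
  thus ?thesis by (simp add: qt_def power_int_power power_int_add)
qed

lemma Q_powi_odd: "1 - Q powi (3 * m + 1) \<noteq> 0" "1 - Q powi (3 * m + 2) \<noteq> 0" "1 - Q powi (2 * m + 1) \<noteq> 0"
  using Q_powi_eq_1[of "3 * m + 1"] Q_powi_eq_1[of "3 * m + 2"] Q_powi_eq_1[of "2 * m + 1"] by (auto, presburger+)

text \<open>For \<open>z ^ 3 = 1\<close>, the identity \<open>1 / (1 - z * x) = (1 + z * x + z ^ 2 * x ^ 2) / (1 - x ^ 3)\<close>
  expresses Watson's series through two Appell sums; \<open>z = 1\<close> gives \<open>\<omega>\<close> and \<open>z = w\<close> gives \<open>\<rho>\<close>.\<close>

definition U :: complex where "U = appell (Q ^ 6) (Q ^ 3) (Q ^ 6)"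
definition V :: complex where "V = Q * appell (Q ^ 6) (Q ^ 3) (Q ^ 8)"

text \<open>With \<open>xx\<close>, the data of Watson's series for the nome \<open>Q ^ 2\<close> at
  \<open>x = z * Q\<close>: its terms are \<open>cc n / (1 - z * xx n)\<close>.\<close>

definition cc :: "int \<Rightarrow> complex" where "cc n = qt (Q ^ 6) n * (Q ^ 6) powi n"
definition xx :: "int \<Rightarrow> complex" where "xx n = Q powi (2 * n + 1)"

lemma cc_altdef: "cc n = (-1) powi n * Q powi (3 * (n * n) + 3 * n)"
  unfolding cc_def qt6 by (rule arg_cong[of _ _ "\<lambda>k. (-1) powi n * Q powi k"]) simp

lemma cc_reflect: "cc (- 1 - n) = - cc n"
proof -
  have e1: "3 * ((- 1 - n) * (- 1 - n)) + 3 * (- 1 - n) = 3 * (n * n) + 3 * n" by (simp add: algebra_simps)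
  have e2: "(-1 :: complex) powi (- 1 - n) = - ((-1) powi n)" by (cases "even n") (auto simp: power_int_minus_left)
  show ?thesis unfolding cc_altdef e1 e2 by simp
qed

lemma xx_reflect: "xx (- 1 - n) = 1 / xx n"
proof -
  have "2 * (- 1 - n) + 1 = - (2 * n + 1)" by simp
  thus ?thesis unfolding xx_def by (simp only: power_int_minus_divide)
qed

lemma xx_nz: "xx n \<noteq> 0" "1 - xx n \<noteq> 0" "1 - xx n ^ 3 \<noteq> 0"
proof -
  show "xx n \<noteq> 0" by (simp add: xx_def)
  show "1 - xx n \<noteq> 0" unfolding xx_def by (rule Q_powi_odd)
  have "xx n ^ 3 = Q powi (2 * (3 * n + 1) + 1)" unfolding xx_def power_int_power' by (rule arg_cong[of _ _ "power_int Q"]) simp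
  thus "1 - xx n ^ 3 \<noteq> 0" by (simp only: Q_powi_odd simp_thms not_False_eq_True)
qed

lemma UV_terms: "qt (Q ^ 6) n * (Q ^ 6) powi n / (1 - Q ^ 3 * (Q ^ 6) powi n) = cc n / (1 - xx n ^ 3)"
  "Q * (qt (Q ^ 6) n * (Q ^ 8) powi n / (1 - Q ^ 3 * (Q ^ 6) powi n)) = cc n * xx n / (1 - xx n ^ 3)"
proof -
  have 1: "Q ^ 3 * (Q ^ 6) powi n = xx n ^ 3"
  proof -
    have "Q ^ 3 * (Q ^ 6) powi n = Q powi 3 * Q powi (6 * n)" by (simp add: power_int_power)
    also have "\<dots> = Q powi (3 * (2 * n + 1))" by (subst power_int_add[symmetric]) (auto simp: algebra_simps)
    finally show ?thesis unfolding xx_def power_int_power' by (simp add: mult.commute)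
  qed
  have 2: "Q * (qt (Q ^ 6) n * (Q ^ 8) powi n) = cc n * xx n"
  proof -
    have "(Q ^ 8) powi n = (Q ^ 6) powi n * Q powi (2 * n)"
      unfolding power_int_power by (subst power_int_add[symmetric]) (auto simp: algebra_simps)
    thus ?thesis by (simp add: cc_def xx_def power_int_add mult_ac)
  qed
  show "qt (Q ^ 6) n * (Q ^ 6) powi n / (1 - Q ^ 3 * (Q ^ 6) powi n) = cc n / (1 - xx n ^ 3)"
    unfolding 1 cc_def ..
  show "Q * (qt (Q ^ 6) n * (Q ^ 8) powi n / (1 - Q ^ 3 * (Q ^ 6) powi n)) = cc n * xx n / (1 - xx n ^ 3)"
    unfolding 1 times_divide_eq_right 2 ..
qed

lemma UV_has_sum:
  "((\<lambda>n. cc n / (1 - xx n ^ 3)) has_sum U) UNIV"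
  "((\<lambda>n. cc n * xx n / (1 - xx n ^ 3)) has_sum V) UNIV"
  "((\<lambda>n. cc n * xx n ^ 2 / (1 - xx n ^ 3)) has_sum V) UNIV"
proof -
  interpret Q6: nome "Q ^ 6" by (rule nome_power) simp
  show "((\<lambda>n. cc n / (1 - xx n ^ 3)) has_sum U) UNIV"
    unfolding U_def appell_def UV_terms[symmetric] by (intro has_sum_infsum Q6.appell_summable) auto
  show v: "((\<lambda>n. cc n * xx n / (1 - xx n ^ 3)) has_sum V) UNIV"
    unfolding V_def appell_def UV_terms[symmetric] by (intro has_sum_cmult_right has_sum_infsum Q6.appell_summable) auto
  \<comment> \<open>The reflection of \<open>n\<close> to \<open>- 1 - n\<close> negates
    \<open>cc\<close> and inverts \<open>xx\<close>, so the sums with \<open>xx\<close> and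
    \<open>xx ^ 2\<close> in the numerator agree. This is why two Appell sums suffice.\<close>
  have "((\<lambda>n. cc (- 1 - n) * xx (- 1 - n) / (1 - xx (- 1 - n) ^ 3)) has_sum V) UNIV"
    using v by (subst has_sum_reindex_bij_witness[of _ "\<lambda>n. - 1 - n" "\<lambda>n. - 1 - n"]) auto
  moreover have "cc (- 1 - n) * xx (- 1 - n) / (1 - xx (- 1 - n) ^ 3) = cc n * xx n ^ 2 / (1 - xx n ^ 3)" for n
  proof -
    have "- c * (1 / x) / (1 - (1 / x) ^ 3) = c * x ^ 2 / (1 - x ^ 3)" if "x \<noteq> 0" "1 - x ^ 3 \<noteq> 0" for c x :: complex
    proof -
      have "1 - (1 / x) ^ 3 = - ((1 - x ^ 3) / x ^ 3)" using that by (simp add: field_simps)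
      thus ?thesis using that by (simp add: power3_eq_cube power2_eq_square)
    qed
    thus ?thesis unfolding cc_reflect xx_reflect using xx_nz[of n] by blast
  qed
  ultimately show "((\<lambda>n. cc n * xx n ^ 2 / (1 - xx n ^ 3)) has_sum V) UNIV" by simp
qed

lemma watson_UV:
  assumes z: "z ^ 3 = 1"
  shows "J 2 * (\<Sum>n. (Q ^ 2) ^ (n * (n + 1)) / (qpoch (z * Q) (Q ^ 2) (n + 1) * qpoch (Q ^ 2 / (z * Q)) (Q ^ 2) (n + 1)))
     = U + (z + z ^ 2) * V"
    and "(\<Sum>\<^sub>\<infinity>n. cc n / (1 - z * xx n)) = U + (z + z ^ 2) * V"
    and "(\<lambda>n. cc n / (1 - z * xx n)) summable_on UNIV"
proof -
  interpret Q2: nome "Q ^ 2" by (rule nome_power) simp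
  have z0: "z \<noteq> 0" using z by auto
  have n: "z * Q \<noteq> (Q ^ 2) powi m" for m
  proof
    assume "z * Q = (Q ^ 2) powi m"
    hence "(z * Q) ^ 3 = ((Q ^ 2) powi m) ^ 3" by simp
    hence "Q powi 3 = Q powi (6 * m)" using z by (simp add: power_mult_distrib power_int_power power_int_power' mult_ac)
    hence "Q powi (6 * m - 3) = 1" by (simp add: power_int_diff)
    hence "6 * m - 3 = 0" by (rule Q_powi_eq_1)
    thus False by presburger
  qed
  have Q6: "(Q ^ 2) ^ 3 = Q ^ 6" by (simp flip: power_mult)
  have t: "qt ((Q ^ 2) ^ 3) n * ((Q ^ 2) ^ 3) powi n / (1 - z * Q * (Q ^ 2) powi n) = cc n / (1 - z * xx n)" for n
  proof -
    have "Q * (Q ^ 2) powi n = xx n" by (simp add: xx_def power_int_power power_int_add)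
    thus ?thesis unfolding Q6 cc_def by (simp add: mult.assoc)
  qed
  have "((\<lambda>n. cc n / (1 - xx n ^ 3) + z * (cc n * xx n / (1 - xx n ^ 3)) + z ^ 2 * (cc n * xx n ^ 2 / (1 - xx n ^ 3)))
     has_sum (U + z * V + z ^ 2 * V)) UNIV"
    by (intro has_sum_add has_sum_cmult_right UV_has_sum)
  moreover have "cc n / (1 - xx n ^ 3) + z * (cc n * xx n / (1 - xx n ^ 3)) + z ^ 2 * (cc n * xx n ^ 2 / (1 - xx n ^ 3)) = cc n / (1 - z * xx n)" for n
  proof -
    define x where "x = xx n"
    have x: "1 - x ^ 3 \<noteq> 0" using xx_nz unfolding x_def by blast
    have f: "1 - x ^ 3 = (1 - z * x) * (1 + z * x + z ^ 2 * x ^ 2)" using z by algebra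
    have nz: "1 - z * x \<noteq> 0" "1 + z * x + z ^ 2 * x ^ 2 \<noteq> 0" using x f by auto
    have "c / E + z * (c * x / E) + z ^ 2 * (c * x ^ 2 / E) = c * (1 + z * x + z ^ 2 * x ^ 2) / E" for c E
      by (simp add: distrib_left add_divide_distrib mult_ac)
    thus ?thesis unfolding x_def[symmetric] f using nz by simp
  qed
  ultimately have h: "((\<lambda>n. cc n / (1 - z * xx n)) has_sum (U + (z + z ^ 2) * V)) UNIV" by (simp add: algebra_simps)
  show "(\<Sum>\<^sub>\<infinity>n. cc n / (1 - z * xx n)) = U + (z + z ^ 2) * V" by (rule infsumI[OF h])
  show "(\<lambda>n. cc n / (1 - z * xx n)) summable_on UNIV" by (rule has_sum_imp_summable[OF h])
  show "J 2 * (\<Sum>n. (Q ^ 2) ^ (n * (n + 1)) / (qpoch (z * Q) (Q ^ 2) (n + 1) * qpoch (Q ^ 2 / (z * Q)) (Q ^ 2) (n + 1)))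
     = U + (z + z ^ 2) * V"
    using Q2.watson[of "z * Q"] n z0 infsumI[OF h] unfolding t J_def by simp
qed

lemma omega_UV: "J 2 * mock_omega Q = U + 2 * V"
proof -
  have "mock_omega Q = (\<Sum>n. (Q ^ 2) ^ (n * (n + 1)) / (qpoch (1 * Q) (Q ^ 2) (n + 1) * qpoch (Q ^ 2 / (1 * Q)) (Q ^ 2) (n + 1)))"
  proof -
    have "Q ^ 2 / (1 * Q) = Q" by (simp add: power2_eq_square)
    thus ?thesis unfolding mock_omega_def power_mult[symmetric] by (simp add: power2_eq_square[of "qpoch _ _ _"] mult.assoc)
  qed
  thus ?thesis using watson_UV(1)[of 1] by simp
qed

text \<open>The cubic product turns the quotient in \<open>mock_rho\<close> into the two conjugate
  products at \<open>w * Q\<close> and \<open>w ^ 2 * Q\<close>, which is Watson's series at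
  \<open>z = w\<close>.\<close>

lemma rho_UV:
  fixes w :: complex
  assumes w: "1 + w + w ^ 2 = 0"
  shows "J 2 * mock_rho Q = U - V"
proof -
  have i: "Q ^ 2 / (w * Q) = w ^ 2 * Q" using w_inv[OF w] w_nz[OF w] w3[OF w] by (simp add: field_simps power2_eq_square power3_eq_cube)
  have c: "qpoch Q (Q ^ 2) n * qpoch (w * Q) (Q ^ 2) n * qpoch (w ^ 2 * Q) (Q ^ 2) n = qpoch (Q ^ 3) (Q ^ 6) n" for n
  proof (induction n)
    case (Suc n)
    have "(1 - x) * (1 - w * x) * (1 - w ^ 2 * x) = 1 - x ^ 3" for x using w by algebra
    moreover have "(Q * (Q ^ 2) ^ n) ^ 3 = Q ^ 3 * (Q ^ 6) ^ n" by (simp add: power_mult_distrib mult.commute flip: power_mult)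
    ultimately have "(1 - Q * (Q ^ 2) ^ n) * (1 - w * (Q * (Q ^ 2) ^ n)) * (1 - w ^ 2 * (Q * (Q ^ 2) ^ n)) = 1 - Q ^ 3 * (Q ^ 6) ^ n"
      by metis
    thus ?case unfolding qpoch_Suc Suc[symmetric] by (simp only: mult_ac)
  qed auto
  have nz: "qpoch Q (Q ^ 2) n \<noteq> 0" for n
  proof -
    interpret Q2: nome "Q ^ 2" by (rule nome_power) simp
    show ?thesis by (rule Q2.qpoch_nz'[OF lt1])
  qed
  have "Q ^ (2 * n * (n + 1)) * qpoch Q (Q ^ 2) (n + 1) / qpoch (Q ^ 3) (Q ^ 6) (n + 1) =
      (Q ^ 2) ^ (n * (n + 1)) / (qpoch (w * Q) (Q ^ 2) (n + 1) * qpoch (Q ^ 2 / (w * Q)) (Q ^ 2) (n + 1))" for n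
    unfolding i c[symmetric] power_mult[symmetric] using nz[of "n + 1"] by (simp add: mult.assoc)
  hence "mock_rho Q = (\<Sum>n. (Q ^ 2) ^ (n * (n + 1)) / (qpoch (w * Q) (Q ^ 2) (n + 1) * qpoch (Q ^ 2 / (w * Q)) (Q ^ 2) (n + 1)))"
    unfolding mock_rho_def by simp
  moreover have "w + w ^ 2 = -1" using w by algebra
  ultimately show ?thesis using watson_UV(1)[OF w3[OF w]] by simp
qed

lemma U_product: "theta (Q ^ 6) (Q ^ 3) * U = J 6 ^ 3"
proof -
  interpret Q6: nome "Q ^ 6" by (rule nome_power) simp
  have "Q ^ 3 \<noteq> (Q ^ 6) powi m" for m
  proof
    assume "Q ^ 3 = (Q ^ 6) powi m"
    hence "Q powi 3 = Q powi (6 * m)" by (simp add: power_int_power)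
    hence "Q powi (6 * m - 3) = 1" by (simp add: power_int_diff)
    hence "6 * m - 3 = 0" by (rule Q_powi_eq_1)
    thus False by presburger
  qed
  hence "theta (Q ^ 6) (Q ^ 3) * U = Q6.K" unfolding U_def by (intro Q6.theta_appell_Q) auto
  thus ?thesis unfolding Q6.K_product J_def .
qed

lemma theta6_nz: "theta (Q ^ 6) (Q ^ m) \<noteq> 0" if "m \<in> {1, 2, 3, 4, 5}" for m
proof -
  interpret Q6: nome "Q ^ 6" by (rule nome_power) simp
  have lt: "norm (Q ^ m) < 1" if "m > 0" for m using that lt1 by (simp add: norm_power power_less_one_iff)
  have "Q ^ 6 / Q ^ m = Q ^ (6 - m)" using that by (intro power_diff[symmetric]) auto
  hence "theta (Q ^ 6) (Q ^ m) = qpoch_inf (Q ^ m) (Q ^ 6) * qpoch_inf (Q ^ (6 - m)) (Q ^ 6) * qpoch_inf (Q ^ 6) (Q ^ 6)"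
    by (simp add: Q6.jacobi_triple jtheta_def)
  moreover have "qpoch_inf (Q ^ m) (Q ^ 6) \<noteq> 0" "qpoch_inf (Q ^ (6 - m)) (Q ^ 6) \<noteq> 0" "qpoch_inf (Q ^ 6) (Q ^ 6) \<noteq> 0"
    using that by (auto intro!: Q6.qpoch_inf_nz' lt)
  ultimately show ?thesis by simp
qed

text \<open>This Appell sum is the one left by the trisection. It belongs to the pair
  \<open>(Q, Q ^ 4)\<close> and \<open>V\<close> to \<open>(1 / Q ^ 3, Q ^ 8)\<close>; both pairs
  have product \<open>Q ^ 5\<close>, so \<open>B_cross\<close> applies, and its theta term reduces
  to \<open>U\<close>.\<close>

lemma appell_UV: "appell (Q ^ 6) (1 / Q) (Q ^ 4) = - Q * (U + V)"
proof -
  interpret Q6: nome "Q ^ 6" by (rule nome_power) simp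
  define a b c where "a = theta (Q ^ 6) (Q ^ 3)" and "b = theta (Q ^ 6) Q" and "c = theta (Q ^ 6) (Q ^ 2)"
  have nz: "a \<noteq> 0" "b \<noteq> 0" "c \<noteq> 0" using theta6_nz[of 3] theta6_nz[of 1] theta6_nz[of 2] by (simp_all add: a_def b_def c_def)
  have p: "Q ^ 6 * (1 / Q ^ 2) = Q ^ 4" "Q ^ 6 * Q ^ 2 = Q ^ 8" "Q ^ 6 * Q = Q ^ 7"
    by (simp_all add: field_simps flip: power_add power_Suc power_Suc2)
  have c4: "theta (Q ^ 6) (Q ^ 4) = c"
    using Q6.theta_mult_Q[of "1 / Q ^ 2"] Q6.theta_inverse[of "Q ^ 2"] unfolding p by (simp add: c_def)
  have c8: "theta (Q ^ 6) (Q ^ 8) = - c / Q ^ 2"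
    using Q6.theta_mult_Q[of "Q ^ 2"] unfolding p by (simp add: c_def)
  have b7: "theta (Q ^ 6) (Q ^ 7) = - b / Q"
    using Q6.theta_mult_Q[of "Q"] unfolding p by (simp add: b_def)
  have a3: "theta (Q ^ 6) (1 / Q ^ 3) = - a / Q ^ 3" using Q6.theta_inverse[of "Q ^ 3"] by (simp add: a_def)
  have i7: "theta (Q ^ 6) (1 / Q ^ 7) = b / Q ^ 8"
    using Q6.theta_inverse[of "Q ^ 7"] unfolding b7 by (simp add: divide_simps flip: power_Suc power_Suc2)
  have i4: "theta (Q ^ 6) (1 / Q ^ 4) = - c / Q ^ 4" using Q6.theta_inverse[of "Q ^ 4"] by (simp add: c4)
  have n1: "Q \<noteq> (Q ^ 6) powi m" and n3: "1 / Q ^ 3 \<noteq> (Q ^ 6) powi m" for m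
  proof -
    show "Q \<noteq> (Q ^ 6) powi m"
    proof
      assume "Q = (Q ^ 6) powi m"
      hence "Q powi 1 = Q powi (6 * m)" by (simp add: power_int_power)
      hence "Q powi (6 * m - 1) = 1" by (simp add: power_int_diff)
      hence "6 * m - 1 = 0" by (rule Q_powi_eq_1)
      thus False by presburger
    qed
    show "1 / Q ^ 3 \<noteq> (Q ^ 6) powi m"
    proof
      assume "1 / Q ^ 3 = (Q ^ 6) powi m"
      hence "Q powi (6 * m) * Q powi 3 = 1" by (simp add: power_int_power field_simps)
      hence "Q powi (6 * m + 3) = 1" by (simp add: power_int_add)
      hence "6 * m + 3 = 0" by (rule Q_powi_eq_1)
      thus False by presburger
    qed
  qed
  define X Y where "X = appell (Q ^ 6) (1 / Q) (Q ^ 4)" and "Y = appell (Q ^ 6) (Q ^ 3) (Q ^ 8)"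
  have B1: "Q6.B Q (Q ^ 4) = b * X"
    using Q6.B_theta_appell[of Q "Q ^ 4"] n1 by (simp add: b_def X_def)
  have B2: "Q6.B (1 / Q ^ 3) (Q ^ 8) = - a / Q ^ 3 * Y"
    using Q6.B_theta_appell[of "1 / Q ^ 3" "Q ^ 8"] n3 by (simp add: a3 Y_def)
  have "1 / Q ^ 3 * Q ^ 8 = Q * Q ^ 4" "1 / Q ^ 3 / Q ^ 4 = 1 / Q ^ 7" "Q ^ 4 / Q ^ 8 = 1 / Q ^ 4"
    by (simp_all add: divide_simps flip: power_add power_Suc power_Suc2)
  hence "b * X * (- a / Q ^ 3) * (- c / Q ^ 2) - (- a / Q ^ 3 * Y) * b * c = Q6.K * Q ^ 8 * (b / Q ^ 8) * (- c / Q ^ 4)"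
    using Q6.B_cross[of Q "Q ^ 4" "1 / Q ^ 3" "Q ^ 8"] nz
    unfolding B1 B2 by (simp add: a3 c8 c4 i7 i4 b_def[symmetric])
  hence "(b * c) * (a * X / Q ^ 5 + a * Y / Q ^ 3) = (b * c) * (- Q6.K / Q ^ 4)"
    by (simp add: field_simps flip: power_add power_Suc power_Suc2)
  hence "a * X / Q ^ 5 + a * Y / Q ^ 3 = - Q6.K / Q ^ 4"
    by (rule mult_left_cancel[THEN iffD1, rotated]) (use nz in simp)
  moreover have "Q6.K = a * U" using U_product unfolding a_def Q6.K_product J_def by simp
  ultimately have "a * (X / Q ^ 5 + Y / Q ^ 3) = a * (- U / Q ^ 4)" by (simp add: distrib_left)
  hence "X / Q ^ 5 + Y / Q ^ 3 = - U / Q ^ 4"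
    by (rule mult_left_cancel[THEN iffD1, rotated]) (rule nz)
  hence "Q ^ 5 * (X / Q ^ 5 + Y / Q ^ 3) = Q ^ 5 * (- U / Q ^ 4)" by simp
  moreover have "Q ^ 5 * (X / Q ^ 5 + Y / Q ^ 3) = X + Q ^ 2 * Y" "Q ^ 5 * (- U / Q ^ 4) = - Q * U"
    by (simp_all add: distrib_left eval_nat_numeral)
  ultimately have "X + Q ^ 2 * Y = - Q * U" by simp
  hence "X = - Q * (U + Q * Y)" by algebra
  thus ?thesis unfolding X_def V_def Y_def .
qed

end

section \<open>Trisection\<close>

lemma infsum_int_mod3:
  fixes f :: "int \<Rightarrow> complex"
  assumes "f summable_on UNIV"
  shows "((\<lambda>k. f (3 * k) + f (3 * k + 1) + f (3 * k + 2)) has_sum (\<Sum>\<^sub>\<infinity>n. f n)) UNIV"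
    and "(\<lambda>k. f (3 * k)) summable_on UNIV" "(\<lambda>k. f (3 * k + 1)) summable_on UNIV" "(\<lambda>k. f (3 * k + 2)) summable_on UNIV"
proof -
  have sub: "f summable_on A" for A by (rule summable_on_subset_banach[OF assms]) auto
  have inj: "inj (\<lambda>k :: int. 3 * k + c)" for c by (auto simp: inj_on_def)
  have s: "(\<lambda>k. f (3 * k + c)) summable_on UNIV" for c
    using sub[of "range (\<lambda>k. 3 * k + c)"] unfolding summable_on_reindex[OF inj] by (simp add: o_def)
  show s': "(\<lambda>k. f (3 * k)) summable_on UNIV" "(\<lambda>k. f (3 * k + 1)) summable_on UNIV" "(\<lambda>k. f (3 * k + 2)) summable_on UNIV"
    using s[of 0] s[of 1] s[of 2] by simp_all
  have i: "infsum f (range (\<lambda>k. 3 * k + c)) = (\<Sum>\<^sub>\<infinity>k. f (3 * k + c))" for c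
    using infsum_reindex[OF inj, of f] by (simp add: o_def)
  have U: "(UNIV :: int set) = range (\<lambda>k. 3 * k + 0) \<union> (range (\<lambda>k. 3 * k + 1) \<union> range (\<lambda>k. 3 * k + 2))"
  proof -
    have "n \<in> range (\<lambda>k. 3 * k + 0) \<union> (range (\<lambda>k. 3 * k + 1) \<union> range (\<lambda>k. 3 * k + 2))" for n :: int
    proof -
      have "n = 3 * (n div 3) + 0 \<or> n = 3 * (n div 3) + 1 \<or> n = 3 * (n div 3) + 2" by presburger
      thus ?thesis by blast
    qed
    thus ?thesis by blast
  qed
  have d: "range (\<lambda>k :: int. 3 * k + 1) \<inter> range (\<lambda>k. 3 * k + 2) = {}"
    "range (\<lambda>k :: int. 3 * k + 0) \<inter> (range (\<lambda>k. 3 * k + 1) \<union> range (\<lambda>k. 3 * k + 2)) = {}"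
    by (auto, presburger+)
  have "(\<Sum>\<^sub>\<infinity>n. f n) = infsum f (range (\<lambda>k. 3 * k + 0)) + infsum f (range (\<lambda>k. 3 * k + 1) \<union> range (\<lambda>k. 3 * k + 2))"
    by (subst U, rule infsum_Un_disjoint[OF sub sub d(2)])
  also have "infsum f (range (\<lambda>k. 3 * k + 1) \<union> range (\<lambda>k. 3 * k + 2)) =
     infsum f (range (\<lambda>k. 3 * k + 1)) + infsum f (range (\<lambda>k. 3 * k + 2))"
    by (rule infsum_Un_disjoint[OF sub sub d(1)])
  finally have "(\<Sum>\<^sub>\<infinity>n. f n) = (\<Sum>\<^sub>\<infinity>k. f (3 * k)) + (\<Sum>\<^sub>\<infinity>k. f (3 * k + 1)) + (\<Sum>\<^sub>\<infinity>k. f (3 * k + 2))"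
    unfolding i by simp
  thus "((\<lambda>k. f (3 * k) + f (3 * k + 1) + f (3 * k + 2)) has_sum (\<Sum>\<^sub>\<infinity>n. f n)) UNIV"
    using s' by (auto intro!: has_sum_add has_sum_infsum)
qed

lemma minus_one_powi_mod3:
  "(-1 :: complex) powi (3 * k) = (-1) powi k" "(-1 :: complex) powi (3 * k + 1) = - ((-1) powi k)"
  "(-1 :: complex) powi (3 * k + 2) = (-1) powi k"
  by (cases "even k"; simp add: power_int_minus_left)+

text \<open>The part of \<open>theta Q (-1)\<close> with exponents divisible by 3, as a function of
  \<open>r = Q ^ 3\<close>.\<close>

definition psi0 :: "complex \<Rightarrow> complex" where
  "psi0 r = (\<Sum>\<^sub>\<infinity>k. r powi (3 * tri k + k) + r powi (3 * tri k + 2 * k))"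

context nome
begin

lemma Q3_powi: "(Q ^ 3) powi n = Q powi (3 * n)"
  by (simp add: power_int_power)

text \<open>Triangular numbers are 0 or 1 modulo 3, and the class of 1 reproduces the whole series
  at \<open>Q ^ 9\<close>.\<close>

lemma psi_trisection: "theta Q (-1) = psi0 (Q ^ 3) + Q * theta (Q ^ 9) (-1)"
proof -
  let ?f = "\<lambda>n. qt Q n * (-1) powi n"
  have f: "?f n = Q powi tri n" for n by (simp add: qt_def mult_ac)
  have sf: "?f summable_on UNIV" by (rule theta_summable) simp
  have t: "tri (3 * k) = 3 * (3 * tri k + k)" "tri (3 * k + 1) = 3 * (3 * tri k + 2 * k)" "tri (3 * k + 2) = 9 * tri (k + 1) + 1" for k
    using two_tri[of "3 * k"] two_tri[of k] two_tri[of "3 * k + 1"] two_tri[of "3 * k + 2"] two_tri[of "k + 1"]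
    by (simp_all add: algebra_simps)
  have q9: "qt (Q ^ 9) (k + 1) * (-1) powi (k + 1) = Q powi (9 * tri (k + 1))" for k
    by (simp add: qt_def power_int_power mult_ac)
  have f3: "?f (3 * k) = (Q ^ 3) powi (3 * tri k + k)" "?f (3 * k + 1) = (Q ^ 3) powi (3 * tri k + 2 * k)"
    "?f (3 * k + 2) = Q * (qt (Q ^ 9) (k + 1) * (-1) powi (k + 1))" for k
    unfolding f t Q3_powi q9 by (simp_all add: power_int_add)
  note m = infsum_int_mod3[OF sf, unfolded f3]
  have "theta Q (-1) = (\<Sum>\<^sub>\<infinity>k. ((Q ^ 3) powi (3 * tri k + k) + (Q ^ 3) powi (3 * tri k + 2 * k)) + Q * (qt (Q ^ 9) (k + 1) * (-1) powi (k + 1)))"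
    unfolding theta_def infsumI[OF m(1)] ..
  also have "\<dots> = psi0 (Q ^ 3) + (\<Sum>\<^sub>\<infinity>k. Q * (qt (Q ^ 9) (k + 1) * (-1) powi (k + 1)))"
    unfolding psi0_def by (rule infsum_add) (intro summable_on_add m)+
  also have "(\<Sum>\<^sub>\<infinity>k. Q * (qt (Q ^ 9) (k + 1) * (-1) powi (k + 1))) = Q * theta (Q ^ 9) (-1)"
    unfolding infsum_cmult_right' theta_def infsum_int_shift[of "\<lambda>k. qt (Q ^ 9) k * (-1) powi k" 1] ..
  finally show ?thesis .
qed

text \<open>Squares are 0 or 1 modulo 3. The indices congruent to 1 and 2 give two theta values that
  coincide up to a factor by the functional equations, whence the coefficient 2.\<close>

lemma phi_trisection: "theta (Q ^ 2) Q = theta ((Q ^ 3) ^ 6) ((Q ^ 3) ^ 3) - 2 * Q * theta ((Q ^ 3) ^ 6) (Q ^ 3)"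
proof -
  define r where "r = Q ^ 3"
  interpret Q2: nome "Q ^ 2" by (rule nome_power) simp
  interpret r: nome r unfolding r_def by (rule nome_power) simp
  interpret r6: nome "r ^ 6" by (rule r.nome_power) simp
  let ?f = "\<lambda>n. qt (Q ^ 2) n * Q powi n"
  let ?t = "\<lambda>m k. qt (r ^ 6) k * (r ^ m) powi k"
  have f: "?f n = (-1) powi n * Q powi (n * n)" for n using qt_sq[of n 1] by simp
  have t: "?t m k = (-1) powi k * Q powi (3 * (3 * (k * k) - 3 * k + int m * k))" for m k
    unfolding r.qt6 by (simp only: r_def Q3_powi)
  have f3: "?f (3 * k) = ?t 3 k" "?f (3 * k + 1) = - Q * ?t 5 k" "?f (3 * k + 2) = Q * r * ?t 7 k" for k
  proof -
    show "?f (3 * k) = ?t 3 k" unfolding f t minus_one_powi_mod3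
      by (rule arg_cong[of _ _ "\<lambda>n. (-1) powi k * Q powi n"]) (simp add: algebra_simps)
    have "Q powi ((3 * k + 1) * (3 * k + 1)) = Q powi (1 + 3 * (3 * (k * k) - 3 * k + int 5 * k))"
      by (rule arg_cong[of _ _ "power_int Q"]) (simp add: algebra_simps)
    thus "?f (3 * k + 1) = - Q * ?t 5 k" unfolding f t minus_one_powi_mod3
      by (subst (asm) power_int_add) auto
    have "Q powi ((3 * k + 2) * (3 * k + 2)) = Q powi (1 + (3 + 3 * (3 * (k * k) - 3 * k + int 7 * k)))"
      by (rule arg_cong[of _ _ "power_int Q"]) (simp add: algebra_simps)
    also have "\<dots> = Q powi 1 * (Q powi 3 * Q powi (3 * (3 * (k * k) - 3 * k + int 7 * k)))"
      by (subst power_int_add, simp, subst power_int_add) auto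
    finally show "?f (3 * k + 2) = Q * r * ?t 7 k" unfolding f t minus_one_powi_mod3 unfolding r_def by simp
  qed
  have st: "(?t m has_sum theta (r ^ 6) (r ^ m)) UNIV" for m
    unfolding theta_def by (intro has_sum_infsum r6.theta_summable) simp
  have "((\<lambda>k. ?t 3 k + (- Q) * ?t 5 k + (Q * r) * ?t 7 k) has_sum
      (theta (r ^ 6) (r ^ 3) + (- Q) * theta (r ^ 6) (r ^ 5) + (Q * r) * theta (r ^ 6) (r ^ 7))) UNIV"
    by (intro has_sum_add has_sum_cmult_right st)
  moreover have "?f summable_on UNIV" by (rule Q2.theta_summable) simp
  ultimately have "theta (Q ^ 2) Q = theta (r ^ 6) (r ^ 3) + (- Q) * theta (r ^ 6) (r ^ 5) + (Q * r) * theta (r ^ 6) (r ^ 7)"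
    using infsum_int_mod3(1)[of ?f, unfolded f3] has_sum_unique unfolding theta_def by blast
  moreover have "theta (r ^ 6) (r ^ 7) = - theta (r ^ 6) r / r"
    using r6.theta_mult_Q[of r] by (simp flip: power_Suc2)
  moreover have "theta (r ^ 6) (r ^ 5) = theta (r ^ 6) r"
  proof -
    have "r ^ 6 * (1 / r) = r ^ 5" by (simp add: field_simps) (simp add: eval_nat_numeral)
    thus ?thesis using r6.theta_mult_Q[of "1 / r"] r6.theta_inverse[of r] by simp
  qed
  ultimately show ?thesis unfolding r_def[symmetric] by simp
qed

text \<open>The coefficient of \<open>Q ^ n\<close> is multiplied by \<open>1 + v + v ^ 2\<close>
  with \<open>v = w ^ (n + 1)\<close>, which is 3 if \<open>n\<close> is 2 modulo 3 and 0
  otherwise.\<close>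

lemma rank_gf_trisection:
  assumes w: "1 + w + w ^ 2 = 0" and z: "norm z = 1"
  shows "rank_gf z Q + w * rank_gf z (w * Q) + w ^ 2 * rank_gf z (w ^ 2 * Q)
           = 3 * Q ^ 2 * (\<Sum>n. rank_sum z (3 * n + 2) * (Q ^ 3) ^ n)"
    and "summable (\<lambda>n. rank_sum z (3 * n + 2) * (Q ^ 3) ^ n)"
proof -
  interpret d1: qdisc "w * Q" by unfold_locales (simp add: norm_mult w_norm[OF w] lt1)
  interpret d2: qdisc "w ^ 2 * Q" by unfold_locales (simp add: norm_mult norm_power w_norm[OF w] lt1)
  let ?c = "rank_sum z"
  have hs: "((\<lambda>n. ?c n * Q ^ n + w * (?c n * (w * Q) ^ n) + w ^ 2 * (?c n * (w ^ 2 * Q) ^ n)) has_sum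
      (rank_gf z Q + w * rank_gf z (w * Q) + w ^ 2 * rank_gf z (w ^ 2 * Q))) UNIV"
    unfolding rank_gf_coeff(2)[OF z] d1.rank_gf_coeff(2)[OF z] d2.rank_gf_coeff(2)[OF z]
    by (intro has_sum_add has_sum_cmult_right has_sum_infsum rank_gf_coeff(1)[OF z] d1.rank_gf_coeff(1)[OF z] d2.rank_gf_coeff(1)[OF z])
  have t: "?c n * Q ^ n + w * (?c n * (w * Q) ^ n) + w ^ 2 * (?c n * (w ^ 2 * Q) ^ n) = ?c n * Q ^ n * (1 + w ^ (n + 1) + (w ^ (n + 1)) ^ 2)" for n
    by (simp add: power_mult_distrib algebra_simps power_mult[symmetric] power_add[symmetric] mult_2_right)
  have w3n: "w ^ (3 * k) = 1" for k unfolding power_mult w3[OF w] by simp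
  have v: "?c n * Q ^ n * (1 + w ^ (n + 1) + (w ^ (n + 1)) ^ 2) = 0" if "n \<notin> range (\<lambda>k. 3 * k + 2)" for n
  proof -
    have "n = 3 * (n div 3) \<or> n = 3 * (n div 3) + 1 \<or> n = 3 * (n div 3) + 2" by presburger
    with that have "n = 3 * (n div 3) \<or> n = 3 * (n div 3) + 1" by blast
    hence "w ^ (n + 1) = w \<or> w ^ (n + 1) = w ^ 2"
    proof
      assume "n = 3 * (n div 3)"
      hence "w ^ (n + 1) = w ^ (3 * (n div 3)) * w" by (metis Suc_eq_plus1 power_Suc2)
      thus ?thesis by (simp add: w3n)
    next
      assume "n = 3 * (n div 3) + 1"
      hence "w ^ (n + 1) = w ^ (3 * (n div 3)) * w ^ 2" by (metis add.assoc one_add_one power_add)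
      thus ?thesis by (simp add: w3n)
    qed
    moreover have "1 + w ^ 2 + (w ^ 2) ^ 2 = 0" using w by algebra
    ultimately show ?thesis using w by auto
  qed
  have inj: "inj (\<lambda>k :: nat. 3 * k + 2)" by (auto simp: inj_on_def)
  have "((\<lambda>n. ?c n * Q ^ n * (1 + w ^ (n + 1) + (w ^ (n + 1)) ^ 2)) has_sum
      (rank_gf z Q + w * rank_gf z (w * Q) + w ^ 2 * rank_gf z (w ^ 2 * Q))) (range (\<lambda>k. 3 * k + 2))"
    using hs unfolding t
    by (subst has_sum_cong_neutral[where S = "range (\<lambda>k. 3 * k + 2)" and T = UNIV,
        where g = "\<lambda>n. ?c n * Q ^ n * (1 + w ^ (n + 1) + (w ^ (n + 1)) ^ 2)"]) (use v in auto)
  hence "((\<lambda>k. ?c (3 * k + 2) * Q ^ (3 * k + 2) * (1 + w ^ (3 * k + 2 + 1) + (w ^ (3 * k + 2 + 1)) ^ 2)) has_sum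
      (rank_gf z Q + w * rank_gf z (w * Q) + w ^ 2 * rank_gf z (w ^ 2 * Q))) UNIV"
    unfolding has_sum_reindex[OF inj] o_def .
  moreover have "?c (3 * k + 2) * Q ^ (3 * k + 2) * (1 + w ^ (3 * k + 2 + 1) + (w ^ (3 * k + 2 + 1)) ^ 2) =
      3 * Q ^ 2 * (?c (3 * k + 2) * (Q ^ 3) ^ k)" for k
  proof -
    have "w ^ (3 * k + 2 + 1) = 1" using w3n[of "k + 1"] by (simp add: algebra_simps numeral_3_eq_3)
    thus ?thesis unfolding power_add power_mult by simp
  qed
  ultimately have "(\<lambda>k. 3 * Q ^ 2 * (?c (3 * k + 2) * (Q ^ 3) ^ k)) sums
      (rank_gf z Q + w * rank_gf z (w * Q) + w ^ 2 * rank_gf z (w ^ 2 * Q))"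
    using has_sum_imp_sums by (simp only:)
  from sums_divide[OF this, of "3 * Q ^ 2"]
  have "(\<lambda>k. ?c (3 * k + 2) * (Q ^ 3) ^ k) sums
      ((rank_gf z Q + w * rank_gf z (w * Q) + w ^ 2 * rank_gf z (w ^ 2 * Q)) / (3 * Q ^ 2))"
    by simp
  thus "rank_gf z Q + w * rank_gf z (w * Q) + w ^ 2 * rank_gf z (w ^ 2 * Q)
           = 3 * Q ^ 2 * (\<Sum>n. rank_sum z (3 * n + 2) * (Q ^ 3) ^ n)"
    and "summable (\<lambda>n. rank_sum z (3 * n + 2) * (Q ^ 3) ^ n)"
    by (auto simp: sums_iff)
qed

text \<open>Each product is split by exponents modulo 3. The multiples of 3 are unaffected by
  rotation and give \<open>J 3 ^ 3\<close>; the other two classes combine by the cubic product and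
  supply \<open>J 3 / J 9\<close>.\<close>

lemma qpoch_inf_trisection:
  assumes w: "1 + w + w ^ 2 = 0"
  shows "qpoch_inf Q Q * qpoch_inf (w * Q) (w * Q) * qpoch_inf (w ^ 2 * Q) (w ^ 2 * Q) = J 3 ^ 4 / J 9"
proof -
  interpret r: nome "Q ^ 3" by (rule nome_power) simp
  interpret d1: qdisc "w * Q" by unfold_locales (simp add: norm_mult w_norm[OF w] lt1)
  interpret d2: qdisc "w ^ 2 * Q" by unfold_locales (simp add: norm_mult norm_power w_norm[OF w] lt1)
  have e: "(w * Q) ^ 3 = Q ^ 3" "(w ^ 2 * Q) ^ 3 = Q ^ 3" "w * Q * (w * Q) ^ 2 = Q ^ 3" "w ^ 2 * Q * (w ^ 2 * Q) ^ 2 = Q ^ 3"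
    "w * Q * (w * Q) = w ^ 2 * Q ^ 2" "w ^ 2 * Q * (w ^ 2 * Q) = w * Q ^ 2" "Q * Q ^ 2 = Q ^ 3" "Q * Q = Q ^ 2"
  proof -
    show "Q * Q ^ 2 = Q ^ 3" "Q * Q = Q ^ 2" "w * Q * (w * Q) = w ^ 2 * Q ^ 2" by (simp_all add: power2_eq_square power3_eq_cube)
    show "(w * Q) ^ 3 = Q ^ 3" using w3[OF w] by algebra
    show "(w ^ 2 * Q) ^ 3 = Q ^ 3" using w3[OF w] by algebra
    show "w * Q * (w * Q) ^ 2 = Q ^ 3" using w3[OF w] by algebra
    show "w ^ 2 * Q * (w ^ 2 * Q) ^ 2 = Q ^ 3" using w3[OF w] by algebra
    show "w ^ 2 * Q * (w ^ 2 * Q) = w * Q ^ 2" using w3[OF w] by algebra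
  qed
  have r9: "(Q ^ 3) ^ 3 = Q ^ 9" "(Q ^ 2) ^ 3 = (Q ^ 3) ^ 2" by (simp_all flip: power_mult)
  have c1: "qpoch_inf Q (Q ^ 3) * qpoch_inf (w * Q) (Q ^ 3) * qpoch_inf (w ^ 2 * Q) (Q ^ 3) = qpoch_inf (Q ^ 3) (Q ^ 9)"
    using r.qpoch_inf_cubic[OF w, of Q] unfolding r9 .
  have c2: "qpoch_inf (Q ^ 2) (Q ^ 3) * qpoch_inf (w * Q ^ 2) (Q ^ 3) * qpoch_inf (w ^ 2 * Q ^ 2) (Q ^ 3) = qpoch_inf ((Q ^ 3) ^ 2) (Q ^ 9)"
    using r.qpoch_inf_cubic[OF w, of "Q ^ 2"] unfolding r9 .
  have s: "J 3 = qpoch_inf (Q ^ 3) (Q ^ 9) * qpoch_inf ((Q ^ 3) ^ 2) (Q ^ 9) * J 9"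
    using r.qpoch_inf_3[of "Q ^ 3"] unfolding r9
    by (simp add: J_def r9 power2_eq_square[of "Q ^ 3"])
  have "qpoch_inf Q Q * qpoch_inf (w * Q) (w * Q) * qpoch_inf (w ^ 2 * Q) (w ^ 2 * Q) =
    (qpoch_inf Q (Q ^ 3) * qpoch_inf (Q ^ 2) (Q ^ 3) * qpoch_inf (Q ^ 3) (Q ^ 3)) *
    (qpoch_inf (w * Q) (Q ^ 3) * qpoch_inf (w ^ 2 * Q ^ 2) (Q ^ 3) * qpoch_inf (Q ^ 3) (Q ^ 3)) *
    (qpoch_inf (w ^ 2 * Q) (Q ^ 3) * qpoch_inf (w * Q ^ 2) (Q ^ 3) * qpoch_inf (Q ^ 3) (Q ^ 3))"
    using qpoch_inf_3[of Q] d1.qpoch_inf_3[of "w * Q"] d2.qpoch_inf_3[of "w ^ 2 * Q"] unfolding e by simp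
  also have "\<dots> = qpoch_inf (Q ^ 3) (Q ^ 9) * qpoch_inf ((Q ^ 3) ^ 2) (Q ^ 9) * J 3 ^ 3"
    unfolding c1[symmetric] c2[symmetric] by (simp add: J_def power3_eq_cube mult_ac)
  also have "\<dots> = J 3 ^ 4 / J 9"
    using J_nz[of 9] s by (simp add: power4_eq_xxxx power3_eq_cube field_simps)
  finally show ?thesis .
qed

context
  fixes w :: complex
  assumes w: "1 + w + w ^ 2 = 0"
begin

lemma rotated_nome: "nome (w * Q)" "nome (w ^ 2 * Q)"
  using w_norm[OF w] w_nz[OF w] lt1 by (unfold_locales; simp add: norm_mult norm_power)+

lemma rotated_cube: "(w * Q) ^ 3 = Q ^ 3" "(w ^ 2 * Q) ^ 3 = Q ^ 3"
proof -
  show "(w * Q) ^ 3 = Q ^ 3" using w3[OF w] by algebra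
  show "(w ^ 2 * Q) ^ 3 = Q ^ 3" using w3[OF w] by algebra
qed

lemma rotated_cubes: "(w * Q) ^ (3 * n) = Q ^ (3 * n)" "(w ^ 2 * Q) ^ (3 * n) = Q ^ (3 * n)"
  unfolding power_mult rotated_cube by simp_all

text \<open>On a residue class modulo 3 the power of \<open>w ^ 2\<close> is constant, and all but
  small powers of \<open>Q\<close> can be written in \<open>Q ^ 3\<close>. The class of 0 involves
  \<open>Q ^ 3\<close> alone, so it is invariant under rotation.\<close>

lemma appell_mod3_terms:
  fixes k :: int
  defines "f \<equiv> (\<lambda>n. qt (Q ^ 2) n * (w ^ 2) powi n / (1 - 1 / Q ^ 3 * (Q ^ 2) powi n))"
  shows "f (3 * k) = (-1) powi k * (Q ^ 3) powi (3 * (k * k) - k) / (1 - (Q ^ 3) powi (2 * k - 1))"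
    and "f (3 * k + 1) = - (w ^ 2) * ((-1) powi k * (Q ^ 3) powi (3 * (k * k) + k)) / (1 - (Q ^ 3) powi (2 * k - 1) * Q ^ 2)"
    and "f (3 * k + 2) = w * ((-1) powi k * (Q ^ 3) powi (3 * (k * k) + 3 * k)) * (Q ^ 2 / (1 - (Q ^ 3) powi (2 * k) * Q))"
proof -
  have q: "qt (Q ^ 2) n = (-1) powi n * Q powi (n * n - n)" for n using qt_sq[of n 0] by simp
  have d: "1 / Q ^ 3 * (Q ^ 2) powi n = Q powi (2 * n - 3)" for n
    unfolding power_int_power by (simp add: power_int_diff)
  have "(w ^ 2) powi 3 = 1" using w3[OF w] by simp algebra
  hence w0: "(w ^ 2) powi (3 * k) = 1" by (simp add: power_int_mult)
  have "w ^ 2 \<noteq> 0" using w_nz[OF w] by simp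
  hence w1: "(w ^ 2) powi (3 * k + 1) = w ^ 2" "(w ^ 2) powi (3 * k + 2) = (w ^ 2) ^ 2"
    by (simp_all add: power_int_add w0)
  have w2: "(w ^ 2) ^ 2 = w" using w3[OF w] by algebra
  have 0: "3 * k * (3 * k) - 3 * k = 3 * (3 * (k * k) - k)" "2 * (3 * k) - 3 = 3 * (2 * k - 1)" by simp_all
  show "f (3 * k) = (-1) powi k * (Q ^ 3) powi (3 * (k * k) - k) / (1 - (Q ^ 3) powi (2 * k - 1))"
    unfolding f_def q d w0 minus_one_powi_mod3 unfolding 0 Q3_powi by simp
  have 1: "(3 * k + 1) * (3 * k + 1) - (3 * k + 1) = 3 * (3 * (k * k) + k)" "2 * (3 * k + 1) - 3 = 3 * (2 * k - 1) + 2"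
    by (simp_all add: algebra_simps)
  have e1: "Q powi (3 * (2 * k - 1) + 2) = Q powi (3 * (2 * k - 1)) * Q ^ 2" by (subst power_int_add) auto
  show "f (3 * k + 1) = - (w ^ 2) * ((-1) powi k * (Q ^ 3) powi (3 * (k * k) + k)) / (1 - (Q ^ 3) powi (2 * k - 1) * Q ^ 2)"
    unfolding f_def q d w1 minus_one_powi_mod3 unfolding 1 e1 Q3_powi by simp
  have 2: "(3 * k + 2) * (3 * k + 2) - (3 * k + 2) = 3 * (3 * (k * k) + 3 * k) + 2" "2 * (3 * k + 2) - 3 = 3 * (2 * k) + 1"
    by (simp_all add: algebra_simps)
  have e2: "Q powi (3 * (3 * (k * k) + 3 * k) + 2) = Q powi (3 * (3 * (k * k) + 3 * k)) * Q ^ 2"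
    "Q powi (3 * (2 * k) + 1) = Q powi (3 * (2 * k)) * Q"
    by (subst power_int_add; simp)+
  show "f (3 * k + 2) = w * ((-1) powi k * (Q ^ 3) powi (3 * (k * k) + 3 * k)) * (Q ^ 2 / (1 - (Q ^ 3) powi (2 * k) * Q))"
    unfolding f_def q d w1 w2 minus_one_powi_mod3 unfolding 2 e2 Q3_powi by simp
qed

end

end

section \<open>Averaging the Appell sum over the rotations\<close>

lemma cube_root_average:
  fixes w y s :: complex
  assumes w: "1 + w + w ^ 2 = 0" and nz: "1 - (s * y) ^ 3 \<noteq> 0"
  shows "1 / (1 - s * y) + 1 / (1 - s * (w * y)) + 1 / (1 - s * (w ^ 2 * y)) = 3 / (1 - (s * y) ^ 3)"
    and "1 / (1 - s * y) + w / (1 - s * (w * y)) + w ^ 2 / (1 - s * (w ^ 2 * y)) = 3 * (s * y) ^ 2 / (1 - (s * y) ^ 3)"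
    and "1 / (1 - s * y) + w ^ 2 / (1 - s * (w * y)) + w / (1 - s * (w ^ 2 * y)) = 3 * (s * y) / (1 - (s * y) ^ 3)"
proof -
  define u where "u = s * y"
  have f: "1 - u ^ 3 = (1 - u) * ((1 - w * u) * (1 - w ^ 2 * u))" using w by algebra
  have nzs: "1 - u \<noteq> 0" "1 - w * u \<noteq> 0" "1 - w ^ 2 * u \<noteq> 0" using nz unfolding u_def[symmetric] f by auto
  have gen: "a / A + b / B + c / C = (a * (B * C) + b * (A * C) + c * (A * B)) / (A * (B * C))"
    if "A \<noteq> 0" "B \<noteq> 0" "C \<noteq> 0" for a b c A B C :: complex
    using that by (simp add: divide_simps) (simp add: algebra_simps)
  have u: "s * y = u" "s * (w * y) = w * u" "s * (w ^ 2 * y) = w ^ 2 * u" by (simp_all add: u_def mult_ac)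
  have g: "1 * ((1 - w * u) * (1 - w ^ 2 * u)) + 1 * ((1 - u) * (1 - w ^ 2 * u)) + 1 * ((1 - u) * (1 - w * u)) = 3"
    using w by algebra
  have g2: "1 * ((1 - w * u) * (1 - w ^ 2 * u)) + w * ((1 - u) * (1 - w ^ 2 * u)) + w ^ 2 * ((1 - u) * (1 - w * u)) = 3 * u ^ 2"
    using w by algebra
  have g3: "1 * ((1 - w * u) * (1 - w ^ 2 * u)) + w ^ 2 * ((1 - u) * (1 - w ^ 2 * u)) + w * ((1 - u) * (1 - w * u)) = 3 * u"
    using w by algebra
  show "1 / (1 - s * y) + 1 / (1 - s * (w * y)) + 1 / (1 - s * (w ^ 2 * y)) = 3 / (1 - (s * y) ^ 3)"
    unfolding u gen[OF nzs] g f ..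
  show "1 / (1 - s * y) + w / (1 - s * (w * y)) + w ^ 2 / (1 - s * (w ^ 2 * y)) = 3 * (s * y) ^ 2 / (1 - (s * y) ^ 3)"
    unfolding u gen[OF nzs] g2 f ..
  show "1 / (1 - s * y) + w ^ 2 / (1 - s * (w * y)) + w / (1 - s * (w ^ 2 * y)) = 3 * (s * y) / (1 - (s * y) ^ 3)"
    unfolding u gen[OF nzs] g3 f ..
qed

context nome
begin

text \<open>After a shift by one, the terms are \<open>- Q\<close> times Watson's at
  \<open>z = 1\<close> with numerator \<open>cc n * xx n\<close>. As \<open>x / (1 - x)\<close> is
  \<open>1 / (1 - x) - 1\<close>, this changes the sum only by that of \<open>cc\<close>, which is a
  theta function at its own nome and vanishes.\<close>

lemma omega_has_sum:
  "((\<lambda>k. (-1) powi k * Q powi (3 * (k * k) - k) / (1 - Q powi (2 * k - 1))) has_sum (- Q * (J 2 * mock_omega Q))) UNIV"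
proof -
  interpret Q6: nome "Q ^ 6" by (rule nome_power) simp
  let ?a = "\<lambda>k. (-1) powi k * Q powi (3 * (k * k) - k) / (1 - Q powi (2 * k - 1))"
  have "((\<lambda>n. cc n / (1 - 1 * xx n)) has_sum (U + 2 * V)) UNIV"
    using has_sum_infsum[OF watson_UV(3)[of 1]] unfolding watson_UV(2)[OF power_one] by simp
  moreover have "(cc has_sum 0) UNIV"
  proof -
    have "theta (Q ^ 6) (Q ^ 6) = 0" using Q6.theta_mult_Q[of 1] Q6.theta_1 by simp
    moreover have "(cc has_sum theta (Q ^ 6) (Q ^ 6)) UNIV"
      unfolding cc_def theta_def by (intro has_sum_infsum Q6.theta_summable) simp
    ultimately show ?thesis by simp
  qed
  ultimately have "((\<lambda>n. (- Q) * (cc n / (1 - 1 * xx n)) + Q * cc n) has_sum ((- Q) * (U + 2 * V) + Q * 0)) UNIV"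
    by (intro has_sum_add has_sum_cmult_right)
  moreover have "(- Q) * (cc n / (1 - 1 * xx n)) + Q * cc n = ?a (n + 1)" for n
  proof -
    have e: "3 * ((n + 1) * (n + 1)) - (n + 1) = 1 + ((3 * (n * n) + 3 * n) + (2 * n + 1))" "2 * (n + 1) - 1 = 2 * n + 1"
      by (simp_all add: algebra_simps)
    have "Q powi (3 * ((n + 1) * (n + 1)) - (n + 1)) = Q * (Q powi (3 * (n * n) + 3 * n) * xx n)"
      unfolding e xx_def by (subst power_int_add, simp, subst power_int_add) auto
    moreover have "(-1 :: complex) powi (n + 1) = - ((-1) powi n)" by (simp add: power_int_add)
    moreover have "Q powi (2 * (n + 1) - 1) = xx n" unfolding e xx_def ..
    ultimately have a: "?a (n + 1) = - Q * (cc n * xx n / (1 - xx n))" unfolding cc_altdef by simp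
    have "(- Q) * (c / (1 - 1 * x)) + Q * c = - Q * (c * x / (1 - x))" if "1 - x \<noteq> 0" for c x
      using that by (simp add: field_simps)
    from this[OF xx_nz(2)] show ?thesis unfolding a .
  qed
  ultimately have "((\<lambda>n. ?a (n + 1)) has_sum (- Q * (U + 2 * V))) UNIV" by simp
  hence s: "((\<lambda>n. ?a (n + 1)) has_sum (- Q * (J 2 * mock_omega Q))) UNIV" unfolding omega_UV .
  have "inj (\<lambda>n :: int. n + 1)" "range (\<lambda>n :: int. n + 1) = UNIV" by (auto simp: inj_on_def image_iff)
  thus ?thesis using s has_sum_reindex[of "\<lambda>n :: int. n + 1" UNIV ?a] by (simp add: o_def)
qed

text \<open>These are the series of the classes 1 and 2 after averaging; the reflection of
  \<open>k\<close> to \<open>- k\<close> shows that they are the same Appell sum up to sign.\<close>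

lemma appell_cube_has_sum:
  fixes S :: complex defines "S \<equiv> appell (Q ^ 6) (1 / Q) (Q ^ 4)"
  shows "((\<lambda>k. (-1) powi k * Q powi (3 * (k * k) + k) / (1 - Q powi (6 * k - 1))) has_sum S) UNIV"
    and "((\<lambda>k. (-1) powi k * Q powi (3 * (k * k) + 5 * k + 1) / (1 - Q powi (6 * k + 1))) has_sum - S) UNIV"
proof -
  interpret Q6: nome "Q ^ 6" by (rule nome_power) simp
  let ?b = "\<lambda>k. (-1) powi k * Q powi (3 * (k * k) + k) / (1 - Q powi (6 * k - 1))"
  let ?c = "\<lambda>k. (-1) powi k * Q powi (3 * (k * k) + 5 * k + 1) / (1 - Q powi (6 * k + 1))"
  have "qt (Q ^ 6) k * (Q ^ 4) powi k / (1 - 1 / Q * (Q ^ 6) powi k) = ?b k" for k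
  proof -
    have e: "3 * (k * k) - 3 * k + int 4 * k = 3 * (k * k) + k" by simp
    have "1 / Q * (Q ^ 6) powi k = Q powi (6 * k - 1)" unfolding power_int_power by (simp add: power_int_diff)
    thus ?thesis unfolding qt6 e by simp
  qed
  moreover have "((\<lambda>k. qt (Q ^ 6) k * (Q ^ 4) powi k / (1 - 1 / Q * (Q ^ 6) powi k)) has_sum S) UNIV"
    unfolding S_def appell_def by (intro has_sum_infsum Q6.appell_summable) auto
  ultimately show b: "(?b has_sum S) UNIV" by simp
  have "?b (- k) = - ?c k" for k
  proof -
    define E where "E = Q powi (6 * k + 1)"
    have "E \<noteq> 0" by (simp add: E_def)
    have "6 * k + 1 = 3 * (2 * k) + 1" by simp
    hence "1 - E \<noteq> 0" unfolding E_def by (metis Q_powi_odd(1))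
    have "Q powi (3 * (- k * - k) + - k) * E = Q powi (3 * (k * k) + 5 * k + 1)"
      unfolding E_def by (subst power_int_add[symmetric]) (auto intro!: arg_cong[of _ _ "power_int Q"])
    moreover have "6 * - k - 1 = - (6 * k + 1)" by simp
    hence "Q powi (6 * - k - 1) = 1 / E" unfolding E_def by (simp only: power_int_minus_divide)
    moreover have "(-1 :: complex) powi (- k) = (-1) powi k" by (cases "even k") (auto simp: power_int_minus_left)
    moreover have "c * x / (1 - 1 / E) = - (c * (x * E) / (1 - E))" for c x
      using \<open>E \<noteq> 0\<close> \<open>1 - E \<noteq> 0\<close> by (simp add: divide_simps) (simp add: algebra_simps)
    ultimately show ?thesis unfolding E_def[symmetric] by simp
  qed
  moreover have "((\<lambda>k. ?b (- k)) has_sum S) UNIV"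
    using b has_sum_reindex[of "uminus :: int \<Rightarrow> int" UNIV ?b] by (simp add: o_def inj_on_def)
  ultimately have "((\<lambda>k. - ?c k) has_sum S) UNIV" by simp
  thus "(?c has_sum - S) UNIV" unfolding has_sum_uminus .
qed

lemma appell_rotated_sum:
  assumes w: "1 + w + w ^ 2 = 0"
  shows "appell (Q ^ 2) (1 / Q ^ 3) (w ^ 2) + appell ((w * Q) ^ 2) (1 / Q ^ 3) (w ^ 2) + appell ((w ^ 2 * Q) ^ 2) (1 / Q ^ 3) (w ^ 2) =
    3 * (- (Q ^ 3) * (J 6 * mock_omega (Q ^ 3)) + appell ((Q ^ 3) ^ 6) (1 / Q ^ 3) ((Q ^ 3) ^ 4))"
proof -
  define r where "r = Q ^ 3"
  interpret r: nome r unfolding r_def by (rule nome_power) simp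
  interpret p1: nome "w * Q" by (rule rotated_nome[OF w])
  interpret p2: nome "w ^ 2 * Q" by (rule rotated_nome[OF w])
  have rw: "Q ^ 3 = r" "(w * Q) ^ 3 = r" "(w ^ 2 * Q) ^ 3 = r" unfolding rotated_cube[OF w] r_def by simp_all
  define S where "S = appell (r ^ 6) (1 / r) (r ^ 4)"
  let ?f = "\<lambda>p n. qt (p ^ 2) n * (w ^ 2) powi n / (1 - 1 / r * (p ^ 2) powi n)"
  have sm: "?f p summable_on UNIV" if "nome p" for p
  proof -
    interpret p: nome p by fact
    interpret P: nome "p ^ 2" by (rule p.nome_power) simp
    show ?thesis using w_nz[OF w] by (intro P.appell_summable) auto
  qed
  note sf = sm[OF nome_axioms] sm[OF p1.nome_axioms] sm[OF p2.nome_axioms]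
  let ?F = "\<lambda>n. ?f Q n + ?f (w * Q) n + ?f (w ^ 2 * Q) n"
  have F: "?F summable_on UNIV" by (intro summable_on_add sf)
  have A: "(\<Sum>\<^sub>\<infinity>n. ?F n) = appell (Q ^ 2) (1 / r) (w ^ 2) + appell ((w * Q) ^ 2) (1 / r) (w ^ 2) + appell ((w ^ 2 * Q) ^ 2) (1 / r) (w ^ 2)"
    unfolding appell_def by (subst infsum_add, (intro summable_on_add sf)+, subst infsum_add, (rule sf)+) simp
  let ?a = "\<lambda>k. (-1) powi k * r powi (3 * (k * k) - k) / (1 - r powi (2 * k - 1))"
  let ?b = "\<lambda>k. (-1) powi k * r powi (3 * (k * k) + k) / (1 - r powi (6 * k - 1))"
  let ?c = "\<lambda>k. (-1) powi k * r powi (3 * (k * k) + 5 * k + 1) / (1 - r powi (6 * k + 1))"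
  have f0: "?F (3 * k) = 3 * ?a k" for k
    unfolding appell_mod3_terms(1)[OF w, of k, unfolded rw] p1.appell_mod3_terms(1)[OF w, of k, unfolded rw]
      p2.appell_mod3_terms(1)[OF w, of k, unfolded rw] by simp
  have f1: "?F (3 * k + 1) = (- 3 * w ^ 2) * ?b k" for k
  proof -
    define s where "s = r powi (2 * k - 1)"
    have sq: "(w * Q) ^ 2 = w ^ 2 * Q ^ 2" "(w ^ 2 * Q) ^ 2 = w * Q ^ 2"
      using w3[OF w] by (simp add: power_mult_distrib, algebra)
    have "s ^ 3 * r ^ 2 = r powi (6 * k - 1)"
    proof -
      have "s ^ 3 * r ^ 2 = r powi (3 * (2 * k - 1)) * r powi 2" unfolding s_def power_int_power' by (simp add: mult.commute)
      also have "\<dots> = r powi (6 * k - 1)" by (subst power_int_add[symmetric]) auto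
      finally show ?thesis .
    qed
    moreover have "(s * Q ^ 2) ^ 3 = s ^ 3 * r ^ 2" unfolding r_def by algebra
    ultimately have s3: "(s * Q ^ 2) ^ 3 = r powi (6 * k - 1)" by simp
    have "6 * k - 1 = 3 * (2 * k - 1) + 2" by simp
    hence "1 - (s * Q ^ 2) ^ 3 \<noteq> 0" unfolding s3 by (metis r.Q_powi_odd(2))
    from cube_root_average(1)[OF w this] have av: "1 / (1 - s * Q ^ 2) + 1 / (1 - s * (w * Q ^ 2)) + 1 / (1 - s * (w ^ 2 * Q ^ 2)) = 3 / (1 - r powi (6 * k - 1))"
      unfolding s3 .
    have "c / X + c / Z + c / Y = c * (1 / X + 1 / Y + 1 / Z)" for c X Y Z :: complex by (simp add: add_divide_distrib distrib_left)
    note this[of "- (w ^ 2) * ((-1) powi k * r powi (3 * (k * k) + k))" "1 - s * Q ^ 2" "1 - s * (w ^ 2 * Q ^ 2)" "1 - s * (w * Q ^ 2)", unfolded av]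
    thus ?thesis
      unfolding appell_mod3_terms(2)[OF w, of k, unfolded rw] p1.appell_mod3_terms(2)[OF w, of k, unfolded rw]
        p2.appell_mod3_terms(2)[OF w, of k, unfolded rw] unfolding sq s_def by simp
  qed
  have f2: "?F (3 * k + 2) = (3 * w) * ?c k" for k
  proof -
    define t where "t = r powi (2 * k)"
    have sq: "(w * Q) ^ 2 = w ^ 2 * Q ^ 2" "(w ^ 2 * Q) ^ 2 = w * Q ^ 2"
      using w3[OF w] by (simp add: power_mult_distrib, algebra)
    have "(t * Q) ^ 3 = t ^ 3 * r" unfolding r_def by algebra
    also have "\<dots> = r powi (3 * (2 * k)) * r powi 1" unfolding t_def power_int_power' by (simp add: mult.commute)
    also have "\<dots> = r powi (6 * k + 1)" by (subst power_int_add[symmetric]) auto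
    finally have s3: "(t * Q) ^ 3 = r powi (6 * k + 1)" .
    have "6 * k + 1 = 3 * (2 * k) + 1" by simp
    hence "1 - (t * Q) ^ 3 \<noteq> 0" unfolding s3 by (metis r.Q_powi_odd(1))
    \<comment> \<open>The factor \<open>Q ^ 2\<close> in the numerator rotates by
      \<open>w ^ 2\<close> and \<open>w\<close>, so this class needs the average with these
      weights.\<close>
    from cube_root_average(3)[OF w this] have av: "1 / (1 - t * Q) + w ^ 2 / (1 - t * (w * Q)) + w / (1 - t * (w ^ 2 * Q)) = 3 * (t * Q) / (1 - r powi (6 * k + 1))"
      unfolding s3 .
    have g: "c * (q / X) + c * (u * q / Y) + c * (v * q / Z) = c * q * (1 / X + u / Y + v / Z)" for c q u v X Y Z :: complex
      by (simp add: distrib_left mult_ac)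
    have "r powi (3 * (k * k) + 5 * k + 1) = r powi (3 * (k * k) + 3 * k) * (t * Q) * Q ^ 2"
    proof -
      have e: "3 * (k * k) + 5 * k + 1 = (3 * (k * k) + 3 * k) + (2 * k + 1)" by simp
      have "r powi (3 * (k * k) + 5 * k + 1) = r powi (3 * (k * k) + 3 * k) * (t * r)"
        unfolding e t_def by (subst power_int_add, simp, subst power_int_add) auto
      thus ?thesis by (simp add: r_def power3_eq_cube power2_eq_square)
    qed
    thus ?thesis
      unfolding appell_mod3_terms(3)[OF w, of k, unfolded rw] p1.appell_mod3_terms(3)[OF w, of k, unfolded rw]
        p2.appell_mod3_terms(3)[OF w, of k, unfolded rw] unfolding sq t_def[symmetric] g av by simp
  qed
  have "((\<lambda>k. 3 * ?a k + (- 3 * w ^ 2) * ?b k + (3 * w) * ?c k) has_sum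
      (3 * (- r * (r.J 2 * mock_omega r)) + (- 3 * w ^ 2) * S + (3 * w) * (- S))) UNIV"
    unfolding S_def by (intro has_sum_add has_sum_cmult_right r.omega_has_sum r.appell_cube_has_sum)
  hence "(\<Sum>\<^sub>\<infinity>n. ?F n) = 3 * (- r * (r.J 2 * mock_omega r)) + (- 3 * w ^ 2) * S + (3 * w) * (- S)"
    using infsum_int_mod3(1)[OF F] unfolding f0 f1 f2 by (rule has_sum_unique[rotated])
  \<comment> \<open>The classes 1 and 2 enter with \<open>- w ^ 2\<close> and \<open>- w\<close>,
    which add up to 1.\<close>
  also have "\<dots> = 3 * (- r * (r.J 2 * mock_omega r) + S)" using w by algebra
  also have "r.J 2 = J 6" unfolding r.J_def J_def unfolding r_def by (simp flip: power_mult)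
  finally show ?thesis unfolding A unfolding S_def r_def .
qed

section \<open>The generating function over the progression 3 n + 2\<close>

lemma cube_root_nome: obtains p where "p ^ 3 = Q" "nome p"
proof -
  define p where "p = exp (Ln Q / 3)"
  have p: "p ^ 3 = Q" by (simp add: p_def flip: exp_of_nat_mult)
  have "norm p < 1"
  proof (rule ccontr)
    assume "\<not> norm p < 1"
    hence "norm p ^ 3 \<ge> 1" by simp
    thus False using lt1 by (simp flip: p add: norm_power)
  qed
  hence "nome p" by unfold_locales (simp_all add: p_def)
  with p show ?thesis by (rule that)
qed

definition rank_gf32 :: "complex \<Rightarrow> complex" where
  "rank_gf32 z = (\<Sum>n. rank_sum z (3 * n + 2) * Q ^ n)"

lemma rank_gf32_summable: assumes "norm z = 1" shows "summable (\<lambda>n. rank_sum z (3 * n + 2) * Q ^ n)"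
proof -
  obtain p where p: "p ^ 3 = Q" "nome p" by (rule cube_root_nome)
  interpret p: nome p by fact
  have "1 + cis (2 * pi / 3) + cis (2 * pi / 3) ^ 2 = 0"
    by (simp add: complex_eq_iff cos_120 sin_120 power2_eq_square)
  from p.rank_gf_trisection(2)[OF this assms] show ?thesis unfolding p(1) .
qed

lemma rank_gf32_trisection:
  assumes "p ^ 3 = Q" "nome p" "1 + w + w ^ 2 = 0" "norm z = 1"
  shows "3 * p ^ 2 * rank_gf32 z = rank_gf z p + w * rank_gf z (w * p) + w ^ 2 * rank_gf z (w ^ 2 * p)"
  using nome.rank_gf_trisection(1)[OF assms(2-4)] unfolding rank_gf32_def assms(1) by simp

lemma rank_gf32_inverse: assumes "norm z = 1" shows "rank_gf32 (1 / z) = rank_gf32 z"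
proof -
  obtain p where p: "p ^ 3 = Q" "nome p" by (rule cube_root_nome)
  interpret p: nome p by fact
  define w where "w = cis (2 * pi / 3)"
  have w: "1 + w + w ^ 2 = 0"
    by (simp add: w_def complex_eq_iff cos_120 sin_120 power2_eq_square)
  interpret p1: nome "w * p" by (rule p.rotated_nome[OF w])
  interpret p2: nome "w ^ 2 * p" by (rule p.rotated_nome[OF w])
  have "norm (1 / z) = 1" using assms by (simp add: norm_divide)
  hence "3 * p ^ 2 * rank_gf32 (1 / z) = 3 * p ^ 2 * rank_gf32 z"
    using rank_gf32_trisection[OF p w] assms
    by (simp only: p.rank_gf_inverse[OF assms] p1.rank_gf_inverse[OF assms] p2.rank_gf_inverse[OF assms])
  thus ?thesis by simp
qed

context
  fixes w :: complex
  assumes w: "1 + w + w ^ 2 = 0"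
begin

lemma norm_roots: "norm w = 1" "norm (- (w ^ 2)) = 1"
  using w_norm[OF w] by (simp_all add: norm_power)

text \<open>The denominator is invariant under rotation, so only the square of
  \<open>Y + p * X\<close> is averaged; with the weights 1, \<open>w\<close>, \<open>w ^ 2\<close>
  just its term in \<open>p ^ 2\<close> survives.\<close>

lemma rank_gf32_sum: "3 * rank_gf32 (- (w ^ 2)) + rank_gf32 w = theta (Q ^ 3) (-1) ^ 2 / J 2"
proof -
  obtain p where p: "p ^ 3 = Q" "nome p" by (rule cube_root_nome)
  interpret p: nome p by fact
  interpret p1: nome "w * p" by (rule p.rotated_nome[OF w])
  interpret p2: nome "w ^ 2 * p" by (rule p.rotated_nome[OF w])
  have p6: "p ^ 6 = Q ^ 2" "p ^ 9 = Q ^ 3" "(w * p) ^ 6 = Q ^ 2" "(w * p) ^ 9 = Q ^ 3" "(w ^ 2 * p) ^ 6 = Q ^ 2" "(w ^ 2 * p) ^ 9 = Q ^ 3"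
    using p.rotated_cubes[OF w, of 2] p.rotated_cubes[OF w, of 3] by (simp_all add: p(1)[symmetric] flip: power_mult)
  define X Y where "X = theta (Q ^ 3) (-1)" and "Y = psi0 Q"
  have J: "p.J 6 = J 2" "p1.J 6 = J 2" "p2.J 6 = J 2" by (simp_all only: p.J_def p1.J_def p2.J_def J_def p6)
  have T: "theta p (-1) = Y + p * X" "theta (w * p) (-1) = Y + w * p * X" "theta (w ^ 2 * p) (-1) = Y + w ^ 2 * p * X"
    by (simp_all only: p.psi_trisection p1.psi_trisection p2.psi_trisection p.rotated_cube[OF w] p6 p(1) X_def Y_def)
  have "3 * p ^ 2 * (3 * rank_gf32 (- (w ^ 2)) + rank_gf32 w) = 3 * (3 * p ^ 2 * rank_gf32 (- (w ^ 2))) + 3 * p ^ 2 * rank_gf32 w"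
    by (simp add: algebra_simps)
  also have "\<dots> = (3 * rank_gf (- (w ^ 2)) p + rank_gf w p) + w * (3 * rank_gf (- (w ^ 2)) (w * p) + rank_gf w (w * p))
      + w ^ 2 * (3 * rank_gf (- (w ^ 2)) (w ^ 2 * p) + rank_gf w (w ^ 2 * p))"
    unfolding rank_gf32_trisection[OF p w norm_roots(1)] rank_gf32_trisection[OF p w norm_roots(2)]
    by (simp add: algebra_simps)
  also have "\<dots> = ((Y + p * X) ^ 2 + w * (Y + w * p * X) ^ 2 + w ^ 2 * (Y + w ^ 2 * p * X) ^ 2) / J 2"
    unfolding p.rank_gf_sum[OF w] p1.rank_gf_sum[OF w] p2.rank_gf_sum[OF w] J T
    by (simp add: add_divide_distrib)
  also have "(Y + p * X) ^ 2 + w * (Y + w * p * X) ^ 2 + w ^ 2 * (Y + w ^ 2 * p * X) ^ 2 = 3 * p ^ 2 * X ^ 2"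
    using w by algebra
  finally have "3 * p ^ 2 * (3 * rank_gf32 (- (w ^ 2)) + rank_gf32 w) = 3 * p ^ 2 * (X ^ 2 / J 2)" by simp
  thus ?thesis unfolding X_def[symmetric] by (subst (asm) mult_left_cancel) auto
qed

text \<open>The constant of \<open>rank_gf_diff\<close> is killed by
  \<open>1 + w + w ^ 2 = 0\<close>. The weights cancel against the rotated factor
  \<open>1 / p\<close>, so the three Appell sums are added without weights, as in
  \<open>appell_rotated_sum\<close>.\<close>

lemma rank_gf32_diff: "3 * rank_gf32 (- (w ^ 2)) - rank_gf32 w = 4 * mock_omega Q + 4 * (U + V) / J 2"
proof -
  obtain p where p: "p ^ 3 = Q" "nome p" by (rule cube_root_nome)
  interpret p: nome p by fact
  interpret p1: nome "w * p" by (rule p.rotated_nome[OF w])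
  interpret p2: nome "w ^ 2 * p" by (rule p.rotated_nome[OF w])
  have p6: "p ^ 6 = Q ^ 2" "(w * p) ^ 6 = Q ^ 2" "(w ^ 2 * p) ^ 6 = Q ^ 2"
    using p.rotated_cubes[OF w, of 2] by (simp_all add: p(1)[symmetric] flip: power_mult)
  have J: "p.J 6 = J 2" "p1.J 6 = J 2" "p2.J 6 = J 2" by (simp_all only: p.J_def p1.J_def p2.J_def J_def p6)
  define A B C c where "A = appell (p ^ 2) (1 / Q) (w ^ 2)" and "B = appell ((w * p) ^ 2) (1 / Q) (w ^ 2)"
    and "C = appell ((w ^ 2 * p) ^ 2) (1 / Q) (w ^ 2)" and "c = 6 * w ^ 2 / (1 - w)"
  have ABC: "A + B + C = 3 * (- Q * (J 2 * mock_omega Q) + - Q * (U + V))"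
    using p.appell_rotated_sum[OF w] unfolding p(1) J appell_UV A_def B_def C_def .
  have D: "3 * rank_gf (- (w ^ 2)) p - rank_gf w p = c - 4 * A / (p * J 2)"
    "3 * rank_gf (- (w ^ 2)) (w * p) - rank_gf w (w * p) = c - 4 * B / (w * p * J 2)"
    "3 * rank_gf (- (w ^ 2)) (w ^ 2 * p) - rank_gf w (w ^ 2 * p) = c - 4 * C / (w ^ 2 * p * J 2)"
    using p.rank_gf_diff[OF w] p1.rank_gf_diff[OF w] p2.rank_gf_diff[OF w]
    unfolding p.rotated_cube[OF w] p(1) J A_def B_def C_def c_def by simp_all
  have "3 * p ^ 2 * (3 * rank_gf32 (- (w ^ 2)) - rank_gf32 w) = 3 * (3 * p ^ 2 * rank_gf32 (- (w ^ 2))) - 3 * p ^ 2 * rank_gf32 w"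
    by (simp add: algebra_simps)
  also have "\<dots> = (3 * rank_gf (- (w ^ 2)) p - rank_gf w p) + w * (3 * rank_gf (- (w ^ 2)) (w * p) - rank_gf w (w * p))
      + w ^ 2 * (3 * rank_gf (- (w ^ 2)) (w ^ 2 * p) - rank_gf w (w ^ 2 * p))"
    unfolding rank_gf32_trisection[OF p w norm_roots(1)] rank_gf32_trisection[OF p w norm_roots(2)]
    by (simp add: algebra_simps)
  also have "\<dots> = c * (1 + w + w ^ 2) - 4 / (p * J 2) * (A + B + C)"
    unfolding D using w_nz[OF w] J_nz[of 2] by (simp add: field_simps)
  also have "\<dots> = - 4 / (p * J 2) * (A + B + C)" unfolding w by simp
  also have "\<dots> = 3 * p ^ 2 * (4 * mock_omega Q + 4 * (U + V) / J 2)"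
  proof -
    have "- 4 / (x * j) * (3 * (- (x ^ 3) * (j * m) + - (x ^ 3) * u)) = 3 * x ^ 2 * (4 * m + 4 * u / j)"
      if "x \<noteq> 0" "j \<noteq> 0" for x j m u :: complex
      using that by (simp add: divide_simps) algebra
    from this[OF p.nz J_nz[of 2], of "mock_omega Q" "U + V"] show ?thesis unfolding ABC p(1) by simp
  qed
  finally show ?thesis by simp
qed

text \<open>The three reciprocals are put over the product of the rotated theta functions, a
  function of \<open>p ^ 3\<close> known from \<open>qpoch_inf_trisection\<close>. The weighted
  numerator reduces to the square of the linear part in \<open>phi_trisection\<close>.\<close>

lemma rank_gf32_1: "rank_gf32 1 = 4 * theta (Q ^ 6) Q ^ 2 / (J 1 ^ 8 * J 6 / (J 2 ^ 4 * J 3 ^ 2))"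
proof -
  obtain p where p: "p ^ 3 = Q" "nome p" by (rule cube_root_nome)
  interpret p: nome p by fact
  interpret P: nome "p ^ 2" by (rule p.nome_power) simp
  interpret p1: nome "w * p" by (rule p.rotated_nome[OF w])
  interpret p2: nome "w ^ 2 * p" by (rule p.rotated_nome[OF w])
  define a b where "a = theta (Q ^ 6) (Q ^ 3)" and "b = theta (Q ^ 6) Q"
  have T: "theta (p ^ 2) p = a - 2 * p * b" "theta ((w * p) ^ 2) (w * p) = a - 2 * (w * p) * b"
    "theta ((w ^ 2 * p) ^ 2) (w ^ 2 * p) = a - 2 * (w ^ 2 * p) * b"
    unfolding p.phi_trisection p1.phi_trisection p2.phi_trisection p.rotated_cube[OF w] p(1) a_def b_def by simp_all
  have JJ: "theta (p ^ 2) p = p.J 1 ^ 2 / p.J 2" "theta ((w * p) ^ 2) (w * p) = p1.J 1 ^ 2 / p1.J 2"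
    "theta ((w ^ 2 * p) ^ 2) (w ^ 2 * p) = p2.J 1 ^ 2 / p2.J 2" by (rule p.phi_product p1.phi_product p2.phi_product)+
  have p9: "p ^ 9 = Q ^ 3" "(p ^ 2) ^ 3 = Q ^ 2" "(p ^ 2) ^ 9 = Q ^ 6" by (simp_all add: p(1)[symmetric] flip: power_mult)
  have J1: "p.J 1 * p1.J 1 * p2.J 1 = J 1 ^ 4 / J 3"
    using p.qpoch_inf_trisection[OF w] unfolding p.J_def p1.J_def p2.J_def J_def p(1) p9 power_one_right .
  have J2: "p.J 2 * p1.J 2 * p2.J 2 = J 2 ^ 4 / J 6"
  proof -
    have e: "w * p ^ 2 = (w ^ 2 * p) ^ 2" using w by algebra
    have e': "w ^ 2 * p ^ 2 = (w * p) ^ 2" by algebra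
    show ?thesis using P.qpoch_inf_trisection[OF w] unfolding p.J_def p1.J_def p2.J_def J_def P.J_def p9 e e' by (simp add: mult_ac)
  qed
  have "(a - 2 * p * b) * (a - 2 * (w * p) * b) * (a - 2 * (w ^ 2 * p) * b) = (p.J 1 * p1.J 1 * p2.J 1) ^ 2 / (p.J 2 * p1.J 2 * p2.J 2)"
    unfolding T[symmetric] JJ by (simp add: power_mult_distrib)
  also have "\<dots> = (J 1 ^ 4 / J 3) ^ 2 / (J 2 ^ 4 / J 6)" unfolding J1 J2 ..
  also have "\<dots> = J 1 ^ 8 * J 6 / (J 2 ^ 4 * J 3 ^ 2)"
    by (simp add: power_divide flip: power_mult)
  finally have D: "(a - 2 * p * b) * (a - 2 * (w * p) * b) * (a - 2 * (w ^ 2 * p) * b) = J 1 ^ 8 * J 6 / (J 2 ^ 4 * J 3 ^ 2)" .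
  have nz: "(a - 2 * p * b) * (a - 2 * (w * p) * b) * (a - 2 * (w ^ 2 * p) * b) \<noteq> 0"
    unfolding D using J_nz[of 1] J_nz[of 2] J_nz[of 3] J_nz[of 6] by simp
  have gen: "1 / X + w * (1 / Y) + w ^ 2 * (1 / Z) = (Y * Z + w * (X * Z) + w ^ 2 * (X * Y)) / (X * Y * Z)"
    if "X * Y * Z \<noteq> 0" for X Y Z :: complex
    using that by (simp add: divide_simps) (simp add: algebra_simps)
  have "3 * p ^ 2 * rank_gf32 1 = 1 / (a - 2 * p * b) + w * (1 / (a - 2 * (w * p) * b)) + w ^ 2 * (1 / (a - 2 * (w ^ 2 * p) * b))"
    unfolding rank_gf32_trisection[OF p w norm_one] p.rank_gf_1 p1.rank_gf_1 p2.rank_gf_1 T ..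
  also have "\<dots> = 3 * p ^ 2 * (4 * b ^ 2) / (J 1 ^ 8 * J 6 / (J 2 ^ 4 * J 3 ^ 2))"
  proof -
    have "(a - 2 * (w * p) * b) * (a - 2 * (w ^ 2 * p) * b) + w * ((a - 2 * p * b) * (a - 2 * (w ^ 2 * p) * b)) + w ^ 2 * ((a - 2 * p * b) * (a - 2 * (w * p) * b))
       = 3 * p ^ 2 * (4 * b ^ 2)" using w by algebra
    thus ?thesis unfolding gen[OF nz] D by simp
  qed
  finally have "3 * p ^ 2 * rank_gf32 1 = 3 * p ^ 2 * (4 * b ^ 2 / (J 1 ^ 8 * J 6 / (J 2 ^ 4 * J 3 ^ 2)))" by simp
  thus ?thesis unfolding b_def[symmetric] by (subst (asm) mult_left_cancel) auto
qed

end

section \<open>Theta quotients and the values at the roots of unity\<close>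

lemma theta_Q6_Q3: "theta (Q ^ 6) (Q ^ 3) = J 3 ^ 2 / J 6"
proof -
  interpret r: nome "Q ^ 3" by (rule nome_power) simp
  have "r.J 1 = J 3" "r.J 2 = J 6" "(Q ^ 3) ^ 2 = Q ^ 6" unfolding r.J_def J_def by (simp_all flip: power_mult)
  thus ?thesis using r.phi_product by simp
qed

text \<open>Both sides are quotients of \<open>J 3\<close> and \<open>J 6\<close>. This links the
  sum of the rank functions to the same \<open>U\<close> that occurs in \<open>mock_omega\<close>
  and \<open>mock_rho\<close>.\<close>

lemma theta_Q3_sq: "theta (Q ^ 3) (-1) ^ 2 = 4 * U"
proof -
  interpret r: nome "Q ^ 3" by (rule nome_power) simp
  have "r.J 1 = J 3" "r.J 2 = J 6" unfolding r.J_def J_def by (simp_all flip: power_mult)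
  hence "theta (Q ^ 3) (-1) ^ 2 = 4 * (J 6 ^ 4 / J 3 ^ 2)" using r.psi_product by (simp add: power_mult_distrib power_divide flip: power_mult)
  also have "J 6 ^ 4 / J 3 ^ 2 = U"
  proof -
    have "U = x ^ 4 / y ^ 2" if "y ^ 2 / x * U = x ^ 3" "x \<noteq> 0" "y \<noteq> 0" for x y
      using that by (simp add: field_simps eval_nat_numeral)
    from this[OF U_product[unfolded theta_Q6_Q3] J_nz J_nz] show ?thesis by simp
  qed
  finally show ?thesis .
qed

lemma theta_Q6_Q: "theta (Q ^ 6) Q = J 1 * J 6 ^ 2 / (J 2 * J 3)"
proof -
  interpret Q2: nome "Q ^ 2" by (rule nome_power) simp
  interpret Q3: nome "Q ^ 3" by (rule nome_power) simp
  interpret Q6: nome "Q ^ 6" by (rule nome_power) simp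
  have e: "(Q ^ 2) ^ 3 = Q ^ 6" "(Q ^ 3) ^ 2 = Q ^ 6" "Q ^ 3 * Q ^ 3 = Q ^ 6" "Q * Q ^ 2 = Q ^ 3" "Q * (Q ^ 2) ^ 2 = Q ^ 5" "Q * Q = Q ^ 2" "Q ^ 6 / Q = Q ^ 5"
    by (simp_all add: eval_nat_numeral)
  define x where "x = qpoch_inf (Q ^ 3) (Q ^ 6)"
  have J3: "J 3 = x * J 6" using Q3.qpoch_inf_2[of "Q ^ 3"] unfolding e by (simp add: J_def x_def)
  have "qpoch_inf Q (Q ^ 2) = qpoch_inf Q (Q ^ 6) * x * qpoch_inf (Q ^ 5) (Q ^ 6)"
    using Q2.qpoch_inf_3[of Q] unfolding e x_def .
  hence J1: "J 1 = qpoch_inf Q (Q ^ 6) * x * qpoch_inf (Q ^ 5) (Q ^ 6) * J 2"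
    using qpoch_inf_2[of Q] unfolding e by (simp add: J_def)
  have "theta (Q ^ 6) Q = qpoch_inf Q (Q ^ 6) * qpoch_inf (Q ^ 5) (Q ^ 6) * J 6"
    using Q6.jacobi_triple[of Q] by (simp add: jtheta_def e J_def)
  thus ?thesis unfolding J1 using J3 J_nz[of 2] J_nz[of 3] J_nz[of 6] by (simp add: power2_eq_square)
qed

lemma M_quot_J: "M_quot Q = 4 * J 6 ^ 12 / (3 * theta (Q ^ 6) Q ^ 6 * J 2 ^ 4 * theta (Q ^ 6) (Q ^ 3) ^ 3)"
proof -
  interpret Q6: nome "Q ^ 6" by (rule nome_power) simp
  show ?thesis unfolding M_quot_def J1_def J2_def J_def by (simp add: Q6.jacobi_triple)
qed

context
  fixes w :: complex
  assumes w: "1 + w + w ^ 2 = 0"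
begin

lemma rank_gf32_1_M: "rank_gf32 1 = 3 * M_quot Q"
proof -
  have "4 * (a * f ^ 2 / (b * c)) ^ 2 / (a ^ 8 * f / (b ^ 4 * c ^ 2)) = 3 * (4 * f ^ 12 / (3 * (a * f ^ 2 / (b * c)) ^ 6 * b ^ 4 * (c ^ 2 / f) ^ 3))"
    if "a \<noteq> 0" "b \<noteq> 0" "c \<noteq> 0" "f \<noteq> 0" for a b c f :: complex
    using that by (simp add: power_mult_distrib power_divide divide_simps flip: power_mult) algebra
  from this[OF J_nz J_nz J_nz J_nz, of 1 2 3 6] show ?thesis
    unfolding rank_gf32_1[OF w] M_quot_J theta_Q6_Q theta_Q6_Q3 by simp
qed

lemma rank_gf32_w: "rank_gf32 w = U / J 2 - 3 * mock_omega Q"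
  and rank_gf32_w6: "rank_gf32 (- (w ^ 2)) = U / J 2 + mock_omega Q"
proof -
  define T where "T = U / J 2"
  have J2: "J 2 \<noteq> 0" by (rule J_nz) simp
  have 1: "3 * rank_gf32 (- (w ^ 2)) + rank_gf32 w = 4 * T"
    unfolding rank_gf32_sum[OF w] theta_Q3_sq T_def by simp
  have "2 * (U + V) = J 2 * mock_omega Q + U" unfolding omega_UV by simp
  hence "2 * ((U + V) / J 2) = mock_omega Q + T" using J2 unfolding T_def by (simp add: field_simps)
  hence 2: "3 * rank_gf32 (- (w ^ 2)) - rank_gf32 w = 6 * mock_omega Q + 2 * T"
    unfolding rank_gf32_diff[OF w] times_divide_eq_right[symmetric] by algebra
  show "rank_gf32 w = U / J 2 - 3 * mock_omega Q" "rank_gf32 (- (w ^ 2)) = U / J 2 + mock_omega Q"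
    unfolding T_def[symmetric] using 1 2 by algebra+
qed

text \<open>Eliminates \<open>V\<close>, so that the theta quotient \<open>U / J 2\<close> can be
  expressed by the two mock theta functions.\<close>

lemma rho_omega: "2 * mock_rho Q = 3 * (U / J 2) - mock_omega Q"
proof -
  have "J 2 * (2 * mock_rho Q) = 3 * U - J 2 * mock_omega Q"
    using rho_UV[OF w] omega_UV by algebra
  thus ?thesis using J_nz[of 2] by (simp add: field_simps)
qed

section \<open>Ranks modulo six\<close>

lemma sixth_root_filter:
  fixes m :: int
  defines "g \<equiv> - (w ^ 2)"
  shows "(\<Sum>j<6. (g ^ j) powi m) = (if [m = 0] (mod 6) then 6 else 0)"
proof -
  define x where "x = g powi m"
  have g: "g ^ 2 = w" "g \<noteq> 0" using w3[OF w] w_nz[OF w] unfolding g_def by (algebra, simp)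
  have "(g ^ j) powi m = x ^ j" for j
    unfolding x_def by (simp add: power_int_power power_int_power' mult.commute)
  moreover have "(\<Sum>j<6. x ^ j) = 1 + x + x ^ 2 + x ^ 3 + x ^ 4 + x ^ 5" by (simp add: eval_nat_numeral)
  ultimately have s: "(\<Sum>j<6. (g ^ j) powi m) = 1 + x + x ^ 2 + x ^ 3 + x ^ 4 + x ^ 5" by simp
  have "g ^ 6 = 1" using w3[OF w] unfolding g_def by algebra
  have "x = g powi (6 * (m div 6) + m mod 6)" by (simp add: x_def)
  also have "\<dots> = (g ^ 6) powi (m div 6) * g powi (m mod 6)"
    unfolding power_int_power using g by (subst power_int_add[symmetric]) auto
  finally have x: "x = g powi (m mod 6)" using \<open>g ^ 6 = 1\<close> by simp
  have "m mod 6 \<in> {0, 1, 2, 3, 4, 5}" using pos_mod_bound[of 6 m] pos_mod_sign[of 6 m] by auto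
  then consider "m mod 6 = 0" "x = 1" | "m mod 6 = 1" "x = - (w ^ 2)" | "m mod 6 = 2" "x = w" | "m mod 6 = 3" "x = - 1"
    | "m mod 6 = 4" "x = w ^ 2" | "m mod 6 = 5" "x = - w"
  proof -
    have "g ^ 3 = - 1" "g ^ 4 = w ^ 2" "g ^ 5 = - w" using w3[OF w] unfolding g_def by (algebra, algebra, algebra)
    thus ?thesis using that x g \<open>m mod 6 \<in> _\<close> by (auto simp: g_def)
  qed
  thus ?thesis
  proof cases
    case 1 thus ?thesis unfolding s by (simp add: cong_def)
  next
    case 2
    have "1 + x + x ^ 2 + x ^ 3 + x ^ 4 + x ^ 5 = 0" unfolding 2(2) using w by algebra
    thus ?thesis unfolding s using 2(1) by (simp add: cong_def)
  next
    case 3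
    have "1 + x + x ^ 2 + x ^ 3 + x ^ 4 + x ^ 5 = 0" unfolding 3(2) using w by algebra
    thus ?thesis unfolding s using 3(1) by (simp add: cong_def)
  next
    case 4 thus ?thesis unfolding s by (simp add: cong_def)
  next
    case 5
    have "1 + x + x ^ 2 + x ^ 3 + x ^ 4 + x ^ 5 = 0" unfolding 5(2) using w by algebra
    thus ?thesis unfolding s using 5(1) by (simp add: cong_def)
  next
    case 6
    have "1 + x + x ^ 2 + x ^ 3 + x ^ 4 + x ^ 5 = 0" unfolding 6(2) using w by algebra
    thus ?thesis unfolding s using 6(1) by (simp add: cong_def)
  qed
qed

text \<open>Orthogonality over the powers of the primitive sixth root \<open>- (w ^ 2)\<close>,
  applied to the rank minus \<open>s\<close>.\<close>

lemma Nbar_filter: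
  defines "g \<equiv> - (w ^ 2)"
  shows "6 * of_nat (Nbar s 6 n) = (\<Sum>j<6. (g ^ j) powi (- s) * rank_sum (g ^ j) n)"
proof -
  have g: "g \<noteq> 0" using w_nz[OF w] by (simp add: g_def)
  have "(\<Sum>j<6. (g ^ j) powi (- s) * rank_sum (g ^ j) n)
     = (\<Sum>j<6. \<Sum>p\<in>overpartitions n. (g ^ j) powi (overpartition_rank p - s))"
    unfolding rank_sum_def sum_distrib_left using g by (simp add: power_int_add[symmetric])
  also have "\<dots> = (\<Sum>p\<in>overpartitions n. if [overpartition_rank p - s = 0] (mod 6) then 6 else 0)"
    unfolding g_def sixth_root_filter[symmetric] by (rule sum.swap)
  also have "\<dots> = (\<Sum>p\<in>overpartitions n. if [overpartition_rank p = s] (mod 6) then 6 else 0)"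
    by (simp add: cong_iff_dvd_diff)
  also have "\<dots> = 6 * of_nat (card {p \<in> overpartitions n. [overpartition_rank p = s] (mod 6)})"
    using finite_overpartitions[of n] by (simp add: sum.If_cases Int_def mult.commute)
  finally show ?thesis by (simp add: Nbar_def)
qed

lemma rbar_filter:
  defines "g \<equiv> - (w ^ 2)"
  shows "6 * rbar s 2 Q = (\<Sum>j<6. (g ^ j) powi (- s) * rank_gf32 (g ^ j))"
proof -
  have "norm (g ^ j) = 1" for j using norm_roots(2)[OF w] by (simp add: g_def norm_power)
  hence "(\<lambda>n. \<Sum>j<6. (g ^ j) powi (- s) * (rank_sum (g ^ j) (3 * n + 2) * Q ^ n)) sums
      (\<Sum>j<6. (g ^ j) powi (- s) * rank_gf32 (g ^ j))"
    unfolding rank_gf32_def by (intro sums_sum sums_mult summable_sums rank_gf32_summable)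
  moreover have "(\<Sum>j<6. (g ^ j) powi (- s) * (rank_sum (g ^ j) (3 * n + 2) * Q ^ n)) = 6 * (of_nat (Nbar s 6 (3 * n + 2)) * Q ^ n)" for n
    using Nbar_filter[of s "3 * n + 2"] unfolding g_def by (simp only: sum_distrib_right mult.assoc[symmetric])
  ultimately have "(\<lambda>n. 6 * (of_nat (Nbar s 6 (3 * n + 2)) * Q ^ n)) sums (\<Sum>j<6. (g ^ j) powi (- s) * rank_gf32 (g ^ j))"
    by simp
  from sums_divide[OF this, of 6] have "rbar s 2 Q = (\<Sum>j<6. (g ^ j) powi (- s) * rank_gf32 (g ^ j)) / 6"
    unfolding rbar_def by (intro sums_unique[symmetric]) simp
  thus ?thesis by (simp only:) simp
qed

text \<open>The powers 4 and 5 of \<open>g\<close> are inverse to the powers 2 and 1, and the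
  generating function is invariant under inversion of \<open>z\<close>; so six values reduce to
  four.\<close>

lemma rbar_values:
  fixes F1 Fg Fw Fm :: complex
  defines "F1 \<equiv> rank_gf32 1" and "Fg \<equiv> rank_gf32 (- (w ^ 2))" and "Fw \<equiv> rank_gf32 w" and "Fm \<equiv> rank_gf32 (- 1)"
  shows "6 * rbar 0 2 Q = F1 + 2 * Fg + 2 * Fw + Fm" "6 * rbar 1 2 Q = F1 + Fg - Fw - Fm"
    "6 * rbar 2 2 Q = F1 - Fg - Fw + Fm" "6 * rbar 3 2 Q = F1 - 2 * Fg + 2 * Fw - Fm"
proof -
  define g where "g = - (w ^ 2)"
  have g: "g ^ 0 = 1" "g ^ 1 = g" "g ^ 2 = w" "g ^ 3 = - 1" "g ^ 4 = 1 / w" "g ^ 5 = 1 / g" "1 / g = - w" "1 / w = w ^ 2"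
  proof -
    show "g ^ 2 = w" "g ^ 3 = - 1" using w3[OF w] unfolding g_def by (algebra, algebra)
    show "1 / w = w ^ 2" by (rule w_inv[OF w])
    show "g ^ 4 = 1 / w" unfolding w_inv[OF w] using w3[OF w] unfolding g_def by algebra
    have "g * - w = 1" using w3[OF w] unfolding g_def by algebra
    thus i: "1 / g = - w" by (metis divide_eq_eq mult.commute mult_eq_0_iff nonzero_eq_divide_eq zero_neq_one)
    show "g ^ 5 = 1 / g" unfolding i using w3[OF w] unfolding g_def by algebra
  qed simp_all
  have F: "rank_gf32 (1 / g) = Fg" "rank_gf32 (1 / w) = Fw" "rank_gf32 g = Fg"
    unfolding Fg_def Fw_def g_def using norm_roots[OF w] by (simp_all only: rank_gf32_inverse)
  have s: "6 * rbar s 2 Q = F1 + g powi (- s) * Fg + w powi (- s) * Fw + (- 1) powi (- s) * Fm + (1 / w) powi (- s) * Fw + (1 / g) powi (- s) * Fg" for s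
  proof -
    have six: "(\<Sum>j<6. h j) = h 0 + h 1 + h 2 + h 3 + h 4 + h 5" for h :: "nat \<Rightarrow> complex" by (simp add: eval_nat_numeral)
    show ?thesis unfolding rbar_filter g_def[symmetric] six unfolding g(1-6) F by (simp add: F1_def Fw_def Fm_def)
  qed
  have i: "x powi (- 1) = 1 / x" "x powi (- 2) = (1 / x) ^ 2" "x powi (- 3) = (1 / x) ^ 3" for x :: complex
    by (simp_all add: power_int_minus_divide power_divide)
  have ii: "1 / (1 / w) = w" "1 / (1 / g) = g" "1 / (- 1 :: complex) = - 1" by simp_all
  show "6 * rbar 0 2 Q = F1 + 2 * Fg + 2 * Fw + Fm" unfolding s by simp
  show "6 * rbar 1 2 Q = F1 + Fg - Fw - Fm"
    unfolding s i ii unfolding g unfolding g_def using w by algebra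
  show "6 * rbar 2 2 Q = F1 - Fg - Fw + Fm"
    unfolding s i ii unfolding g unfolding g_def using w by algebra
  show "6 * rbar 3 2 Q = F1 - 2 * Fg + 2 * Fw - Fm"
    unfolding s i ii unfolding g unfolding g_def using w by algebra
qed

end

end

theorem theorem1p4:
  fixes q :: complex
  assumes "0 < norm q" and "norm q < 1"
  shows "rbar 0 2 q + rbar 3 2 q = 4/9 * mock_rho q - 16/9 * mock_omega q + M_quot q
    \<and> rbar 1 2 q - rbar 3 2 q = 2 * mock_omega q
    \<and> rbar 2 2 q + rbar 3 2 q = - (2/9) * mock_rho q - 10/9 * mock_omega q + M_quot q"
proof -
  interpret nome q using assms by unfold_locales auto
  have w: "1 + cis (2 * pi / 3) + cis (2 * pi / 3) ^ 2 = 0"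
    by (simp add: complex_eq_iff cos_120 sin_120 power2_eq_square)
  define T where "T = U / J 2"
  note v = rbar_values[OF w, unfolded rank_gf32_1_M[OF w] rank_gf32_w[OF w] rank_gf32_w6[OF w], folded T_def]
  have rho: "mock_rho q = (3 * T - mock_omega q) / 2" using arg_cong[OF rho_omega[OF w], of "\<lambda>x. x / 2"] unfolding T_def[symmetric] by simp
  show ?thesis
  proof (intro conjI)
    \<comment> \<open>In this and the next two combinations the value at \<open>- 1\<close> cancels,
      and the rest depends on \<open>M_quot q\<close>, \<open>T\<close> and
      \<open>mock_omega q\<close> only.\<close>
    have "6 * (rbar 0 2 q + rbar 3 2 q) = 6 * (4/9 * mock_rho q - 16/9 * mock_omega q + M_quot q)"
      unfolding distrib_left[of 6 "rbar _ _ _"] v rho by (simp add: field_simps)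
    thus "rbar 0 2 q + rbar 3 2 q = 4/9 * mock_rho q - 16/9 * mock_omega q + M_quot q" by (subst (asm) mult_left_cancel) auto
    have "6 * (rbar 1 2 q - rbar 3 2 q) = 6 * (2 * mock_omega q)"
      unfolding right_diff_distrib[of 6 "rbar _ _ _"] v by (simp add: field_simps)
    thus "rbar 1 2 q - rbar 3 2 q = 2 * mock_omega q" by (subst (asm) mult_left_cancel) auto
    have "6 * (rbar 2 2 q + rbar 3 2 q) = 6 * (- (2/9) * mock_rho q - 10/9 * mock_omega q + M_quot q)"
      unfolding distrib_left[of 6 "rbar _ _ _"] v rho by (simp add: field_simps)
    thus "rbar 2 2 q + rbar 3 2 q = - (2/9) * mock_rho q - 10/9 * mock_omega q + M_quot q" by (subst (asm) mult_left_cancel) auto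
  qed
qed

end
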